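(* Assume that $\Phi$ is either strictly convex ($\mu'(r)>0$) or strictly concave ($\mu'(r)<0$) on $(0,+\infty)$, that $0<S^-_\phi\le S^+_\phi<+\infty$, and that the finite element spaces satisfy the compatibility conditions given in the context. Then, for every $c_{h,0}\in C_h^+$, the problem $$\frac{dc_h}{dt}=|Du_h[c_h]|^2-c_h,\qquad c_h(0)=c_{h,0},$$ (in both the scalar and the incompressible vector-valued case) has a unique global solution $c_h\in C^1([0,+\infty);C_h)$ with $c_h(t)\in C_h^+$ for all $t\ge0$. Moreover, for each fixed time $T<+\infty$ there exists $\epsilon(T)>0$ such that $$\epsilon(T)\le c_h(t)\le 1/\epsilon(T)\quad\text{a.e. in }\Omega,\quad\forall\,0\le t\le T.$$
   Context: $\Omega\subset\mathbb{R}^d$, $d=2,3$, is an open bounded domain. $\phi:[0,+\infty)\to[0,+\infty)$ is an N-function: convex, continuous, $\phi(0)=0$, $\phi(r)>0$ for $r>0$, $\lim_{r\to0}\phi(r)/r=0$, $\lim_{r\to+\infty}\phi(r)/r=+\infty$. Standing assumptions: $\phi\in C^1([0,+\infty))\cap C^3((0,+\infty))$; $\inf_{r>0}\frac{r\phi'(r)}{\phi(r)}>1$ and $\sup_{r>0}\frac{r\phi'(r)}{\phi(r)}<+\infty$. Set $\Phi(r):=\phi(\sqrt r)$, $\mu(r):=2\Phi'(r)=\phi'(\sqrt r)/\sqrt r$ for $r>0$, and $$S^-_\phi:=\inf_{r>0}\frac{r\phi''(r)}{\phi'(r)},\qquad S^+_\phi:=\sup_{r>0}\frac{r\phi''(r)}{\phi'(r)}.$$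 Finite element spaces: $C_h$, $U_h\subset H^1_0(\Omega)$, $\boldsymbol U_h\subset H^1_0(\Omega;\mathbb{R}^d)$, $Q_h\subset Q:=\{p\in L^2(\Omega):\int_\Omega p\,dx=0\}$ are finite-dimensional (finite element) spaces of functions on $\Omega$. Write $\varepsilon(\boldsymbol u):=\tfrac12(\nabla\boldsymbol u+\nabla\boldsymbol u^T)$. Compatibility conditions: $C_h\subset L^\infty(\Omega)$; $|\nabla u_h|^2\in C_h$ for all $u_h\in U_h$; $|\varepsilon(\boldsymbol u_h)|^2\in C_h$ for all $\boldsymbol u_h\in\boldsymbol U_h$; and $\boldsymbol U_h\times Q_h$ is an inf-sup stable pair for the weighted Stokes system (the last two conditions concern the vector-valued case). Let $W_h:=U_h$ and $D:=\nabla$ in the scalar case; $W_h:=\{\boldsymbol u_h\in\boldsymbol U_h:\int_\Omega q\,\nabla\cdot\boldsymbol u_h\,dx=0\ \forall q\in Q_h\}$ and $D:=\varepsilon$ in the incompressible vector-valued case. $Du:Dv$ denotes the Euclidean/Frobenius inner product. $F$ is a bounded linear functional on $H^1_0(\Omega)$ (scalar case) or $H^1_0(\Omega;\mathbb{R}^d)$ (vector case). $C_h^+:=\{c_h\in C_h:\operatorname{ess\,inf}_{x\in\Omega}c_h(x)>0\}$. For $c_h\in C_h^+$, $u_h[c_h]\in W_h$ denotes the unique solution of $\int_\Omega\mu(c_h)\,Du_h[c_h]:Dv_h\,dx=F(v_h)$ for all $v_h\in W_h$. *)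

theory Defs
  imports "HOL-Analysis.Analysis" "HOL-Probability.Essential_Supremum"
begin

section \<open>N-functions\<close>

definition N_function :: "(real \<Rightarrow> real) \<Rightarrow> bool" where
  "N_function \<phi> \<longleftrightarrow>
     convex_on {0..} \<phi> \<and> continuous_on {0..} \<phi> \<and> \<phi> 0 = 0 \<and> (\<forall>r>0. \<phi> r > 0) \<and>
     ((\<lambda>r. \<phi> r / r) \<longlongrightarrow> 0) (at_right 0) \<and>
     filterlim (\<lambda>r. \<phi> r / r) at_top at_top"

text \<open>Only the values of \<open>\<phi>\<close> on \<open>[0,\<infinity>)\<close> matter; at \<open>0\<close> the derivative is one-sided.\<close>

definition C1_on_nonneg :: "(real \<Rightarrow> real) \<Rightarrow> bool" where
  "C1_on_nonneg \<phi> \<longleftrightarrow>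
     (\<exists>D. continuous_on {0..} D \<and>
          (\<forall>r\<ge>0. (\<phi> has_real_derivative D r) (at r within {0..})))"

definition C3_on_pos :: "(real \<Rightarrow> real) \<Rightarrow> bool" where
  "C3_on_pos \<phi> \<longleftrightarrow>
     (\<forall>k<3. \<forall>r>0. (deriv ^^ k) \<phi> field_differentiable (at r)) \<and>
     continuous_on {0<..} ((deriv ^^ 3) \<phi>)"

definition standing_assumptions :: "(real \<Rightarrow> real) \<Rightarrow> bool" where
  "standing_assumptions \<phi> \<longleftrightarrow>
     N_function \<phi> \<and> C1_on_nonneg \<phi> \<and> C3_on_pos \<phi> \<and>
     (INF r\<in>{0<..}. ereal (r * deriv \<phi> r / \<phi> r)) > 1 \<and>
     (SUP r\<in>{0<..}. ereal (r * deriv \<phi> r / \<phi> r)) < \<infinity>"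

definition Phi :: "(real \<Rightarrow> real) \<Rightarrow> real \<Rightarrow> real" where
  "Phi \<phi> r = \<phi> (sqrt r)"

definition mu :: "(real \<Rightarrow> real) \<Rightarrow> real \<Rightarrow> real" where
  "mu \<phi> r = 2 * deriv (Phi \<phi>) r"

lemma mu_eq:
  assumes "C3_on_pos \<phi>" "r > 0"
  shows "mu \<phi> r = deriv \<phi> (sqrt r) / sqrt r"
proof -
  have "(deriv ^^ 0) \<phi> field_differentiable (at (sqrt r))"
    using assms unfolding C3_on_pos_def
    by (metis real_sqrt_gt_zero zero_less_numeral)
  then have "(\<phi> has_real_derivative deriv \<phi> (sqrt r)) (at (sqrt r))"
    by (simp add: field_differentiable_derivI)
  moreover have "(sqrt has_real_derivative inverse (sqrt r) / 2) (at r)"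
    using assms(2) by (rule DERIV_real_sqrt)
  ultimately have "((\<lambda>x. \<phi> (sqrt x)) has_real_derivative
      deriv \<phi> (sqrt r) * (inverse (sqrt r) / 2)) (at r)"
    by (rule DERIV_chain2)
  then have "deriv (Phi \<phi>) r = deriv \<phi> (sqrt r) * (inverse (sqrt r) / 2)"
    unfolding Phi_def[abs_def] by (rule DERIV_imp_deriv)
  then show ?thesis
    by (simp add: mu_def field_simps)
qed

definition S_minus :: "(real \<Rightarrow> real) \<Rightarrow> ereal" where
  "S_minus \<phi> = (INF r\<in>{0<..}. ereal (r * deriv (deriv \<phi>) r / deriv \<phi> r))"

definition S_plus :: "(real \<Rightarrow> real) \<Rightarrow> ereal" where
  "S_plus \<phi> = (SUP r\<in>{0<..}. ereal (r * deriv (deriv \<phi>) r / deriv \<phi> r))"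

definition strictly_convex_on :: "real set \<Rightarrow> (real \<Rightarrow> real) \<Rightarrow> bool" where
  "strictly_convex_on S f \<longleftrightarrow>
     convex S \<and>
     (\<forall>x\<in>S. \<forall>y\<in>S. \<forall>t\<in>{0<..<1}. x \<noteq> y \<longrightarrow>
        f ((1 - t) * x + t * y) < (1 - t) * f x + t * f y)"

definition strictly_concave_on :: "real set \<Rightarrow> (real \<Rightarrow> real) \<Rightarrow> bool" where
  "strictly_concave_on S f \<longleftrightarrow> strictly_convex_on S (\<lambda>x. - f x)"


section \<open>Lebesgue spaces\<close>

text \<open>
  Elements of function spaces over a measure space are represented by functions, and the spaces
  are sets of functions closed under almost-everywhere equality.  Such a set is the union of the
  equivalence classes that make up the space, so membership does not depend on
  representatives; equality of elements is almost-everywhere equality.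
\<close>

definition essinf :: "'a measure \<Rightarrow> ('a \<Rightarrow> ereal) \<Rightarrow> ereal" where
  "essinf M f = - esssup M (\<lambda>x. - f x)"

definition Linf_norm :: "'a measure \<Rightarrow> ('a \<Rightarrow> real) \<Rightarrow> ereal" where
  "Linf_norm M f = esssup M (\<lambda>x. ereal \<bar>f x\<bar>)"

definition Linf :: "'a measure \<Rightarrow> ('a \<Rightarrow> real) set" where
  "Linf M = {f. f \<in> borel_measurable M \<and> Linf_norm M f < \<infinity>}"

definition L2 :: "'a measure \<Rightarrow> ('a \<Rightarrow> 'b::euclidean_space) set" where
  "L2 M = {f. f \<in> borel_measurable M \<and> integrable M (\<lambda>x. (norm (f x))\<^sup>2)}"

definition L2_norm :: "'a measure \<Rightarrow> ('a \<Rightarrow> 'b::euclidean_space) \<Rightarrow> real" where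
  "L2_norm M f = sqrt (LINT x|M. (norm (f x))\<^sup>2)"

definition L2_mean_zero :: "'a measure \<Rightarrow> ('a \<Rightarrow> real) set" where
  "L2_mean_zero M = {p \<in> L2 M. (LINT x|M. p x) = 0}"

definition fin_dim_space :: "'a measure \<Rightarrow> ('a \<Rightarrow> 'b::real_vector) set \<Rightarrow> bool" where
  "fin_dim_space M V \<longleftrightarrow>
     (\<lambda>x. 0) \<in> V \<and>
     (\<forall>f\<in>V. \<forall>g\<in>V. (\<lambda>x. f x + g x) \<in> V) \<and>
     (\<forall>a. \<forall>f\<in>V. (\<lambda>x. a *\<^sub>R f x) \<in> V) \<and>
     (\<forall>f\<in>V. \<forall>g. (AE x in M. f x = g x) \<longrightarrow> g \<in> V) \<and>
     (\<exists>B. finite B \<and> B \<subseteq> V \<and>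
          (\<forall>f\<in>V. \<exists>a. AE x in M. f x = (\<Sum>b\<in>B. a b *\<^sub>R b x)))"

definition bounded_functional ::
  "('a \<Rightarrow> 'b::real_vector) set \<Rightarrow> (('a \<Rightarrow> 'b) \<Rightarrow> real) \<Rightarrow> (('a \<Rightarrow> 'b) \<Rightarrow> real) \<Rightarrow> bool" where
  "bounded_functional V nrm F \<longleftrightarrow>
     (\<forall>f\<in>V. \<forall>g\<in>V. F (\<lambda>x. f x + g x) = F f + F g) \<and>
     (\<forall>a. \<forall>f\<in>V. F (\<lambda>x. a *\<^sub>R f x) = a * F f) \<and>
     (\<exists>K. \<forall>f\<in>V. \<bar>F f\<bar> \<le> K * nrm f)"


section \<open>Sobolev spaces\<close>

definition pderiv_at :: "'d::finite \<Rightarrow> (real^'d \<Rightarrow> real) \<Rightarrow> real^'d \<Rightarrow> real" where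
  "pderiv_at i f = (\<lambda>x. frechet_derivative f (at x) (axis i 1))"

definition smooth :: "(real^'d::finite \<Rightarrow> real) \<Rightarrow> bool" where
  "smooth f \<longleftrightarrow> (\<forall>idx x. foldr pderiv_at idx f differentiable (at x))"

definition test_functions :: "(real^'d::finite) set \<Rightarrow> (real^'d \<Rightarrow> real) set" where
  "test_functions \<Omega> =
     {f. smooth f \<and> compact (closure {x. f x \<noteq> 0}) \<and> closure {x. f x \<noteq> 0} \<subseteq> \<Omega>}"

definition is_weak_grad ::
  "(real^'d::finite) set \<Rightarrow> (real^'d \<Rightarrow> real) \<Rightarrow> (real^'d \<Rightarrow> real^'d) \<Rightarrow> bool" where
  "is_weak_grad \<Omega> u g \<longleftrightarrow>
     g \<in> L2 (lebesgue_on \<Omega>) \<and>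
     (\<forall>f\<in>test_functions \<Omega>. \<forall>i.
        (LINT x|lebesgue_on \<Omega>. u x * pderiv_at i f x) = - (LINT x|lebesgue_on \<Omega>. g x $ i * f x))"

definition H1 :: "(real^'d::finite) set \<Rightarrow> (real^'d \<Rightarrow> real) set" where
  "H1 \<Omega> = {u \<in> L2 (lebesgue_on \<Omega>). \<exists>g. is_weak_grad \<Omega> u g}"

text \<open>For \<open>u\<close> in \<open>H1 \<Omega>\<close> the weak gradient is determined almost everywhere on \<open>\<Omega>\<close>.\<close>

definition grad :: "(real^'d::finite) set \<Rightarrow> (real^'d \<Rightarrow> real) \<Rightarrow> real^'d \<Rightarrow> real^'d" where
  "grad \<Omega> u = (SOME g. is_weak_grad \<Omega> u g)"

definition H1_norm :: "(real^'d::finite) set \<Rightarrow> (real^'d \<Rightarrow> real) \<Rightarrow> real" where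
  "H1_norm \<Omega> u =
     sqrt ((L2_norm (lebesgue_on \<Omega>) u)\<^sup>2 + (L2_norm (lebesgue_on \<Omega>) (grad \<Omega> u))\<^sup>2)"

definition H10 :: "(real^'d::finite) set \<Rightarrow> (real^'d \<Rightarrow> real) set" where
  "H10 \<Omega> = {u \<in> H1 \<Omega>. \<exists>f. (\<forall>n::nat. f n \<in> test_functions \<Omega>) \<and>
              (\<lambda>n. H1_norm \<Omega> (\<lambda>x. f n x - u x)) \<longlonglongrightarrow> 0}"

definition H10_vec :: "(real^'d::finite) set \<Rightarrow> (real^'d \<Rightarrow> real^'d) set" where
  "H10_vec \<Omega> = {u. \<forall>i. (\<lambda>x. u x $ i) \<in> H10 \<Omega>}"

definition H1_norm_vec :: "(real^'d::finite) set \<Rightarrow> (real^'d \<Rightarrow> real^'d) \<Rightarrow> real" where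
  "H1_norm_vec \<Omega> u = sqrt (\<Sum>i\<in>UNIV. (H1_norm \<Omega> (\<lambda>x. u x $ i))\<^sup>2)"

definition grad_vec ::
  "(real^'d::finite) set \<Rightarrow> (real^'d \<Rightarrow> real^'d) \<Rightarrow> real^'d \<Rightarrow> real^'d^'d" where
  "grad_vec \<Omega> u x = (\<chi> i. grad \<Omega> (\<lambda>y. u y $ i) x)"

definition sym_grad ::
  "(real^'d::finite) set \<Rightarrow> (real^'d \<Rightarrow> real^'d) \<Rightarrow> real^'d \<Rightarrow> real^'d^'d" where
  "sym_grad \<Omega> u x = (1/2) *\<^sub>R (grad_vec \<Omega> u x + transpose (grad_vec \<Omega> u x))"

definition divergence ::
  "(real^'d::finite) set \<Rightarrow> (real^'d \<Rightarrow> real^'d) \<Rightarrow> real^'d \<Rightarrow> real" where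
  "divergence \<Omega> u x = trace (grad_vec \<Omega> u x)"


section \<open>The finite element setting\<close>

definition positive_part :: "'a measure \<Rightarrow> ('a \<Rightarrow> real) set \<Rightarrow> ('a \<Rightarrow> real) set" where
  "positive_part M C = {c \<in> C. essinf M (\<lambda>x. ereal (c x)) > 0}"

definition div_free ::
  "(real^'d::finite) set \<Rightarrow> (real^'d \<Rightarrow> real^'d) set \<Rightarrow> (real^'d \<Rightarrow> real) set
     \<Rightarrow> (real^'d \<Rightarrow> real^'d) set" where
  "div_free \<Omega> U Q = {u \<in> U. \<forall>q\<in>Q. (LINT x|lebesgue_on \<Omega>. q x * divergence \<Omega> u x) = 0}"

text \<open>
  The velocity norm is the energy norm of the Stokes operator with viscosity \<open>w\<close>.
\<close>

definition weighted_norm ::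
  "(real^'d::finite) set \<Rightarrow> (real^'d \<Rightarrow> real) \<Rightarrow> (real^'d \<Rightarrow> real^'d) \<Rightarrow> real" where
  "weighted_norm \<Omega> w v = sqrt (LINT x|lebesgue_on \<Omega>. w x * (norm (sym_grad \<Omega> v x))\<^sup>2)"

definition inf_sup_stable ::
  "(real^'d::finite) set \<Rightarrow> (real^'d \<Rightarrow> real) \<Rightarrow> (real^'d \<Rightarrow> real^'d) set
     \<Rightarrow> (real^'d \<Rightarrow> real) set \<Rightarrow> bool" where
  "inf_sup_stable \<Omega> w U Q \<longleftrightarrow>
     0 < (INF q\<in>{q\<in>Q. L2_norm (lebesgue_on \<Omega>) q \<noteq> 0}.
          SUP v\<in>{v\<in>U. weighted_norm \<Omega> w v \<noteq> 0}.
            ereal ((LINT x|lebesgue_on \<Omega>. q x * divergence \<Omega> v x) /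
                   (weighted_norm \<Omega> w v * L2_norm (lebesgue_on \<Omega>) q)))"

definition scalar_setting ::
  "(real^'d::finite) set \<Rightarrow> (real^'d \<Rightarrow> real) set \<Rightarrow> (real^'d \<Rightarrow> real) set
     \<Rightarrow> ((real^'d \<Rightarrow> real) \<Rightarrow> real) \<Rightarrow> bool" where
  "scalar_setting \<Omega> C U F \<longleftrightarrow>
     fin_dim_space (lebesgue_on \<Omega>) C \<and> C \<subseteq> Linf (lebesgue_on \<Omega>) \<and>
     fin_dim_space (lebesgue_on \<Omega>) U \<and> U \<subseteq> H10 \<Omega> \<and>
     (\<forall>u\<in>U. (\<lambda>x. (norm (grad \<Omega> u x))\<^sup>2) \<in> C) \<and>
     bounded_functional (H10 \<Omega>) (H1_norm \<Omega>) F"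

definition vector_setting ::
  "(real^'d::finite) set \<Rightarrow> (real \<Rightarrow> real) \<Rightarrow> (real^'d \<Rightarrow> real) set
     \<Rightarrow> (real^'d \<Rightarrow> real^'d) set \<Rightarrow> (real^'d \<Rightarrow> real) set
     \<Rightarrow> ((real^'d \<Rightarrow> real^'d) \<Rightarrow> real) \<Rightarrow> bool" where
  "vector_setting \<Omega> m C U Q F \<longleftrightarrow>
     fin_dim_space (lebesgue_on \<Omega>) C \<and> C \<subseteq> Linf (lebesgue_on \<Omega>) \<and>
     fin_dim_space (lebesgue_on \<Omega>) U \<and> U \<subseteq> H10_vec \<Omega> \<and>
     fin_dim_space (lebesgue_on \<Omega>) Q \<and> Q \<subseteq> L2_mean_zero (lebesgue_on \<Omega>) \<and>
     (\<forall>u\<in>U. (\<lambda>x. (norm (sym_grad \<Omega> u x))\<^sup>2) \<in> C) \<and>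
     (\<forall>c\<in>positive_part (lebesgue_on \<Omega>) C. inf_sup_stable \<Omega> (\<lambda>x. m (c x)) U Q) \<and>
     bounded_functional (H10_vec \<Omega>) (H1_norm_vec \<Omega>) F"


section \<open>The evolution problem\<close>

text \<open>
  In this section \<open>m\<close> is the function \<open>\<mu>\<close>, \<open>W\<close> the discrete space and \<open>D\<close> the differential
  operator; both the scalar and the incompressible case are instances.  On matrices,
  \<open>\<bullet>\<close> and \<open>norm\<close> are the Frobenius inner product and norm.
\<close>

definition discrete_solution ::
  "'a measure \<Rightarrow> (real \<Rightarrow> real) \<Rightarrow> ('a \<Rightarrow> 'b) set \<Rightarrow> (('a \<Rightarrow> 'b) \<Rightarrow> 'a \<Rightarrow> 'e::real_inner)
     \<Rightarrow> (('a \<Rightarrow> 'b) \<Rightarrow> real) \<Rightarrow> ('a \<Rightarrow> real) \<Rightarrow> ('a \<Rightarrow> 'b) \<Rightarrow> bool" where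
  "discrete_solution M m W D F c u \<longleftrightarrow>
     u \<in> W \<and> (\<forall>v\<in>W. (LINT x|M. m (c x) * (D u x \<bullet> D v x)) = F v)"

text \<open>The discrete solution is unique up to almost-everywhere equality; one representative is chosen.\<close>

definition u_h ::
  "'a measure \<Rightarrow> (real \<Rightarrow> real) \<Rightarrow> ('a \<Rightarrow> 'b) set \<Rightarrow> (('a \<Rightarrow> 'b) \<Rightarrow> 'a \<Rightarrow> 'e::real_inner)
     \<Rightarrow> (('a \<Rightarrow> 'b) \<Rightarrow> real) \<Rightarrow> ('a \<Rightarrow> real) \<Rightarrow> 'a \<Rightarrow> 'b" where
  "u_h M m W D F c = (SOME u. discrete_solution M m W D F c u)"

text \<open>
  \<open>c\<close> is a \<open>C\<^sup>1\<close> curve \<open>[0,\<infinity>) \<rightarrow> V\<close> with derivative \<open>c'\<close>.  The space \<open>V\<close> carries the \<open>L\<^sup>\<infinity>\<close> norm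
  (all norms are equivalent in finite dimension); at time \<open>0\<close> the limits are one-sided.
\<close>

definition C1_curve ::
  "'a measure \<Rightarrow> ('a \<Rightarrow> real) set \<Rightarrow> (real \<Rightarrow> 'a \<Rightarrow> real) \<Rightarrow> (real \<Rightarrow> 'a \<Rightarrow> real) \<Rightarrow> bool" where
  "C1_curve M V c c' \<longleftrightarrow>
     (\<forall>t\<ge>0. c t \<in> V \<and> c' t \<in> V \<and>
        ((\<lambda>s. Linf_norm M (\<lambda>x. (c s x - c t x) / (s - t) - c' t x)) \<longlongrightarrow> 0) (at t within {0..}) \<and>
        ((\<lambda>s. Linf_norm M (\<lambda>x. c' s x - c' t x)) \<longlongrightarrow> 0) (at t within {0..}))"

definition global_solution ::
  "'a measure \<Rightarrow> (real \<Rightarrow> real) \<Rightarrow> ('a \<Rightarrow> real) set \<Rightarrow> ('a \<Rightarrow> 'b) set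
     \<Rightarrow> (('a \<Rightarrow> 'b) \<Rightarrow> 'a \<Rightarrow> 'e::real_inner) \<Rightarrow> (('a \<Rightarrow> 'b) \<Rightarrow> real)
     \<Rightarrow> ('a \<Rightarrow> real) \<Rightarrow> (real \<Rightarrow> 'a \<Rightarrow> real) \<Rightarrow> bool" where
  "global_solution M m C W D F c0 c \<longleftrightarrow>
     (\<exists>c'. C1_curve M C c c' \<and>
           (\<forall>t\<ge>0. AE x in M. c' t x = (norm (D (u_h M m W D F (c t)) x))\<^sup>2 - c t x)) \<and>
     (AE x in M. c 0 x = c0 x) \<and>
     (\<forall>t\<ge>0. c t \<in> positive_part M C)"

definition well_posed ::
  "'a measure \<Rightarrow> (real \<Rightarrow> real) \<Rightarrow> ('a \<Rightarrow> real) set \<Rightarrow> ('a \<Rightarrow> 'b) set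
     \<Rightarrow> (('a \<Rightarrow> 'b) \<Rightarrow> 'a \<Rightarrow> 'e::real_inner) \<Rightarrow> (('a \<Rightarrow> 'b) \<Rightarrow> real)
     \<Rightarrow> ('a \<Rightarrow> real) \<Rightarrow> bool" where
  "well_posed M m C W D F c0 \<longleftrightarrow>
     (\<exists>c. global_solution M m C W D F c0 c \<and>
          (\<forall>b. global_solution M m C W D F c0 b \<longrightarrow> (\<forall>t\<ge>0. AE x in M. b t x = c t x)) \<and>
          (\<forall>T. \<exists>\<epsilon>>0. \<forall>t. 0 \<le> t \<and> t \<le> T \<longrightarrow> (AE x in M. \<epsilon> \<le> c t x \<and> c t x \<le> 1 / \<epsilon>)))"

end

theory Submission
  imports Defs
begin

text \<open>
  The integrating factor \<open>e\<^sup>t\<close> turns the equation into \<open>z' = e\<^sup>t |Du|\<^sup>2\<close> for \<open>z = e\<^sup>t c\<close>.  The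
  right-hand side is nonnegative, so \<open>z\<close> stays above every positive constant that bounds the initial
  value from below; hence \<open>c(t) \<ge> e\<^sup>-\<^sup>t \<delta>\<close>, and the set where \<open>\<mu>(c)\<close> degenerates is not reached in
  finite time.

  Blow-up is excluded by linear growth of the right-hand side.  Since \<open>\<phi>\<close> is convex,
  \<open>\<surd>r \<mu>(r) = \<phi>'(\<surd>r)\<close> is nondecreasing, so \<open>\<mu>(c) \<ge> \<kappa> / \<surd>m\<close> wherever \<open>\<delta> \<le> c \<le> m\<close>, with
  \<open>\<kappa> = \<phi>'(\<surd>\<delta>)\<close>.  Testing the discrete equation with its own solution gives
  \<open>\<kappa> \<parallel>Du\<parallel>\<^sup>2 \<le> \<surd>m F(u) \<le> \<surd>m K \<parallel>Du\<parallel>\<close> in \<open>L\<^sup>2\<close>, hence \<open>\<parallel>Du\<parallel>\<^sup>2 \<le> (K/\<kappa>)\<^sup>2 m\<close>.  The function \<open>|Du|\<^sup>2\<close>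
  lies in the finite-dimensional space \<open>C\<^sub>h\<close>, where the \<open>L\<^sup>1\<close> norm controls the \<open>L\<^sup>\<infinity>\<close> norm, so it is
  bounded by a multiple of the supremum of \<open>c\<close> (lemma \<open>flux_growth\<close>).  Testing the difference of two
  discrete equations shows in the same way that \<open>|Du|\<^sup>2\<close> depends on \<open>c\<close> in a locally Lipschitz manner
  (lemma \<open>flux_lipschitz\<close>).  For an integral equation that preserves a closed set, on which the
  right-hand side has linear growth and is locally Lipschitz, the Picard iterates converge locally
  uniformly on \<open>[0,\<infinity>)\<close> (locale \<open>volterra_problem\<close>).

  The estimate \<open>F(u) \<le> K \<parallel>Du\<parallel>\<close> and the solvability of the discrete equation both reduce to the fact
  that \<open>F u = 0\<close> whenever \<open>D u = 0\<close>.  For this it is enough to know that a function in \<open>H\<^sup>1\<^sub>0\<close> vanishes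
  as soon as one of its partial derivatives does, which follows from the Poincare inequality in one
  direction (lemma \<open>H10_directional_null\<close>).  The diagonal of \<open>\<epsilon>(u)\<close> consists of the derivatives
  \<open>\<partial>\<^sub>i u\<^sub>i\<close>, so \<open>\<epsilon>(u) = 0\<close> forces \<open>u = 0\<close> as well.  Linearity of \<open>D\<close> up to null sets rests on the
  uniqueness of weak gradients (lemma \<open>fundamental_lemma\<close>).
\<close>

section \<open>Picard iteration in a closed subset of a Banach space\<close>

lemma sum_in_closed:
  fixes K :: "'v::comm_monoid_add set"
  assumes "\<And>p. p \<in> A \<Longrightarrow> g p \<in> K" "0 \<in> K" "\<And>x y. x \<in> K \<Longrightarrow> y \<in> K \<Longrightarrow> x + y \<in> K"
  shows "sum g A \<in> K"
  using assms by (induction A rule: infinite_finite_induct) auto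

text \<open>
  Riemann sums with values in a closed convex cone stay in the cone.  A function that is not integrable
  has integral \<open>0\<close> by convention, and \<open>0\<close> lies in the cone.
\<close>

lemma integral_in_closed_convex_cone:
  fixes f :: "'n::euclidean_space \<Rightarrow> 'v::real_normed_vector"
  assumes "closed K" "convex K" "cone K" "K \<noteq> {}"
    and f: "\<And>x. x \<in> cbox a b \<Longrightarrow> f x \<in> K"
  shows "integral (cbox a b) f \<in> K"
proof (cases "f integrable_on cbox a b")
  case False
  have "0 \<in> K" using assms(1-4) by (simp add: cone_contains_0)
  then show ?thesis using False by (simp add: not_integrable_integral)
next
  case True
  have "\<exists>y\<in>K. dist y (integral (cbox a b) f) < e" if "e > 0" for e
  proof -
    have "\<forall>e>0. \<exists>\<gamma>. gauge \<gamma> \<and> (\<forall>\<D>. \<D> tagged_division_of cbox a b \<and> \<gamma> fine \<D> \<longrightarrow>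
        norm ((\<Sum>(x, k)\<in>\<D>. measure lborel k *\<^sub>R f x) - integral (cbox a b) f) < e)"
      using integrable_integral[OF True] unfolding has_integral .
    from this[rule_format, OF \<open>e > 0\<close>] obtain \<gamma> where "gauge \<gamma>" and
      \<gamma>: "\<And>\<D>. \<D> tagged_division_of cbox a b \<and> \<gamma> fine \<D> \<Longrightarrow>
        norm ((\<Sum>(x, k)\<in>\<D>. measure lborel k *\<^sub>R f x) - integral (cbox a b) f) < e" by (elim exE conjE) simp
    obtain \<D> where D: "\<D> tagged_division_of cbox a b" "\<gamma> fine \<D>"
      by (rule fine_division_exists[OF \<open>gauge \<gamma>\<close>])
    have "0 \<in> K" using assms(1-4) by (simp add: cone_contains_0)
    have add: "x + y \<in> K" if "x \<in> K" "y \<in> K" for x y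
      using \<open>convex K\<close> \<open>cone K\<close> that convex_cone[of K] by simp
    have "(\<Sum>p\<in>\<D>. measure lborel (snd p) *\<^sub>R f (fst p)) \<in> K"
    proof (rule sum_in_closed)
      show "measure lborel (snd p) *\<^sub>R f (fst p) \<in> K" if "p \<in> \<D>" for p
      proof -
        have p: "(fst p, snd p) \<in> \<D>" using that by simp
        show ?thesis
          using tagged_division_ofD(2)[OF D(1) p] tagged_division_ofD(3)[OF D(1) p] f[of "fst p"] \<open>cone K\<close>
          unfolding cone_def by (simp add: subset_iff)
      qed
    qed (use \<open>0 \<in> K\<close> add in auto)
    then show ?thesis
      using \<gamma>[of \<D>] D by (intro bexI[of _ "\<Sum>p\<in>\<D>. measure lborel (snd p) *\<^sub>R f (fst p)"])
        (simp_all add: dist_norm case_prod_unfold)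
  qed
  then have "integral (cbox a b) f \<in> closure K"
    unfolding closure_approachable by blast
  then show ?thesis using \<open>closed K\<close> by simp
qed

text \<open>
  The iterated Gronwall estimate.  Applied to the differences of successive Picard iterates it gives
  convergence; applied to a constant sequence, the distance of two solutions, it gives uniqueness.
\<close>

lemma iterated_integral_bound:
  fixes d :: "nat \<Rightarrow> real \<Rightarrow> real"
  assumes "0 \<le> \<Lambda>" "\<And>t. t \<in> {0..T} \<Longrightarrow> d 0 t \<le> D"
    and cont: "\<And>k. continuous_on {0..T} (d k)"
    and step: "\<And>k t. t \<in> {0..T} \<Longrightarrow> d (Suc k) t \<le> \<Lambda> * integral {0..t} (d k)"
    and t: "t \<in> {0..T}"
  shows "d k t \<le> D * (\<Lambda> * t) ^ k / fact k"
  using t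
proof (induction k arbitrary: t)
  case 0
  then show ?case using assms(2) by simp
next
  case (Suc k)
  have int: "((\<lambda>s. D * (\<Lambda> * s) ^ k / fact k) has_integral
      D * \<Lambda> ^ k * t ^ Suc k / fact (Suc k) - D * \<Lambda> ^ k * 0 ^ Suc k / fact (Suc k)) {0..t}"
  proof (rule fundamental_theorem_of_calculus)
    show "0 \<le> t" using Suc by simp
    fix x
    have "((\<lambda>s. D * \<Lambda> ^ k * s ^ Suc k / fact (Suc k)) has_real_derivative
        D * \<Lambda> ^ k * (real (Suc k) * x ^ k) / fact (Suc k)) (at x within {0..t})"
      by (intro DERIV_cdivide DERIV_cmult DERIV_pow[THEN DERIV_cong]) simp
    also have "D * \<Lambda> ^ k * (real (Suc k) * x ^ k) / fact (Suc k) = D * (\<Lambda> * x) ^ k / fact k"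
      by (simp add: power_mult_distrib field_simps del: of_nat_Suc)
    finally show "((\<lambda>s. D * \<Lambda> ^ k * s ^ Suc k / fact (Suc k)) has_vector_derivative
        D * (\<Lambda> * x) ^ k / fact k) (at x within {0..t})"
      by (simp add: has_real_derivative_iff_has_vector_derivative)
  qed
  have "integral {0..t} (d k) \<le> integral {0..t} (\<lambda>s. D * (\<Lambda> * s) ^ k / fact k)"
  proof (rule integral_le)
    show "d k integrable_on {0..t}"
      using Suc.prems continuous_on_subset[OF cont[of k]] by (intro integrable_continuous_real) auto
    show "(\<lambda>s. D * (\<Lambda> * s) ^ k / fact k) integrable_on {0..t}"
      using int by blast
    show "d k s \<le> D * (\<Lambda> * s) ^ k / fact k" if "s \<in> {0..t}" for s
      using Suc.IH[of s] that Suc.prems by auto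
  qed
  also have "\<dots> = D * \<Lambda> ^ k * t ^ Suc k / fact (Suc k)"
    by (subst integral_unique[OF int]) simp
  finally have "\<Lambda> * integral {0..t} (d k) \<le> \<Lambda> * (D * \<Lambda> ^ k * t ^ Suc k / fact (Suc k))"
    using assms(1) by (rule mult_left_mono)
  then have "d (Suc k) t \<le> \<Lambda> * (D * \<Lambda> ^ k * t ^ Suc k / fact (Suc k))"
    using step[OF Suc.prems, of k] by linarith
  also have "\<dots> = D * (\<Lambda> * t) ^ Suc k / fact (Suc k)"
    by (simp add: power_mult_distrib mult_ac)
  finally show ?case .
qed

text \<open>
  The integral equation \<open>z(t) = z\<^sub>0 + \<integral>\<^sub>0\<^sup>t h(s, z(s)) ds\<close> in a closed set that the Picard map preserves.
  The Lipschitz constant may depend on the time and on the size of \<open>z\<close>; linear growth keeps all Picard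
  iterates in a common ball on each bounded time interval, so that a single constant is enough there.
\<close>

locale volterra_problem =
  fixes h :: "real \<Rightarrow> 'v::banach \<Rightarrow> 'v" and S :: "'v set" and z0 :: 'v
  assumes closed_S: "closed S" and z0_in: "z0 \<in> S"
    and cont_h: "continuous_on ({0..} \<times> S) (\<lambda>(s, z). h s z)"
    and invariant: "\<And>z t. continuous_on {0..} z \<Longrightarrow> (\<And>s. 0 \<le> s \<Longrightarrow> z s \<in> S) \<Longrightarrow> 0 \<le> t \<Longrightarrow>
        z0 + integral {0..t} (\<lambda>s. h s (z s)) \<in> S"
    and growth: "\<And>T. \<exists>L\<ge>0. \<forall>s\<in>{0..T}. \<forall>z\<in>S. norm (h s z) \<le> L * norm z"
    and lipschitz: "\<And>T R. \<exists>\<Lambda>\<ge>0. \<forall>s\<in>{0..T}. \<forall>z\<in>S. \<forall>w\<in>S.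
        norm z \<le> R \<longrightarrow> norm w \<le> R \<longrightarrow> norm (h s z - h s w) \<le> \<Lambda> * norm (z - w)"
begin

definition path :: "(real \<Rightarrow> 'v) \<Rightarrow> bool" where
  "path z \<longleftrightarrow> continuous_on {0..} z \<and> (\<forall>s\<ge>0. z s \<in> S)"

definition solves :: "(real \<Rightarrow> 'v) \<Rightarrow> bool" where
  "solves z \<longleftrightarrow> path z \<and> (\<forall>t\<ge>0. z t = z0 + integral {0..t} (\<lambda>s. h s (z s)))"

definition picard :: "(real \<Rightarrow> 'v) \<Rightarrow> real \<Rightarrow> 'v" where
  "picard z t = z0 + integral {0..t} (\<lambda>s. h s (z s))"

lemma growthE:
  obtains L where "0 \<le> L" "\<And>s z. s \<in> {0..T} \<Longrightarrow> z \<in> S \<Longrightarrow> norm (h s z) \<le> L * norm z"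
  using growth[of T] by blast

lemma lipschitzE:
  obtains \<Lambda> where "0 \<le> \<Lambda>" "\<And>s z w. s \<in> {0..T} \<Longrightarrow> z \<in> S \<Longrightarrow> w \<in> S \<Longrightarrow> norm z \<le> R \<Longrightarrow>
    norm w \<le> R \<Longrightarrow> norm (h s z - h s w) \<le> \<Lambda> * norm (z - w)"
  using lipschitz[of T R] by blast

lemma continuous_on_h_path:
  assumes "path z"
  shows "continuous_on {0..} (\<lambda>s. h s (z s))"
proof -
  have "continuous_on {0..} (\<lambda>s. (\<lambda>(s, z). h s z) (s, z s))"
    using assms by (intro continuous_on_compose2[OF cont_h] continuous_intros)
      (auto simp: path_def)
  then show ?thesis by simp
qed

lemma integrable_h_path:
  assumes "path z" "0 \<le> a"
  shows "(\<lambda>s. h s (z s)) integrable_on {a..b}"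
  using continuous_on_subset[OF continuous_on_h_path[OF assms(1)]] assms(2)
  by (intro integrable_continuous_real) auto

lemma path_picard:
  assumes "path z"
  shows "path (picard z)"
  unfolding path_def
proof
  show "\<forall>t\<ge>0. picard z t \<in> S"
    using assms invariant unfolding path_def picard_def by blast
  have "continuous_on {0..T} (\<lambda>t. integral {0..t} (\<lambda>s. h s (z s)))" for T
    by (rule indefinite_integral_continuous_1) (simp add: integrable_h_path assms)
  then have "continuous_on {0..T} (picard z)" for T
    unfolding picard_def by (intro continuous_intros)
  then have "continuous (at t within {0..}) (picard z)" if "t \<ge> 0" for t
  proof -
    have "continuous (at t within {0..t+1}) (picard z)"
      using \<open>continuous_on {0..t+1} (picard z)\<close> that by (simp add: continuous_on_eq_continuous_within)
    moreover have "at t within {0..t+1} = at t within {0..}"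
      by (rule at_within_nhd[of _ "{..<t+1}"]) auto
    ultimately show ?thesis by simp
  qed
  then show "continuous_on {0..} (picard z)"
    by (simp add: continuous_on_eq_continuous_within)
qed

lemma norm_picard_diff:
  assumes "path z" "path w" "0 \<le> \<Lambda>" "t \<in> {0..T}"
    and L: "\<And>s. s \<in> {0..T} \<Longrightarrow> norm (h s (z s) - h s (w s)) \<le> \<Lambda> * norm (z s - w s)"
  shows "norm (picard z t - picard w t) \<le> \<Lambda> * integral {0..t} (\<lambda>s. norm (z s - w s))"
proof -
  have int: "(\<lambda>s. norm (z s - w s)) integrable_on {0..t}"
    using assms(1,2) continuous_on_subset[of "{0..}" _ "{0..t}"]
    by (intro integrable_continuous_real continuous_intros) (auto simp: path_def)
  have "picard z t - picard w t = integral {0..t} (\<lambda>s. h s (z s) - h s (w s))"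
    by (simp add: picard_def Henstock_Kurzweil_Integration.integral_diff integrable_h_path assms)
  also have "norm \<dots> \<le> integral {0..t} (\<lambda>s. \<Lambda> * norm (z s - w s))"
    using assms L int
    by (intro integral_norm_bound_integral Henstock_Kurzweil_Integration.integrable_diff integrable_h_path
        integrable_on_mult_right) auto
  finally show ?thesis by simp
qed

theorem unique:
  assumes "solves z" "solves w" "0 \<le> t"
  shows "z t = w t"
proof -
  have p: "path z" "path w" using assms by (auto simp: solves_def)
  have c: "continuous_on {0..t} z" "continuous_on {0..t} w"
    using p continuous_on_subset[of "{0..}" _ "{0..t}"] by (auto simp: path_def)
  obtain R1 R2 where R: "\<And>s. s \<in> {0..t} \<Longrightarrow> norm (z s) \<le> R1" "\<And>s. s \<in> {0..t} \<Longrightarrow> norm (w s) \<le> R2"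
    using compact_imp_bounded[OF compact_continuous_image[OF c(1) compact_Icc]]
      compact_imp_bounded[OF compact_continuous_image[OF c(2) compact_Icc]]
    unfolding bounded_iff by (metis image_eqI)
  obtain \<Lambda> where \<Lambda>: "0 \<le> \<Lambda>" "\<And>s z w. s \<in> {0..t} \<Longrightarrow> z \<in> S \<Longrightarrow> w \<in> S \<Longrightarrow> norm z \<le> max R1 R2 \<Longrightarrow>
    norm w \<le> max R1 R2 \<Longrightarrow> norm (h s z - h s w) \<le> \<Lambda> * norm (z - w)"
    using lipschitzE[of t "max R1 R2"] by blast
  have eq: "z s = picard z s" "w s = picard w s" if "s \<ge> 0" for s
    using assms that by (auto simp: solves_def picard_def)
  have bound: "norm (z t - w t) \<le> (R1 + R2) * (\<Lambda> * t) ^ k / fact k" for k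
  proof (rule iterated_integral_bound[where d = "\<lambda>_ s. norm (z s - w s)" and T = t])
    show "0 \<le> \<Lambda>" by fact
    show "continuous_on {0..t} (\<lambda>s. norm (z s - w s))"
      using c by (intro continuous_intros)
    show "norm (z s - w s) \<le> R1 + R2" if "s \<in> {0..t}" for s
      using R[OF that] norm_triangle_ineq4[of "z s" "w s"] by linarith
    show "norm (z s - w s) \<le> \<Lambda> * integral {0..s} (\<lambda>s. norm (z s - w s))" if "s \<in> {0..t}" for s
    proof -
      have "norm (picard z s - picard w s) \<le> \<Lambda> * integral {0..s} (\<lambda>s. norm (z s - w s))"
      proof (rule norm_picard_diff[OF p \<Lambda>(1) that])
        fix r assume "r \<in> {0..t}"
        then show "norm (h r (z r) - h r (w r)) \<le> \<Lambda> * norm (z r - w r)"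
          using R[of r] p by (intro \<Lambda>(2)) (auto simp: path_def)
      qed
      then show ?thesis using eq that by auto
    qed
  qed (use assms in auto)
  have "(\<lambda>k. (R1 + R2) * ((\<Lambda> * t) ^ k / fact k)) \<longlonglongrightarrow> (R1 + R2) * 0" (is "?X \<longlonglongrightarrow> _")
    using summable_LIMSEQ_zero[OF summable_exp_generic[of "\<Lambda> * t"]]
    by (intro tendsto_intros) (simp add: divide_inverse mult.commute)
  then have "norm (z t - w t) \<le> 0"
    using bound LIMSEQ_le_const[of ?X "(R1 + R2) * 0" "norm (z t - w t)"] by auto
  then show ?thesis by simp
qed

lemma solves_has_derivative:
  assumes "solves z" "0 \<le> t"
  shows "(z has_vector_derivative h t (z t)) (at t within {0..})"
proof -
  have p: "path z" using assms by (simp add: solves_def)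
  have c: "continuous_on {0..t+1} (\<lambda>s. h s (z s))"
    using continuous_on_h_path[OF p] by (rule continuous_on_subset) auto
  have "((\<lambda>t. integral {0..t} (\<lambda>s. h s (z s))) has_vector_derivative h t (z t)) (at t within {0..t+1})"
    using assms(2) by (intro integral_has_vector_derivative[OF c]) auto
  moreover have "at t within {0..t+1} = at t within {0..}"
    by (rule at_within_nhd[of _ "{..<t+1}"]) auto
  ultimately have "((\<lambda>t. z0 + integral {0..t} (\<lambda>s. h s (z s))) has_vector_derivative 0 + h t (z t)) (at t within {0..})"
    by (intro has_vector_derivative_add has_vector_derivative_const) simp
  then have "((\<lambda>t. z0 + integral {0..t} (\<lambda>s. h s (z s))) has_vector_derivative h t (z t)) (at t within {0..})"
    by simp
  then show ?thesis
    by (rule has_vector_derivative_transform[rotated 2]) (use assms in \<open>auto simp: solves_def\<close>)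
qed

lemma solvesI:
  assumes "path z" "z 0 = z0"
    and deriv: "\<And>t. 0 \<le> t \<Longrightarrow> (z has_vector_derivative h t (z t)) (at t within {0..})"
  shows "solves z"
  unfolding solves_def
proof (intro conjI allI impI)
  fix t :: real assume "0 \<le> t"
  have "((\<lambda>s. h s (z s)) has_integral z t - z 0) {0..t}"
    using \<open>0 \<le> t\<close> by (intro fundamental_theorem_of_calculus)
      (auto intro: has_vector_derivative_within_subset[OF deriv])
  then show "z t = z0 + integral {0..t} (\<lambda>s. h s (z s))"
    using assms(2) by (simp add: integral_unique)
qed fact

definition iterate :: "nat \<Rightarrow> real \<Rightarrow> 'v" where
  "iterate k = (picard ^^ k) (\<lambda>_. z0)"

lemma iterate_Suc: "iterate (Suc k) t = z0 + integral {0..t} (\<lambda>s. h s (iterate k s))"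
  by (simp add: iterate_def picard_def)

lemma path_iterate: "path (iterate k)"
proof (induction k)
  case 0
  then show ?case by (simp add: iterate_def path_def z0_in)
next
  case (Suc k)
  then show ?case using path_picard by (simp add: iterate_def)
qed

text \<open>
  The bound \<open>y(t) = \<parallel>z\<^sub>0\<parallel> e\<^sup>L\<^sup>t\<close> solves \<open>y' = L y\<close>, so it passes from one iterate to the next.
\<close>

lemma iterate_bound:
  assumes L: "0 \<le> L" "\<And>s z. s \<in> {0..T} \<Longrightarrow> z \<in> S \<Longrightarrow> norm (h s z) \<le> L * norm z"
    and "t \<in> {0..T}"
  shows "norm (iterate k t) \<le> norm z0 * exp (L * t)"
  using assms(3)
proof (induction k arbitrary: t)
  case 0
  then show ?case using L(1) by (simp add: iterate_def mult_le_cancel_left1)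
next
  case (Suc k)
  have int: "((\<lambda>s. norm z0 * (L * exp (L * s))) has_integral norm z0 * exp (L * t) - norm z0 * exp (L * 0)) {0..t}"
    using Suc.prems
    by (intro fundamental_theorem_of_calculus)
      (auto simp flip: has_real_derivative_iff_has_vector_derivative intro!: derivative_eq_intros)
  have "norm (iterate (Suc k) t) \<le> norm z0 + norm (integral {0..t} (\<lambda>s. h s (iterate k s)))"
    unfolding iterate_Suc by (rule norm_triangle_ineq)
  also have "norm (integral {0..t} (\<lambda>s. h s (iterate k s))) \<le> integral {0..t} (\<lambda>s. norm z0 * (L * exp (L * s)))"
  proof (rule integral_norm_bound_integral)
    fix s assume s: "s \<in> {0..t}"
    have "norm (h s (iterate k s)) \<le> L * norm (iterate k s)"
      using s Suc.prems path_iterate[of k] by (intro L) (auto simp: path_def)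
    also have "\<dots> \<le> L * (norm z0 * exp (L * s))"
      using s Suc.prems by (intro mult_left_mono Suc.IH L) auto
    finally show "norm (h s (iterate k s)) \<le> norm z0 * (L * exp (L * s))" by (simp add: mult_ac)
  qed (use int path_iterate integrable_h_path in auto)
  also have "\<dots> = norm z0 * exp (L * t) - norm z0" by (subst integral_unique[OF int]) simp
  finally show ?case by simp
qed

lemma iterate_uniform_limit:
  obtains R where "\<And>k t. t \<in> {0..T} \<Longrightarrow> norm (iterate k t) \<le> R"
    "uniform_limit {0..T} iterate (\<lambda>t. lim (\<lambda>k. iterate k t)) sequentially"
proof -
  obtain L where L: "0 \<le> L" "\<And>s z. s \<in> {0..T} \<Longrightarrow> z \<in> S \<Longrightarrow> norm (h s z) \<le> L * norm z"
    using growthE[of T] by blast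
  define R where "R = norm z0 * exp (L * T)"
  have R: "norm (iterate k t) \<le> R" if "t \<in> {0..T}" for k t
  proof -
    have "norm (iterate k t) \<le> norm z0 * exp (L * t)"
      by (rule iterate_bound[OF L that])
    also have "\<dots> \<le> R" unfolding R_def using that L by (intro mult_left_mono) (auto intro: mult_left_mono)
    finally show ?thesis .
  qed
  obtain \<Lambda> where \<Lambda>: "0 \<le> \<Lambda>" "\<And>s z w. s \<in> {0..T} \<Longrightarrow> z \<in> S \<Longrightarrow> w \<in> S \<Longrightarrow> norm z \<le> R \<Longrightarrow>
    norm w \<le> R \<Longrightarrow> norm (h s z - h s w) \<le> \<Lambda> * norm (z - w)"
    using lipschitzE[of T R] by blast
  have diff: "norm (iterate (Suc k) t - iterate k t) \<le> (2 * R) * (\<Lambda> * t) ^ k / fact k"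
    if "t \<in> {0..T}" for k t
  proof (rule iterated_integral_bound[where d = "\<lambda>k s. norm (iterate (Suc k) s - iterate k s)" and T = T])
    show "0 \<le> \<Lambda>" by fact
    show "continuous_on {0..T} (\<lambda>s. norm (iterate (Suc k) s - iterate k s))" for k
      using path_iterate continuous_on_subset[of "{0..}" _ "{0..T}"]
      by (intro continuous_intros) (auto simp: path_def)
    show "norm (iterate (Suc 0) s - iterate 0 s) \<le> 2 * R" if "s \<in> {0..T}" for s
      using R[OF that, of 0] R[OF that, of "Suc 0"]
        norm_triangle_ineq4[of "iterate (Suc 0) s" "iterate 0 s"] by linarith
    show "norm (iterate (Suc (Suc k)) s - iterate (Suc k) s)
        \<le> \<Lambda> * integral {0..s} (\<lambda>s. norm (iterate (Suc k) s - iterate k s))" if "s \<in> {0..T}" for s k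
    proof -
      have "norm (picard (iterate (Suc k)) s - picard (iterate k) s)
          \<le> \<Lambda> * integral {0..s} (\<lambda>s. norm (iterate (Suc k) s - iterate k s))"
        using R path_iterate by (intro norm_picard_diff[OF _ _ \<Lambda>(1) that] \<Lambda>(2)) (auto simp: path_def)
      then show ?thesis by (simp add: iterate_def)
    qed
  qed (use that in auto)
  have bound: "norm (iterate (Suc k) t - iterate k t) \<le> (2 * R) * ((\<Lambda> * T) ^ k / fact k)"
    if "t \<in> {0..T}" for k t
  proof -
    have "0 \<le> R" using R[OF that, of 0] norm_ge_zero order_trans by blast
    have "(\<Lambda> * t) ^ k \<le> (\<Lambda> * T) ^ k"
      using that \<Lambda>(1) by (intro power_mono mult_left_mono) auto
    then have "(2 * R) * (\<Lambda> * t) ^ k / fact k \<le> (2 * R) * ((\<Lambda> * T) ^ k / fact k)"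
      using \<open>0 \<le> R\<close> by (simp add: divide_right_mono mult_left_mono)
    then show ?thesis using diff[OF that, of k] by linarith
  qed
  have "summable (\<lambda>k. (2 * R) * ((\<Lambda> * T) ^ k / fact k))"
    using summable_exp_generic[of "\<Lambda> * T"] by (intro summable_mult) (simp add: field_simps)
  then have "uniform_limit {0..T} (\<lambda>n t. \<Sum>k<n. iterate (Suc k) t - iterate k t)
      (\<lambda>t. \<Sum>k. iterate (Suc k) t - iterate k t) sequentially"
    by (intro Weierstrass_m_test) (rule bound)
  then have "uniform_limit {0..T} (\<lambda>n t. z0 + (\<Sum>k<n. iterate (Suc k) t - iterate k t))
      (\<lambda>t. z0 + (\<Sum>k. iterate (Suc k) t - iterate k t)) sequentially"
    by (intro uniform_limit_intros)
  moreover have "z0 + (\<Sum>k<n. iterate (Suc k) t - iterate k t) = iterate n t" for n t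
    by (subst sum_lessThan_telescope) (simp add: iterate_def)
  ultimately have u: "uniform_limit {0..T} iterate (\<lambda>t. z0 + (\<Sum>k. iterate (Suc k) t - iterate k t)) sequentially"
    by simp
  have "lim (\<lambda>k. iterate k t) = z0 + (\<Sum>k. iterate (Suc k) t - iterate k t)" if "t \<in> {0..T}" for t
    by (rule limI[OF tendsto_uniform_limitI[OF u that]])
  then have "uniform_limit {0..T} iterate (\<lambda>t. lim (\<lambda>k. iterate k t)) sequentially"
    using uniform_limit_cong'[of "{0..T}" iterate iterate "\<lambda>t. lim (\<lambda>k. iterate k t)"
        "\<lambda>t. z0 + (\<Sum>k. iterate (Suc k) t - iterate k t)" sequentially] u by blast
  then show ?thesis using R that by blast
qed

theorem exists: "\<exists>z. solves z"
proof
  let ?z = "\<lambda>t. lim (\<lambda>k. iterate k t)"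
  have lim: "(\<lambda>k. iterate k t) \<longlonglongrightarrow> ?z t" if "t \<ge> 0" for t
    by (rule iterate_uniform_limit[of t], rule tendsto_uniform_limitI) (use that in auto)
  have cont: "continuous_on {0..T} ?z" for T
  proof -
    have "uniform_limit {0..T} iterate ?z sequentially"
      by (rule iterate_uniform_limit)
    moreover have "continuous_on {0..T} (iterate k)" for k
      using path_iterate[of k] continuous_on_subset[of "{0..}" "iterate k" "{0..T}"] by (auto simp: path_def)
    ultimately show ?thesis
      by (intro uniform_limit_theorem[where f = iterate and F = sequentially]) auto
  qed
  have "continuous (at t within {0..}) ?z" if "t \<ge> 0" for t
  proof -
    have "continuous (at t within {0..t+1}) ?z"
      using cont[of "t+1"] that unfolding continuous_on_eq_continuous_within by auto
    moreover have "at t within {0..t+1} = at t within {0..}"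
      by (rule at_within_nhd[of _ "{..<t+1}"]) auto
    ultimately show ?thesis by simp
  qed
  then have "continuous_on {0..} ?z" by (simp add: continuous_on_eq_continuous_within)
  moreover have in_S: "?z t \<in> S" if "t \<ge> 0" for t
    by (rule closed_sequentially[OF closed_S _ lim[OF that]])
      (use that path_iterate in \<open>auto simp: path_def\<close>)
  ultimately have path: "path ?z" by (simp add: path_def)
  have "?z t = z0 + integral {0..t} (\<lambda>s. h s (?z s))" if t: "t \<ge> 0" for t
  proof -
    obtain R where R: "\<And>k s. s \<in> {0..t} \<Longrightarrow> norm (iterate k s) \<le> R"
      and u: "uniform_limit {0..t} iterate ?z sequentially"
      by (rule iterate_uniform_limit[of t]) blast
    have Rz: "norm (?z s) \<le> R" if "s \<in> {0..t}" for s
    proof (rule LIMSEQ_le_const2[OF tendsto_norm[OF lim]])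
      show "\<exists>N. \<forall>n\<ge>N. norm (iterate n s) \<le> R" using R[OF that] by blast
    qed (use that in auto)
    obtain \<Lambda> where \<Lambda>: "0 \<le> \<Lambda>" "\<And>s z w. s \<in> {0..t} \<Longrightarrow> z \<in> S \<Longrightarrow> w \<in> S \<Longrightarrow> norm z \<le> R \<Longrightarrow>
        norm w \<le> R \<Longrightarrow> norm (h s z - h s w) \<le> \<Lambda> * norm (z - w)"
      using lipschitzE[of t R] by blast
    have conv: "uniform_limit {0..t} (\<lambda>k s. h s (iterate k s)) (\<lambda>s. h s (?z s)) sequentially"
    proof (rule uniform_limitI)
      fix e :: real assume "e > 0"
      then have "e / (\<Lambda> + 1) > 0" using \<Lambda>(1) by simp
      from uniform_limitD[OF u this]
      show "\<forall>\<^sub>F k in sequentially. \<forall>s\<in>{0..t}. dist (h s (iterate k s)) (h s (?z s)) < e"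
      proof eventually_elim
        case (elim k)
        show ?case
        proof
          fix s assume s: "s \<in> {0..t}"
          have "dist (h s (iterate k s)) (h s (?z s)) \<le> \<Lambda> * dist (iterate k s) (?z s)"
            unfolding dist_norm using s R Rz in_S path_iterate by (intro \<Lambda>(2)) (auto simp: path_def)
          also have "\<dots> \<le> \<Lambda> * (e / (\<Lambda> + 1))"
            using elim s \<Lambda>(1) by (intro mult_left_mono) (auto simp: less_imp_le)
          also have "\<dots> < e" using \<Lambda>(1) \<open>e > 0\<close> by (simp add: field_simps)
          finally show "dist (h s (iterate k s)) (h s (?z s)) < e" .
        qed
      qed
    qed
    have c: "continuous_on {0..t} (\<lambda>s. h s (iterate k s))" for k
      using continuous_on_h_path[OF path_iterate] by (rule continuous_on_subset) auto
    obtain I J where IJ: "\<And>n. ((\<lambda>s. h s (iterate n s)) has_integral I n) {0..t}"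
      "((\<lambda>s. h s (?z s)) has_integral J) {0..t}" "I \<longlonglongrightarrow> J"
      using uniform_limit_integral[OF conv c] by auto
    have "(\<lambda>k. z0 + I k) \<longlonglongrightarrow> z0 + J" by (intro tendsto_intros IJ)
    moreover have "(\<lambda>k. iterate (Suc k) t) = (\<lambda>k. z0 + I k)"
      by (simp add: iterate_Suc integral_unique[OF IJ(1)])
    ultimately have "(\<lambda>k. iterate (Suc k) t) \<longlonglongrightarrow> z0 + J" by simp
    moreover have "(\<lambda>k. iterate (Suc k) t) \<longlonglongrightarrow> ?z t" using lim[OF t] by (rule LIMSEQ_Suc)
    ultimately have "?z t = z0 + J" by (metis LIMSEQ_unique)
    then show ?thesis unfolding integral_unique[OF IJ(2)] .
  qed
  with path show "solves ?z" unfolding solves_def by blast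
qed

end

section \<open>Semi-inner products on spaces of functions\<close>

locale function_space =
  fixes V :: "('a \<Rightarrow> 'b::real_vector) set"
  assumes zero_in: "(\<lambda>x. 0) \<in> V"
    and add_in: "f \<in> V \<Longrightarrow> g \<in> V \<Longrightarrow> (\<lambda>x. f x + g x) \<in> V"
    and scale_in: "f \<in> V \<Longrightarrow> (\<lambda>x. a *\<^sub>R f x) \<in> V"
begin

lemma sum_in: "(\<And>i. i < n \<Longrightarrow> b i \<in> V) \<Longrightarrow> (\<lambda>x. \<Sum>i<n. a i *\<^sub>R b i x) \<in> V" for n :: nat
  by (induction n) (auto simp: zero_in intro!: add_in scale_in)

lemma linear_sum:
  fixes n :: nat
  assumes "\<And>f g. f \<in> V \<Longrightarrow> g \<in> V \<Longrightarrow> F (\<lambda>x. f x + g x) = F f + F g"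
    and "\<And>f a. f \<in> V \<Longrightarrow> F (\<lambda>x. a *\<^sub>R f x) = a * F f"
    and "\<And>i. i < n \<Longrightarrow> b i \<in> V"
  shows "F (\<lambda>x. \<Sum>i<n. a i *\<^sub>R b i x) = (\<Sum>i<n. a i * (F (b i) :: real))"
  using assms(3)
proof (induction n)
  case 0
  have "F (\<lambda>x. 0 *\<^sub>R 0) = 0 * F (\<lambda>x. 0)" by (rule assms(2)[OF zero_in])
  then show ?case by simp
next
  case (Suc n)
  then show ?case
    using assms(1)[OF sum_in[of n b a] scale_in[of "b n" "a n"]] assms(2)[of "b n" "a n"] by simp
qed

end

locale semi_inner_space = function_space V for V :: "('a \<Rightarrow> 'b::real_vector) set" +
  fixes ip :: "('a \<Rightarrow> 'b) \<Rightarrow> ('a \<Rightarrow> 'b) \<Rightarrow> real"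
  assumes ip_sym: "f \<in> V \<Longrightarrow> g \<in> V \<Longrightarrow> ip f g = ip g f"
    and ip_add: "f \<in> V \<Longrightarrow> g \<in> V \<Longrightarrow> h \<in> V \<Longrightarrow> ip (\<lambda>x. f x + g x) h = ip f h + ip g h"
    and ip_scale: "f \<in> V \<Longrightarrow> h \<in> V \<Longrightarrow> ip (\<lambda>x. a *\<^sub>R f x) h = a * ip f h"
    and ip_nonneg: "f \<in> V \<Longrightarrow> 0 \<le> ip f f"
begin

lemma ip_sum_left:
  fixes n :: nat
  assumes "\<And>i. i < n \<Longrightarrow> b i \<in> V" "h \<in> V"
  shows "ip (\<lambda>x. \<Sum>i<n. a i *\<^sub>R b i x) h = (\<Sum>i<n. a i * ip (b i) h)"
  by (rule linear_sum[where F = "\<lambda>f. ip f h"]) (use assms ip_add ip_scale in auto)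

lemma ip_combination:
  assumes "f \<in> V" "g \<in> V"
  shows "ip (\<lambda>x. s *\<^sub>R f x + t *\<^sub>R g x) (\<lambda>x. s *\<^sub>R f x + t *\<^sub>R g x)
    = s\<^sup>2 * ip f f + 2 * s * t * ip f g + t\<^sup>2 * ip g g"
proof -
  let ?h = "\<lambda>x. s *\<^sub>R f x + t *\<^sub>R g x"
  have h: "?h \<in> V" using assms by (intro add_in scale_in)
  have "ip ?h k = s * ip f k + t * ip g k" if "k \<in> V" for k
    using assms that ip_add[of "\<lambda>x. s *\<^sub>R f x" "\<lambda>x. t *\<^sub>R g x" k] by (simp add: ip_scale scale_in)
  note left = this
  have "ip ?h ?h = s * ip ?h f + t * ip ?h g"
    using left[OF h] ip_sym[OF h] assms by simp
  then show ?thesis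
    using assms left[OF assms(1)] left[OF assms(2)] ip_sym[OF assms] by (simp add: power2_eq_square algebra_simps)
qed

lemma null_ip:
  assumes "f \<in> V" "g \<in> V" "ip f f = 0"
  shows "ip f g = 0"
proof (rule ccontr)
  assume "ip f g \<noteq> 0"
  \<comment> \<open>As \<open>f\<close> has length \<open>0\<close>, the squared length of \<open>s f + g\<close> is linear in \<open>s\<close>; here it is \<open>-1\<close>.\<close>
  define s where "s = - (ip g g + 1) / (2 * ip f g)"
  have "0 \<le> ip (\<lambda>x. s *\<^sub>R f x + 1 *\<^sub>R g x) (\<lambda>x. s *\<^sub>R f x + 1 *\<^sub>R g x)"
    using assms by (intro ip_nonneg add_in scale_in)
  also have "\<dots> = - 1"
    unfolding ip_combination[OF assms(1,2)] s_def using \<open>ip f g \<noteq> 0\<close> assms(3) by (simp add: field_simps)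
  finally show False by simp
qed

lemma Cauchy_Schwarz:
  assumes "f \<in> V" "g \<in> V"
  shows "\<bar>ip f g\<bar> \<le> sqrt (ip f f) * sqrt (ip g g)"
proof (cases "ip g g = 0")
  case True
  then show ?thesis using null_ip[OF assms(2,1)] ip_sym[OF assms] by simp
next
  case False
  then have pos: "ip g g > 0" using ip_nonneg[OF assms(2)] by simp
  have "0 \<le> ip (\<lambda>x. ip g g *\<^sub>R f x + (- ip f g) *\<^sub>R g x) (\<lambda>x. ip g g *\<^sub>R f x + (- ip f g) *\<^sub>R g x)"
    using assms by (intro ip_nonneg add_in scale_in)
  also have "\<dots> = ip g g * (ip f f * ip g g - (ip f g)\<^sup>2)"
    unfolding ip_combination[OF assms] by (simp add: power2_eq_square algebra_simps)
  finally have "(ip f g)\<^sup>2 \<le> ip f f * ip g g" using pos by (simp add: zero_le_mult_iff)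
  then have "sqrt ((ip f g)\<^sup>2) \<le> sqrt (ip f f * ip g g)" by (rule real_sqrt_le_mono)
  then show ?thesis by (simp add: real_sqrt_mult)
qed

text \<open>
  Gram-Schmidt for a semidefinite form.  A remainder \<open>r\<close> of length \<open>0\<close> is kept and scaled by
  \<open>1 / 0 = 0\<close>, which turns it into the zero function; this avoids a case distinction.  The representation formula is claimed for the
  vectors \<open>e i\<close> as well as for the \<open>b i\<close>, since both facts are used to see that the next remainder is
  orthogonal to everything constructed before.
\<close>

lemma Parseval_family_aux:
  fixes k :: nat
  assumes b: "\<And>i. i < k \<Longrightarrow> b i \<in> V"
  shows "\<exists>e. (\<forall>i<k. e i \<in> V) \<and>
    (\<forall>f. f \<in> b ` {..<k} \<union> e ` {..<k} \<longrightarrow> (\<forall>g\<in>V. ip f g = (\<Sum>i<k. ip f (e i) * ip (e i) g)))"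
  using b
proof (induction k)
  case 0
  then show ?case by simp
next
  case (Suc k)
  have "\<exists>e. (\<forall>i<k. e i \<in> V) \<and>
    (\<forall>f. f \<in> b ` {..<k} \<union> e ` {..<k} \<longrightarrow> (\<forall>g\<in>V. ip f g = (\<Sum>i<k. ip f (e i) * ip (e i) g)))"
    by (rule Suc.IH) (simp add: Suc.prems)
  then obtain e where "\<forall>i<k. e i \<in> V" and
    "\<forall>f. f \<in> b ` {..<k} \<union> e ` {..<k} \<longrightarrow> (\<forall>g\<in>V. ip f g = (\<Sum>i<k. ip f (e i) * ip (e i) g))"
    by (elim exE conjE)
  then have e: "\<And>i. i < k \<Longrightarrow> e i \<in> V"
    and rep: "\<And>f g. f \<in> b ` {..<k} \<union> e ` {..<k} \<Longrightarrow> g \<in> V \<Longrightarrow> ip f g = (\<Sum>i<k. ip f (e i) * ip (e i) g)"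
    by blast+
  have bk: "b k \<in> V" using Suc.prems by simp
  define r where "r = (\<lambda>x. b k x + (\<Sum>i<k. (- ip (b k) (e i)) *\<^sub>R e i x))"
  have r: "r \<in> V" unfolding r_def using bk e by (intro add_in sum_in)
  have ip_r: "ip r g = ip (b k) g - (\<Sum>i<k. ip (b k) (e i) * ip (e i) g)" if "g \<in> V" for g
    unfolding r_def using that bk e sum_in[OF e] 
    by (subst ip_add) (auto simp: ip_sum_left sum_negf simp del: scaleR_minus_left)
  define s where "s = sqrt (ip r r)"
  define e' where "e' = e(k := \<lambda>x. (1 / s) *\<^sub>R r x)"
  have e'_old: "e' i = e i" if "i < k" for i using that by (simp add: e'_def)
  have ek: "e' k \<in> V" unfolding e'_def using r scale_in by auto
  have e': "e' i \<in> V" if "i < Suc k" for i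
    using that e e'_old ek by (cases "i = k") auto
  have ip_ek: "ip (e' k) g = ip r g / s" if "g \<in> V" for g
    unfolding e'_def using ip_scale[OF r that, of "1/s"] by simp
  have s0: "ip r g = 0" if "s = 0" "g \<in> V" for g
    using null_ip[OF r that(2)] that(1) by (simp add: s_def)
  have orth: "ip r f = 0" if f: "f \<in> b ` {..<k} \<union> e ` {..<k}" for f
  proof -
    have fV: "f \<in> V" using f e Suc.prems by auto
    have "(\<Sum>i<k. ip (b k) (e i) * ip (e i) f) = (\<Sum>i<k. ip f (e i) * ip (e i) (b k))"
      by (intro sum.cong refl) (use ip_sym e bk fV in auto)
    also have "\<dots> = ip f (b k)" using rep[OF f bk] by simp
    finally show ?thesis using ip_r[OF fV] ip_sym[OF fV bk] by simp
  qed
  have sum_eq: "(\<Sum>i<Suc k. ip f (e' i) * ip (e' i) g) = (\<Sum>i<k. ip f (e i) * ip (e i) g) + ip f (e' k) * ip (e' k) g"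
    for f g using e'_old by simp
  have old: "ip f g = (\<Sum>i<Suc k. ip f (e' i) * ip (e' i) g)"
    if "f \<in> b ` {..<k} \<union> e ` {..<k}" "g \<in> V" for f g
  proof -
    have fV: "f \<in> V" using that e Suc.prems by auto
    have "ip f (e' k) = 0"
      using ip_ek[OF fV] orth[OF that(1)] ip_sym[OF fV ek] by simp
    then show ?thesis using sum_eq rep[OF that] by simp
  qed
  have ip_rr: "ip r r = s * s" using ip_nonneg[OF r] by (simp add: s_def)
  have new_e: "ip (e' k) g = (\<Sum>i<Suc k. ip (e' k) (e' i) * ip (e' i) g)" if g: "g \<in> V" for g
  proof -
    have "ip (e' k) (e i) = 0" if "i < k" for i
      using that orth[of "e i"] ip_ek[OF e[OF that]] by simp
    moreover have "ip (e' k) (e' k) * ip (e' k) g = ip (e' k) g"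
      using ip_ek[OF ek] ip_ek[OF g] ip_ek[OF r] ip_sym[OF r ek] ip_rr s0[OF _ g] by (cases "s = 0") auto
    ultimately show ?thesis using sum_eq by simp
  qed
  have new_b: "ip (b k) g = (\<Sum>i<Suc k. ip (b k) (e' i) * ip (e' i) g)" if g: "g \<in> V" for g
  proof -
    have "(\<Sum>i<k. ip (b k) (e i) * ip (e i) r) = 0"
      using orth ip_sym[OF r e] by (intro sum.neutral) auto
    then have "ip (b k) r = s * s" using ip_r[OF r] ip_rr by simp
    then have "ip (b k) (e' k) * ip (e' k) g = ip r g"
      using ip_ek[OF bk] ip_ek[OF g] ip_sym[OF bk ek] ip_sym[OF bk r] s0[OF _ g] by (cases "s = 0") auto
    then show ?thesis using sum_eq ip_r[OF g] by simp
  qed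
  show ?case
  proof (intro exI[of _ e'] conjI allI impI ballI)
    fix f g assume f: "f \<in> b ` {..<Suc k} \<union> e' ` {..<Suc k}" and g: "g \<in> V"
    have "f \<in> b ` {..<k} \<union> e ` {..<k} \<or> f = b k \<or> f = e' k"
      using f e'_old by (auto simp: less_Suc_eq)
    then show "ip f g = (\<Sum>i<Suc k. ip f (e' i) * ip (e' i) g)"
      using old[OF _ g] new_e[OF g] new_b[OF g] by blast
  qed (use e' in auto)
qed

text \<open>
  The representation is stated weakly, after pairing with \<open>g\<close>, because vectors are determined only up
  to vectors of length \<open>0\<close>.
\<close>

lemma Parseval_family:
  fixes n :: nat
  assumes b: "\<And>i. i < n \<Longrightarrow> b i \<in> V"
    and span: "\<And>f. f \<in> V \<Longrightarrow> \<exists>a. \<forall>g\<in>V. ip f g = (\<Sum>i<n. a i * ip (b i) g)"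
  obtains e where "\<And>i. i < n \<Longrightarrow> e i \<in> V"
    "\<And>f g. f \<in> V \<Longrightarrow> g \<in> V \<Longrightarrow> ip f g = (\<Sum>i<n. ip f (e i) * ip (e i) g)"
proof -
  obtain e where e: "\<forall>i<n. e i \<in> V"
    and rep: "\<forall>f. f \<in> b ` {..<n} \<union> e ` {..<n} \<longrightarrow> (\<forall>g\<in>V. ip f g = (\<Sum>i<n. ip f (e i) * ip (e i) g))"
    using Parseval_family_aux[of n b, OF b] by blast
  have "ip f g = (\<Sum>i<n. ip f (e i) * ip (e i) g)" if f: "f \<in> V" and g: "g \<in> V" for f g
  proof -
    obtain a where a: "\<And>g. g \<in> V \<Longrightarrow> ip f g = (\<Sum>i<n. a i * ip (b i) g)" using span[OF f] by blast
    have "ip f g = (\<Sum>j<n. a j * (\<Sum>i<n. ip (b j) (e i) * ip (e i) g))"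
      unfolding a[OF g] using rep g by (intro sum.cong refl) auto
    also have "\<dots> = (\<Sum>i<n. (\<Sum>j<n. a j * ip (b j) (e i)) * ip (e i) g)"
      by (simp add: sum_distrib_left sum_distrib_right mult.assoc) (rule sum.swap)
    also have "\<dots> = (\<Sum>i<n. ip f (e i) * ip (e i) g)"
      using a e by (intro sum.cong refl) auto
    finally show ?thesis .
  qed
  with e show ?thesis using that[of e] by blast
qed

text \<open>
  The Riesz representation theorem, with the explicit representative \<open>\<Sum>i. F (e i) e i\<close>.  Applied to the
  energy form it solves the discrete equation.
\<close>

lemma representable_functional:
  fixes n :: nat
  assumes b: "\<And>i. i < n \<Longrightarrow> b i \<in> V"
    and span: "\<And>f. f \<in> V \<Longrightarrow> \<exists>a. \<forall>g\<in>V. ip f g = (\<Sum>i<n. a i * ip (b i) g)"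
    and F_add: "\<And>f g. f \<in> V \<Longrightarrow> g \<in> V \<Longrightarrow> F (\<lambda>x. f x + g x) = F f + F g"
    and F_scale: "\<And>f a. f \<in> V \<Longrightarrow> F (\<lambda>x. a *\<^sub>R f x) = a * F f"
    and F_null: "\<And>f. f \<in> V \<Longrightarrow> ip f f = 0 \<Longrightarrow> F f = (0::real)"
  obtains u where "u \<in> V" "\<And>v. v \<in> V \<Longrightarrow> ip u v = F v"
proof -
  obtain e where e: "\<And>i. i < n \<Longrightarrow> e i \<in> V"
    and rep: "\<And>f g. f \<in> V \<Longrightarrow> g \<in> V \<Longrightarrow> ip f g = (\<Sum>i<n. ip f (e i) * ip (e i) g)"
    using Parseval_family[of n b, OF b span] by blast
  define u where "u = (\<lambda>x. \<Sum>i<n. F (e i) *\<^sub>R e i x)"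
  have u: "u \<in> V" unfolding u_def using e by (rule sum_in)
  moreover have "ip u v = F v" if v: "v \<in> V" for v
  proof -
    let ?p = "\<lambda>x. \<Sum>i<n. (- ip v (e i)) *\<^sub>R e i x"
    let ?w = "\<lambda>x. v x + ?p x"
    have p: "?p \<in> V" using e by (rule sum_in)
    have w: "?w \<in> V" using v p by (rule add_in)
    have "ip ?w ?w = 0"
      using ip_add[OF v p w] ip_sum_left[of n e ?w "\<lambda>i. - ip v (e i)", OF e w] rep[OF v w]
      by (simp add: sum_negf)
    then have "0 = F v + F ?p" using F_null[OF w] F_add[OF v p] by simp
    also have "F ?p = (\<Sum>i<n. - ip v (e i) * F (e i))"
      by (rule linear_sum) (use F_add F_scale e in auto)
    finally have "F v = (\<Sum>i<n. ip v (e i) * F (e i))" by (simp add: sum_negf)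
    also have "\<dots> = (\<Sum>i<n. F (e i) * ip (e i) v)"
      using ip_sym[OF v e] by (intro sum.cong refl) auto
    also have "\<dots> = ip u v" unfolding u_def using e v by (simp add: ip_sum_left)
    finally show ?thesis by simp
  qed
  ultimately show ?thesis using that by blast
qed

end

section \<open>Essentially bounded functions\<close>

definition ess_bounded :: "'a measure \<Rightarrow> ('a \<Rightarrow> 'v::euclidean_space) \<Rightarrow> bool" where
  "ess_bounded M f \<longleftrightarrow> f \<in> borel_measurable M \<and> (\<exists>B. AE x in M. norm (f x) \<le> B)"

lemma ess_boundedI: "f \<in> borel_measurable M \<Longrightarrow> AE x in M. norm (f x) \<le> B \<Longrightarrow> ess_bounded M f"
  by (auto simp: ess_bounded_def)

lemma ess_boundedE:
  assumes "ess_bounded M f"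
  obtains B where "0 \<le> B" "f \<in> borel_measurable M" "AE x in M. norm (f x) \<le> B"
proof -
  obtain B where B: "AE x in M. norm (f x) \<le> B" and f: "f \<in> borel_measurable M"
    using assms by (auto simp: ess_bounded_def)
  have "AE x in M. norm (f x) \<le> max 0 B" using B by eventually_elim simp
  with f show ?thesis by (intro that[of "max 0 B"]) simp_all
qed

lemma ess_bounded_zero [simp]: "ess_bounded M (\<lambda>x. 0)"
  by (rule ess_boundedI[of _ _ 0]) auto

lemma ess_bounded_add:
  assumes "ess_bounded M f" "ess_bounded M g"
  shows "ess_bounded M (\<lambda>x. f x + g x)"
proof -
  obtain A B where "f \<in> borel_measurable M" "AE x in M. norm (f x) \<le> A"
    "g \<in> borel_measurable M" "AE x in M. norm (g x) \<le> B"
    using assms by (auto elim!: ess_boundedE)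
  then have "AE x in M. norm (f x + g x) \<le> A + B"
    by (auto elim!: eventually_elim2 intro!: norm_triangle_mono)
  then show ?thesis using \<open>f \<in> _\<close> \<open>g \<in> _\<close> by (intro ess_boundedI) auto
qed

lemma ess_bounded_scaleR:
  assumes "ess_bounded M a" "ess_bounded M f"
  shows "ess_bounded M (\<lambda>x. a x *\<^sub>R f x)"
proof -
  obtain A B where "f \<in> borel_measurable M" "AE x in M. norm (f x) \<le> A"
    "a \<in> borel_measurable M" "AE x in M. norm (a x) \<le> B" "0 \<le> A" "0 \<le> B"
    using assms by (auto elim!: ess_boundedE)
  then have "AE x in M. norm (a x *\<^sub>R f x) \<le> B * A"
    by (auto elim!: eventually_elim2 intro!: mult_mono)
  then show ?thesis using \<open>f \<in> _\<close> \<open>a \<in> _\<close> by (intro ess_boundedI) auto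
qed

lemma ess_bounded_inner:
  assumes "ess_bounded M f" "ess_bounded M g"
  shows "ess_bounded M (\<lambda>x. f x \<bullet> g x)"
proof -
  obtain A B where "f \<in> borel_measurable M" "AE x in M. norm (f x) \<le> A"
    "g \<in> borel_measurable M" "AE x in M. norm (g x) \<le> B" "0 \<le> A" "0 \<le> B"
    using assms by (auto elim!: ess_boundedE)
  then have "AE x in M. norm (f x \<bullet> g x) \<le> A * B"
    by (auto elim!: eventually_elim2 intro!: mult_mono order_trans[OF Cauchy_Schwarz_ineq2])
  then show ?thesis using \<open>f \<in> _\<close> \<open>g \<in> _\<close> by (intro ess_boundedI) auto
qed

lemma ess_bounded_mult: "ess_bounded M a \<Longrightarrow> ess_bounded M f \<Longrightarrow> ess_bounded M (\<lambda>x. a x * f x :: real)"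
  using ess_bounded_scaleR[of M a f] by simp

lemma ess_bounded_const: "ess_bounded M (\<lambda>x. c)"
  by (rule ess_boundedI[of _ _ "norm c"]) auto

lemma ess_bounded_norm: "ess_bounded M f \<Longrightarrow> ess_bounded M (\<lambda>x. norm (f x))"
  by (auto simp: ess_bounded_def)

lemma ess_bounded_diff: "ess_bounded M f \<Longrightarrow> ess_bounded M g \<Longrightarrow> ess_bounded M (\<lambda>x. f x - g x)"
  using ess_bounded_add[of M f "\<lambda>x. (-1) *\<^sub>R g x"] ess_bounded_scaleR[OF ess_bounded_const[of M "-1"], of g] by simp

lemma (in finite_measure) integrable_ess_bounded: "ess_bounded M f \<Longrightarrow> integrable M f"
  by (auto simp: ess_bounded_def intro: integrable_const_bound)

lemma Linf_ess_bounded: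
  assumes "f \<in> Linf M"
  shows "ess_bounded M f"
proof -
  have f: "f \<in> borel_measurable M" and lt: "Linf_norm M f < \<infinity>" using assms by (auto simp: Linf_def)
  have ae: "AE x in M. ereal \<bar>f x\<bar> \<le> Linf_norm M f" unfolding Linf_norm_def by (rule esssup_AE)
  obtain B where "Linf_norm M f \<le> ereal B" using lt by (cases "Linf_norm M f") auto
  have "AE x in M. norm (f x) \<le> B"
    using ae
  proof eventually_elim
    case (elim x)
    then have "ereal \<bar>f x\<bar> \<le> ereal B" using \<open>Linf_norm M f \<le> ereal B\<close> by (rule order_trans)
    then show ?case by simp
  qed
  with f show ?thesis by (rule ess_boundedI)
qed

lemma essinf_posE:
  assumes "essinf M (\<lambda>x. ereal (c x)) > 0"
  obtains \<delta> where "\<delta> > 0" "AE x in M. \<delta> \<le> c x"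
proof -
  obtain e where e: "0 < ereal e" "ereal e < essinf M (\<lambda>x. ereal (c x))"
    using ereal_dense2[OF assms] by blast
  have "AE x in M. - ereal (c x) \<le> esssup M (\<lambda>x. - ereal (c x))" by (rule esssup_AE)
  then have "AE x in M. e \<le> c x"
  proof eventually_elim
    case (elim x)
    then have "essinf M (\<lambda>x. ereal (c x)) \<le> ereal (c x)"
      unfolding essinf_def by (metis ereal_minus_le_minus ereal_uminus_uminus)
    then have "ereal e < ereal (c x)" using e(2) by (rule less_le_trans[rotated])
    then show ?case by simp
  qed
  then show ?thesis using e(1) that by simp
qed

lemma essinf_posI:
  assumes "c \<in> borel_measurable M" "\<delta> > 0" "AE x in M. \<delta> \<le> c x"
  shows "essinf M (\<lambda>x. ereal (c x)) > 0"
proof -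
  have "esssup M (\<lambda>x. - ereal (c x)) \<le> ereal (- \<delta>)"
    using assms by (intro esssup_I) (auto elim!: eventually_mono)
  then have "ereal \<delta> \<le> essinf M (\<lambda>x. ereal (c x))"
    unfolding essinf_def by (metis ereal_minus_le_minus ereal_uminus_uminus uminus_ereal.simps(1))
  then show ?thesis using assms(2) by (metis ereal_less(2) less_le_trans)
qed

lemma fin_dim_space_spanE:
  assumes "fin_dim_space M V"
  obtains b and n :: nat where "\<And>i. i < n \<Longrightarrow> b i \<in> V"
    "\<And>f. f \<in> V \<Longrightarrow> \<exists>a. AE x in M. f x = (\<Sum>i<n. a i *\<^sub>R b i x)"
proof -
  obtain B where B: "finite B" "B \<subseteq> V" and span: "\<And>f. f \<in> V \<Longrightarrow> \<exists>a. AE x in M. f x = (\<Sum>b\<in>B. a b *\<^sub>R b x)"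
    using assms unfolding fin_dim_space_def by blast
  obtain b where b: "bij_betw b {..<card B} B"
    using ex_bij_betw_nat_finite[OF B(1)] by (auto simp: atLeast0LessThan)
  have "\<exists>a. AE x in M. f x = (\<Sum>i<card B. a i *\<^sub>R b i x)" if f: "f \<in> V" for f
  proof -
    obtain a where a: "AE x in M. f x = (\<Sum>b\<in>B. a b *\<^sub>R b x)" using span[OF f] by blast
    have "(\<Sum>i<card B. a (b i) *\<^sub>R b i x) = (\<Sum>b\<in>B. a b *\<^sub>R b x)" for x
      using sum.reindex_bij_betw[OF b, of "\<lambda>c. a c *\<^sub>R c x"] .
    with a show ?thesis by (intro exI[of _ "a \<circ> b"]) simp
  qed
  moreover have "b i \<in> V" if "i < card B" for i
    using b B(2) that by (auto simp: bij_betw_def)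
  ultimately show ?thesis using that[of "card B" b] by blast
qed

text \<open>
  Outside \<open>(0,\<infinity>)\<close> the function \<open>m\<close> may be arbitrary, so \<open>m \<circ> c\<close> is only almost everywhere equal to a
  function that is evidently measurable; completeness of the measure absorbs the difference.
\<close>

lemma borel_measurable_compose_positive:
  fixes m :: "real \<Rightarrow> real"
  assumes "complete_measure M" and "continuous_on {0<..} m"
    and c: "c \<in> borel_measurable M" "AE x in M. 0 < c x"
  shows "(\<lambda>x. m (c x)) \<in> borel_measurable M"
proof -
  interpret complete_measure M by fact
  have m: "(\<lambda>r. if r \<in> {0<..} then m r else 0) \<in> borel_measurable borel"
    using assms(2) by (intro borel_measurable_continuous_on_if) auto
  have mc: "(\<lambda>x. if c x \<in> {0<..} then m (c x) else 0) \<in> borel_measurable M"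
    using measurable_compose[OF c(1) m] .
  show ?thesis
  proof (rule measurableI)
    fix A :: "real set" assume A: "A \<in> sets borel"
    let ?A = "(\<lambda>x. if c x \<in> {0<..} then m (c x) else 0) -` A \<inter> space M"
    let ?B = "(\<lambda>x. m (c x)) -` A \<inter> space M"
    have "AE x in M. x \<in> ?A \<longleftrightarrow> x \<in> ?B" using c(2) by eventually_elim simp
    then show "?B \<in> sets M"
      by (rule in_sets_AE[OF _ measurable_sets[OF mc A]]) simp
  qed auto
qed

lemma integral_AE_sum:
  fixes f :: "'a \<Rightarrow> real" and n :: nat
  assumes "AE x in M. f x = (\<Sum>i<n. a i * g i x)" "f \<in> borel_measurable M"
    and g: "\<And>i. i < n \<Longrightarrow> integrable M (g i)"
  shows "(LINT x|M. f x) = (\<Sum>i<n. a i * (LINT x|M. g i x))"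
proof -
  have "(LINT x|M. f x) = (LINT x|M. (\<Sum>i<n. a i * g i x))"
    using assms by (intro integral_cong_AE borel_measurable_sum borel_measurable_times) auto
  also have "\<dots> = (\<Sum>i<n. (LINT x|M. a i * g i x))"
    using g by (intro Bochner_Integration.integral_sum) auto
  finally show ?thesis by simp
qed

section \<open>The discrete flow\<close>

text \<open>
  The properties of \<open>\<mu>\<close> on which the flow depends.  The last one is the source of the linear growth
  of the flow.
\<close>

locale viscosity =
  fixes m :: "real \<Rightarrow> real"
  assumes m_cont: "continuous_on {0<..} m" and m_pos: "\<And>r. 0 < r \<Longrightarrow> 0 < m r"
    and m_lipschitz: "\<And>\<delta> R. 0 < \<delta> \<Longrightarrow> \<exists>\<Lambda>. \<forall>r\<in>{\<delta>..R}. \<forall>s\<in>{\<delta>..R}. \<bar>m r - m s\<bar> \<le> \<Lambda> * \<bar>r - s\<bar>"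
    and m_growth: "\<And>\<delta>. 0 < \<delta> \<Longrightarrow> \<exists>\<kappa>>0. \<forall>r\<ge>\<delta>. \<kappa> \<le> sqrt r * m r"

text \<open>
  The common abstraction of the scalar and the incompressible case.  The operator \<open>D\<close> is linear only
  up to null sets, since a weak gradient is a choice among almost everywhere equal functions.
  Nontriviality of the measure ensures that the \<open>L\<^sup>\<infinity>\<close> norm is nonnegative: on a null measure the
  essential supremum is \<open>-\<infinity>\<close>.
\<close>

locale discrete_flow = finite_measure M + viscosity m
  for M :: "'a measure" and m :: "real \<Rightarrow> real" +
  fixes C :: "('a \<Rightarrow> real) set"
    and W :: "('a \<Rightarrow> 'b::real_vector) set" and D :: "('a \<Rightarrow> 'b) \<Rightarrow> 'a \<Rightarrow> 'e::euclidean_space"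
    and F :: "('a \<Rightarrow> 'b) \<Rightarrow> real"
  assumes complete: "complete_measure M" and nontrivial: "emeasure M (space M) \<noteq> 0"
    and C_fin_dim: "fin_dim_space M C" and C_Linf: "C \<subseteq> Linf M"
    and W_zero: "(\<lambda>x. 0) \<in> W"
    and W_add: "\<And>u v. u \<in> W \<Longrightarrow> v \<in> W \<Longrightarrow> (\<lambda>x. u x + v x) \<in> W"
    and W_scale: "\<And>u a. u \<in> W \<Longrightarrow> (\<lambda>x. a *\<^sub>R u x) \<in> W"
    and W_span: "\<exists>b (n::nat). (\<forall>i<n. b i \<in> W) \<and> (\<forall>u\<in>W. \<exists>a. AE x in M. D u x = (\<Sum>i<n. a i *\<^sub>R D (b i) x))"
    and D_measurable: "\<And>u. u \<in> W \<Longrightarrow> D u \<in> borel_measurable M"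
    and D_sq: "\<And>u. u \<in> W \<Longrightarrow> (\<lambda>x. (norm (D u x))\<^sup>2) \<in> C"
    and D_add: "\<And>u v. u \<in> W \<Longrightarrow> v \<in> W \<Longrightarrow> AE x in M. D (\<lambda>x. u x + v x) x = D u x + D v x"
    and D_scale: "\<And>u a. u \<in> W \<Longrightarrow> AE x in M. D (\<lambda>x. a *\<^sub>R u x) x = a *\<^sub>R D u x"
    and F_add: "\<And>u v. u \<in> W \<Longrightarrow> v \<in> W \<Longrightarrow> F (\<lambda>x. u x + v x) = F u + F v"
    and F_scale: "\<And>u a. u \<in> W \<Longrightarrow> F (\<lambda>x. a *\<^sub>R u x) = a * F u"
    and F_null: "\<And>u. u \<in> W \<Longrightarrow> AE x in M. D u x = 0 \<Longrightarrow> F u = 0"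
begin

lemma C_ess_bounded: "f \<in> C \<Longrightarrow> ess_bounded M f"
  using C_Linf Linf_ess_bounded by blast

lemma D_ess_bounded:
  assumes "u \<in> W"
  shows "ess_bounded M (D u)"
proof -
  obtain B where B: "0 \<le> B" "AE x in M. norm ((norm (D u x))\<^sup>2) \<le> B"
    using C_ess_bounded[OF D_sq[OF assms]] by (rule ess_boundedE)
  from B(2) have "AE x in M. norm (D u x) \<le> sqrt B"
    by eventually_elim (simp add: real_le_rsqrt)
  with D_measurable[OF assms] show ?thesis by (rule ess_boundedI)
qed

lemma W_diff:
  assumes "u \<in> W" "v \<in> W"
  shows "(\<lambda>x. u x - v x) \<in> W" "AE x in M. D (\<lambda>x. u x - v x) x = D u x - D v x"
    "F (\<lambda>x. u x - v x) = F u - F v"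
proof -
  have v: "(\<lambda>x. (-1) *\<^sub>R v x) \<in> W" using assms by (rule_tac W_scale)
  show "(\<lambda>x. u x - v x) \<in> W" using W_add[OF assms(1) v] by simp
  show "AE x in M. D (\<lambda>x. u x - v x) x = D u x - D v x"
    using D_add[OF assms(1) v] D_scale[OF assms(2), of "-1"] by eventually_elim simp
  show "F (\<lambda>x. u x - v x) = F u - F v"
    using F_add[OF assms(1) v] F_scale[OF assms(2), of "-1"] by simp
qed

definition energy :: "('a \<Rightarrow> real) \<Rightarrow> ('a \<Rightarrow> 'b) \<Rightarrow> ('a \<Rightarrow> 'b) \<Rightarrow> real" where
  "energy w u v = (LINT x|M. w x * (D u x \<bullet> D v x))"

lemma integrable_energy:
  assumes "ess_bounded M w" "u \<in> W" "v \<in> W"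
  shows "integrable M (\<lambda>x. w x * (D u x \<bullet> D v x))"
  using assms by (intro integrable_ess_bounded ess_bounded_mult ess_bounded_inner D_ess_bounded)

lemma energy_semi_inner:
  assumes w: "ess_bounded M w" "AE x in M. 0 \<le> w x"
  shows "semi_inner_space W (energy w)"
proof
  fix f g h :: "'a \<Rightarrow> 'b" and a :: real
  assume f: "f \<in> W"
  show "0 \<le> energy w f f" unfolding energy_def using w(2)
    by (intro integral_nonneg_AE) (auto elim!: eventually_mono)
  show "energy w (\<lambda>x. a *\<^sub>R f x) h = a * energy w f h" if h: "h \<in> W"
  proof -
    have "energy w (\<lambda>x. a *\<^sub>R f x) h = (LINT x|M. a * (w x * (D f x \<bullet> D h x)))"
      unfolding energy_def
    proof (rule integral_cong_AE)
      show "AE x in M. w x * (D (\<lambda>x. a *\<^sub>R f x) x \<bullet> D h x) = a * (w x * (D f x \<bullet> D h x))"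
        using D_scale[OF f, of a] by eventually_elim simp
    qed (intro borel_measurable_integrable integrable_mult_right integrable_energy w W_scale f h)+
    then show ?thesis by (simp add: energy_def)
  qed
  assume g: "g \<in> W"
  show "energy w f g = energy w g f" by (simp add: energy_def inner_commute)
  show "energy w (\<lambda>x. f x + g x) h = energy w f h + energy w g h" if h: "h \<in> W"
  proof -
    have "energy w (\<lambda>x. f x + g x) h = (LINT x|M. w x * (D f x \<bullet> D h x) + w x * (D g x \<bullet> D h x))"
      unfolding energy_def
    proof (rule integral_cong_AE)
      show "AE x in M. w x * (D (\<lambda>x. f x + g x) x \<bullet> D h x) = w x * (D f x \<bullet> D h x) + w x * (D g x \<bullet> D h x)"
        using D_add[OF f g] by eventually_elim (simp add: inner_add_left distrib_left)
    qed (intro borel_measurable_integrable Bochner_Integration.integrable_add integrable_energy w W_add f g h)+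
    then show ?thesis
      unfolding energy_def using integrable_energy[OF w(1)] f g h by simp
  qed
qed (use W_zero W_add W_scale in auto)

text \<open>
  A function of zero energy has \<open>D u = 0\<close>, because the weight is positive; so \<open>F\<close> vanishes on it and
  the representation theorem applies.
\<close>

lemma energy_representation:
  assumes w: "ess_bounded M w" "AE x in M. 0 < w x"
  obtains u where "u \<in> W" "\<And>v. v \<in> W \<Longrightarrow> energy w u v = F v"
proof -
  have w0: "AE x in M. 0 \<le> w x" using w(2) by eventually_elim simp
  interpret E: semi_inner_space W "energy w" using w(1) w0 by (rule energy_semi_inner)
  obtain b and n :: nat where b: "\<And>i. i < n \<Longrightarrow> b i \<in> W"
    and span: "\<And>u. u \<in> W \<Longrightarrow> \<exists>a. AE x in M. D u x = (\<Sum>i<n. a i *\<^sub>R D (b i) x)"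
    using W_span by blast
  show ?thesis
  proof (rule E.representable_functional[of n b F])
    show "\<exists>a. \<forall>g\<in>W. energy w f g = (\<Sum>i<n. a i * energy w (b i) g)" if f: "f \<in> W" for f
    proof -
      obtain a where a: "AE x in M. D f x = (\<Sum>i<n. a i *\<^sub>R D (b i) x)" using span[OF f] by blast
      have "energy w f g = (\<Sum>i<n. a i * energy w (b i) g)" if g: "g \<in> W" for g
        unfolding energy_def
      proof (rule integral_AE_sum)
        show "AE x in M. w x * (D f x \<bullet> D g x) = (\<Sum>i<n. a i * (w x * (D (b i) x \<bullet> D g x)))"
          using a by eventually_elim (simp add: inner_sum_left sum_distrib_left mult_ac)
        show "(\<lambda>x. w x * (D f x \<bullet> D g x)) \<in> borel_measurable M"
          by (intro borel_measurable_integrable integrable_energy w f g)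
        show "integrable M (\<lambda>x. w x * (D (b i) x \<bullet> D g x))" if "i < n" for i
          using that by (intro integrable_energy w b g)
      qed
      then show ?thesis by blast
    qed
    show "F f = 0" if f: "f \<in> W" "energy w f f = 0" for f
    proof (rule F_null[OF f(1)])
      have "AE x in M. w x * (D f x \<bullet> D f x) = 0"
        using f(2) w0 unfolding energy_def
        by (subst (asm) integral_nonneg_eq_0_iff_AE) (auto intro!: integrable_energy w f elim!: eventually_mono)
      then show "AE x in M. D f x = 0" using w(2) by eventually_elim auto
    qed
  qed (use b F_add F_scale that in auto)
qed

definition energy_norm :: "('a \<Rightarrow> 'b) \<Rightarrow> real" where
  "energy_norm u = sqrt (energy (\<lambda>_. 1) u u)"

lemma unweighted_semi_inner: "semi_inner_space W (energy (\<lambda>_. 1))"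
  by (rule energy_semi_inner) (auto intro: ess_bounded_const)

lemma energy_norm_sq: "u \<in> W \<Longrightarrow> (energy_norm u)\<^sup>2 = (LINT x|M. (norm (D u x))\<^sup>2)"
  using semi_inner_space.ip_nonneg[OF unweighted_semi_inner]
  by (simp add: energy_norm_def) (simp add: energy_def power2_norm_eq_inner)

lemma energy_norm_nonneg: "u \<in> W \<Longrightarrow> 0 \<le> energy_norm u"
  using semi_inner_space.ip_nonneg[OF unweighted_semi_inner] by (simp add: energy_norm_def)

text \<open>
  With unit weight \<open>F\<close> is represented by some \<open>u\<close>, and the energy norm of \<open>u\<close> serves as bound.
\<close>

lemma F_bounded:
  obtains K where "0 \<le> K" "\<And>v. v \<in> W \<Longrightarrow> \<bar>F v\<bar> \<le> K * energy_norm v"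
proof -
  interpret E: semi_inner_space W "energy (\<lambda>_. 1)" by (rule unweighted_semi_inner)
  obtain u where u: "u \<in> W" "\<And>v. v \<in> W \<Longrightarrow> energy (\<lambda>_. 1) u v = F v"
    by (rule energy_representation[of "\<lambda>_. 1"]) (auto intro: ess_bounded_const)
  show ?thesis
  proof (rule that)
    show "0 \<le> energy_norm u" using u by (rule_tac energy_norm_nonneg)
    show "\<bar>F v\<bar> \<le> energy_norm u * energy_norm v" if "v \<in> W" for v
      using E.Cauchy_Schwarz[OF u(1) that] u(2)[OF that] by (simp add: energy_norm_def)
  qed
qed

text \<open>
  The Cauchy-Schwarz inequality in \<open>L\<^sup>2\<close>, read off from the semi-inner product space of essentially
  bounded functions.
\<close>

lemma integral_norm_mult_le:
  assumes "u \<in> W" "v \<in> W"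
  shows "(LINT x|M. norm (D u x) * norm (D v x)) \<le> energy_norm u * energy_norm v"
proof -
  let ?V = "{f :: 'a \<Rightarrow> real. ess_bounded M f}"
  interpret L: semi_inner_space ?V "\<lambda>f g. LINT x|M. f x * g x"
  proof
    fix f g h :: "'a \<Rightarrow> real" and a :: real
    assume f: "f \<in> ?V"
    show "(\<lambda>x. a *\<^sub>R f x) \<in> ?V" using f by (auto intro: ess_bounded_mult ess_bounded_const)
    assume g: "g \<in> ?V"
    show "(\<lambda>x. f x + g x) \<in> ?V" using f g by (auto intro: ess_bounded_add)
    assume h: "h \<in> ?V"
    show "(LINT x|M. (f x + g x) * h x) = (LINT x|M. f x * h x) + (LINT x|M. g x * h x)"
      using f g h by (simp add: distrib_right integrable_ess_bounded ess_bounded_mult)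
  qed (simp_all add: mult.commute mult.left_commute)
  have eq: "sqrt (LINT x|M. norm (D w x) * norm (D w x)) = energy_norm w" if "w \<in> W" for w
    using energy_norm_sq[OF that] energy_norm_nonneg[OF that] by (simp add: power2_eq_square real_sqrt_unique)
  show ?thesis
    using L.Cauchy_Schwarz[of "\<lambda>x. norm (D u x)" "\<lambda>x. norm (D v x)"] assms
    by (auto simp: eq intro: ess_bounded_norm D_ess_bounded)
qed

definition between :: "real \<Rightarrow> real \<Rightarrow> ('a \<Rightarrow> real) \<Rightarrow> bool" where
  "between \<delta> R c \<longleftrightarrow> c \<in> C \<and> (AE x in M. \<delta> \<le> c x \<and> c x \<le> R)"

lemma weight_bounds:
  assumes "0 < \<delta>" "between \<delta> R c"
  shows "ess_bounded M (\<lambda>x. m (c x))" "AE x in M. 0 < m (c x)"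
proof -
  have c: "c \<in> borel_measurable M" using assms C_ess_bounded by (auto simp: between_def ess_bounded_def)
  have ae: "AE x in M. \<delta> \<le> c x \<and> c x \<le> R" using assms by (simp add: between_def)
  then have pos: "AE x in M. 0 < c x" by eventually_elim (use assms(1) in linarith)
  then show "AE x in M. 0 < m (c x)" by eventually_elim (rule m_pos)
  have "continuous_on {\<delta>..R} m" using m_cont assms(1) by (auto intro: continuous_on_subset)
  then have "bounded (m ` {\<delta>..R})" by (intro compact_imp_bounded compact_continuous_image) auto
  then obtain B where B: "\<And>r. r \<in> {\<delta>..R} \<Longrightarrow> norm (m r) \<le> B" unfolding bounded_iff by blast
  have "AE x in M. norm (m (c x)) \<le> B" using ae by eventually_elim (use B in auto)
  then show "ess_bounded M (\<lambda>x. m (c x))"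
    using borel_measurable_compose_positive[OF complete m_cont c pos] by (rule_tac ess_boundedI)
qed

abbreviation "solution \<equiv> discrete_solution M m W D F"

abbreviation "uh \<equiv> u_h M m W D F"

lemma solution_energy:
  "solution c u \<longleftrightarrow> u \<in> W \<and> (\<forall>v\<in>W. energy (\<lambda>x. m (c x)) u v = F v)"
  by (simp add: discrete_solution_def energy_def)

lemma solution_u_h:
  assumes "0 < \<delta>" "between \<delta> R c"
  shows "solution c (uh c)"
  unfolding u_h_def
proof (rule someI_ex[of "solution c"])
  obtain u where "u \<in> W" "\<And>v. v \<in> W \<Longrightarrow> energy (\<lambda>x. m (c x)) u v = F v"
    by (rule energy_representation[OF weight_bounds[OF assms]]) blast
  then have "solution c u" by (simp add: solution_energy)
  then show "\<exists>u. solution c u" by blast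
qed

text \<open>
  Testing with the solution: \<open>\<kappa> \<le> \<surd>R m(c)\<close> holds wherever \<open>\<delta> \<le> c \<le> R\<close>, so with \<open>N = \<parallel>Du\<parallel>\<close> one has
  \<open>\<kappa> N\<^sup>2 \<le> \<surd>R F(u) \<le> \<surd>R K N\<close>.  Since \<open>\<kappa>\<close> and \<open>K\<close> do not depend on \<open>R\<close>,
  this is linear growth.
\<close>

lemma solution_growth:
  assumes "0 < \<delta>"
  obtains A where "0 \<le> A" "\<And>R c u. between \<delta> R c \<Longrightarrow> 0 \<le> R \<Longrightarrow> solution c u \<Longrightarrow> (energy_norm u)\<^sup>2 \<le> A * R"
proof -
  obtain K where K: "0 \<le> K" "\<And>v. v \<in> W \<Longrightarrow> \<bar>F v\<bar> \<le> K * energy_norm v" by (rule F_bounded) blast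
  obtain \<kappa> where \<kappa>: "\<kappa> > 0" "\<And>r. r \<ge> \<delta> \<Longrightarrow> \<kappa> \<le> sqrt r * m r" using m_growth[OF assms] by blast
  show ?thesis
  proof (rule that)
    show "0 \<le> (K / \<kappa>)\<^sup>2" by simp
    fix R c u assume c: "between \<delta> R c" and R: "0 \<le> R" and sol: "solution c u"
    have u: "u \<in> W" "energy (\<lambda>x. m (c x)) u u = F u" using sol by (auto simp: solution_energy)
    let ?N = "energy_norm u"
    have N: "0 \<le> ?N" using energy_norm_nonneg u by simp
    have "\<kappa> * ?N\<^sup>2 = (LINT x|M. \<kappa> * (D u x \<bullet> D u x))"
      by (simp add: energy_norm_sq u power2_norm_eq_inner)
    also have "\<dots> \<le> (LINT x|M. sqrt R * (m (c x) * (D u x \<bullet> D u x)))"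
    proof (rule integral_mono_AE)
      show "integrable M (\<lambda>x. \<kappa> * (D u x \<bullet> D u x))"
        by (intro integrable_energy ess_bounded_const u)
      show "integrable M (\<lambda>x. sqrt R * (m (c x) * (D u x \<bullet> D u x)))"
        by (intro integrable_mult_right integrable_energy weight_bounds[OF assms c] u)
      have "AE x in M. \<delta> \<le> c x \<and> c x \<le> R" using c by (simp add: between_def)
      then show "AE x in M. \<kappa> * (D u x \<bullet> D u x) \<le> sqrt R * (m (c x) * (D u x \<bullet> D u x))"
      proof eventually_elim
        case (elim x)
        have "\<kappa> \<le> sqrt (c x) * m (c x)" using \<kappa>(2) elim by simp
        also have "\<dots> \<le> sqrt R * m (c x)"
          using elim assms m_pos[of "c x"] by (intro mult_right_mono) auto
        finally have "\<kappa> * (D u x \<bullet> D u x) \<le> sqrt R * m (c x) * (D u x \<bullet> D u x)"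
          by (intro mult_right_mono) auto
        then show ?case by (simp add: mult.assoc)
      qed
    qed
    also have "\<dots> = sqrt R * F u" using u(2) by (simp add: energy_def)
    also have "\<dots> \<le> sqrt R * (K * ?N)"
      using K(2)[OF u(1)] R by (intro mult_left_mono) auto
    finally have "?N * (\<kappa> * ?N) \<le> ?N * (sqrt R * K)" by (simp add: power2_eq_square mult_ac)
    then have "\<kappa> * ?N \<le> sqrt R * K"
      using N K(1) R by (cases "?N = 0") (auto simp: mult_le_cancel_left)
    then have "?N \<le> K / \<kappa> * sqrt R" using \<kappa>(1) by (simp add: field_simps)
    then have "?N\<^sup>2 \<le> (K / \<kappa> * sqrt R)\<^sup>2" using N by (rule power_mono)
    also have "\<dots> = (K / \<kappa>)\<^sup>2 * R" using R by (simp add: power_mult_distrib power_divide)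
    finally show "?N\<^sup>2 \<le> (K / \<kappa>)\<^sup>2 * R" .
  qed
qed

text \<open>
  With \<open>w = u\<^sub>1 - u\<^sub>2\<close>, the two equations give \<open>\<integral> m(c\<^sub>1) |Dw|\<^sup>2 = \<integral> (m(c\<^sub>2) - m(c\<^sub>1)) Du\<^sub>2 \<cdot> Dw\<close>, which bounds
  \<open>\<parallel>Dw\<parallel>\<close> by a multiple of \<open>\<epsilon>\<close>; then \<open>| |Du\<^sub>1|\<^sup>2 - |Du\<^sub>2|\<^sup>2 | \<le> |Dw| (|Du\<^sub>1| + |Du\<^sub>2|)\<close>.
\<close>

lemma solution_lipschitz:
  assumes "0 < \<delta>"
  obtains A where "0 \<le> A" "\<And>c1 c2 u1 u2 \<epsilon>. between \<delta> R c1 \<Longrightarrow> between \<delta> R c2 \<Longrightarrow>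
    solution c1 u1 \<Longrightarrow> solution c2 u2 \<Longrightarrow> 0 \<le> \<epsilon> \<Longrightarrow> AE x in M. \<bar>c1 x - c2 x\<bar> \<le> \<epsilon> \<Longrightarrow>
    (LINT x|M. \<bar>(norm (D u1 x))\<^sup>2 - (norm (D u2 x))\<^sup>2\<bar>) \<le> A * \<epsilon>"
proof -
  \<comment> \<open>If \<open>R < \<delta>\<close> the interval \<open>[\<delta>,R]\<close> is empty and \<open>m\<close> attains no minimum on it.\<close>
  define R' where "R' = max R \<delta>"
  have R': "0 \<le> R'" "\<delta> \<le> R'" using assms by (auto simp: R'_def)
  obtain B where B: "0 \<le> B" "\<And>R c u. between \<delta> R c \<Longrightarrow> 0 \<le> R \<Longrightarrow> solution c u \<Longrightarrow> (energy_norm u)\<^sup>2 \<le> B * R"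
    by (rule solution_growth[OF assms]) blast
  obtain L0 where L0: "\<forall>r\<in>{\<delta>..R'}. \<forall>s\<in>{\<delta>..R'}. \<bar>m r - m s\<bar> \<le> L0 * \<bar>r - s\<bar>"
    using m_lipschitz[OF assms] by blast
  define L where "L = max 0 L0"
  have L: "\<bar>m r - m s\<bar> \<le> L * \<bar>r - s\<bar>" if "r \<in> {\<delta>..R'}" "s \<in> {\<delta>..R'}" for r s
  proof -
    have "\<bar>m r - m s\<bar> \<le> L0 * \<bar>r - s\<bar>" using L0 that by blast
    also have "\<dots> \<le> L * \<bar>r - s\<bar>" unfolding L_def by (rule mult_right_mono) auto
    finally show ?thesis .
  qed
  have "0 \<le> L" by (simp add: L_def)
  have "continuous_on {\<delta>..R'} m" using m_cont assms(1) by (auto intro: continuous_on_subset)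
  then obtain r0 where r0: "r0 \<in> {\<delta>..R'}" "\<And>r. r \<in> {\<delta>..R'} \<Longrightarrow> m r0 \<le> m r"
    using continuous_attains_inf[of "{\<delta>..R'}" m] R' by auto
  define l where "l = m r0"
  have l: "0 < l" "\<And>r. r \<in> {\<delta>..R'} \<Longrightarrow> l \<le> m r" using r0 m_pos assms by (auto simp: l_def)
  define N where "N = sqrt (B * R')"
  have N: "energy_norm u \<le> N" if "between \<delta> R c" "solution c u" for c u
  proof -
    have "AE x in M. \<delta> \<le> c x \<and> c x \<le> R" using that(1) by (simp add: between_def)
    then have "AE x in M. \<delta> \<le> c x \<and> c x \<le> R'" by eventually_elim (auto simp: R'_def)
    then have "between \<delta> R' c" using that by (auto simp: between_def)
    then have "(energy_norm u)\<^sup>2 \<le> B * R'" using that R' B by blast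
    then show ?thesis unfolding N_def by (rule real_le_rsqrt)
  qed
  have N0: "0 \<le> N" using B R' by (simp add: N_def)
  show ?thesis
  proof (rule that)
    show "0 \<le> L * N / l * (N + N)" using \<open>0 \<le> L\<close> N0 l by simp
    fix c1 c2 u1 u2 \<epsilon>
    assume c1: "between \<delta> R c1" and c2: "between \<delta> R c2" and s: "solution c1 u1" "solution c2 u2"
      and \<epsilon>: "0 \<le> \<epsilon>" "AE x in M. \<bar>c1 x - c2 x\<bar> \<le> \<epsilon>"
    have u: "u1 \<in> W" "u2 \<in> W" using s by (auto simp: solution_energy)
    define w where "w = (\<lambda>x. u1 x - u2 x)"
    have w: "w \<in> W" and Dw: "AE x in M. D w x = D u1 x - D u2 x" using W_diff[OF u] by (auto simp: w_def)
    have bounds: "AE x in M. c1 x \<in> {\<delta>..R'} \<and> c2 x \<in> {\<delta>..R'}"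
      using c1 c2 unfolding between_def R'_def by (auto elim!: eventually_elim2)
    interpret E: semi_inner_space W "energy (\<lambda>x. m (c1 x))"
      using weight_bounds[OF assms c1] by (intro energy_semi_inner) (auto elim!: eventually_mono)
    have "energy (\<lambda>x. m (c1 x)) w w = energy (\<lambda>x. m (c1 x)) u1 w - energy (\<lambda>x. m (c1 x)) u2 w"
      using E.ip_add[OF w u(2) w] by (simp add: w_def)
    also have "energy (\<lambda>x. m (c1 x)) u1 w = energy (\<lambda>x. m (c2 x)) u2 w"
      using s w by (auto simp: solution_energy)
    finally have eq: "energy (\<lambda>x. m (c1 x)) w w
        = (LINT x|M. m (c2 x) * (D u2 x \<bullet> D w x) - m (c1 x) * (D u2 x \<bullet> D w x))"
      unfolding energy_def
      using integrable_energy[OF weight_bounds(1)[OF assms c1] u(2) w]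
        integrable_energy[OF weight_bounds(1)[OF assms c2] u(2) w] by simp
    have int_prod: "integrable M (\<lambda>x. norm (D u x) * norm (D v x))" if "u \<in> W" "v \<in> W" for u v
      using that by (intro integrable_ess_bounded ess_bounded_mult ess_bounded_norm D_ess_bounded)
    have "l * (energy_norm w)\<^sup>2 = (LINT x|M. l * (D w x \<bullet> D w x))"
      by (simp add: energy_norm_sq w power2_norm_eq_inner)
    also have "\<dots> \<le> energy (\<lambda>x. m (c1 x)) w w"
      unfolding energy_def
    proof (rule integral_mono_AE)
      show "AE x in M. l * (D w x \<bullet> D w x) \<le> m (c1 x) * (D w x \<bullet> D w x)"
        using bounds by eventually_elim (use l in \<open>auto intro!: mult_right_mono\<close>)
    qed (intro integrable_energy ess_bounded_const weight_bounds[OF assms c1] w)+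
    also have "\<dots> \<le> (LINT x|M. L * \<epsilon> * (norm (D u2 x) * norm (D w x)))"
      unfolding eq
    proof (rule integral_mono_AE)
      show "AE x in M. m (c2 x) * (D u2 x \<bullet> D w x) - m (c1 x) * (D u2 x \<bullet> D w x)
          \<le> L * \<epsilon> * (norm (D u2 x) * norm (D w x))"
        using bounds \<epsilon>(2)
      proof eventually_elim
        case (elim x)
        have "\<bar>m (c2 x) - m (c1 x)\<bar> \<le> L * \<bar>c2 x - c1 x\<bar>" using elim by (intro L) auto
        also have "\<dots> \<le> L * \<epsilon>" using elim \<open>0 \<le> L\<close> by (intro mult_left_mono) auto
        finally have "\<bar>m (c2 x) - m (c1 x)\<bar> * \<bar>D u2 x \<bullet> D w x\<bar> \<le> L * \<epsilon> * (norm (D u2 x) * norm (D w x))"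
          using Cauchy_Schwarz_ineq2[of "D u2 x" "D w x"] \<open>0 \<le> L\<close> \<epsilon>(1) by (intro mult_mono) auto
        then have "\<bar>(m (c2 x) - m (c1 x)) * (D u2 x \<bullet> D w x)\<bar> \<le> L * \<epsilon> * (norm (D u2 x) * norm (D w x))"
          by (simp add: abs_mult)
        then show ?case by (simp add: algebra_simps)
      qed
    qed (intro Bochner_Integration.integrable_diff integrable_energy weight_bounds[OF assms c1]
        weight_bounds[OF assms c2] u w integrable_mult_right int_prod)+
    also have "\<dots> = L * \<epsilon> * (LINT x|M. norm (D u2 x) * norm (D w x))" by simp
    also have "\<dots> \<le> L * \<epsilon> * (energy_norm u2 * energy_norm w)"
      using \<open>0 \<le> L\<close> \<epsilon>(1) by (intro mult_left_mono integral_norm_mult_le u w) auto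
    also have "\<dots> \<le> L * \<epsilon> * (N * energy_norm w)"
      using \<open>0 \<le> L\<close> \<epsilon>(1) N[OF c2 s(2)] energy_norm_nonneg[OF w] by (intro mult_left_mono mult_right_mono) auto
    finally have "energy_norm w * (l * energy_norm w) \<le> energy_norm w * (L * \<epsilon> * N)"
      by (simp add: power2_eq_square mult_ac)
    then have "l * energy_norm w \<le> L * \<epsilon> * N"
      using energy_norm_nonneg[OF w] \<open>0 \<le> L\<close> \<epsilon>(1) N0
      by (cases "energy_norm w = 0") (auto simp: mult_le_cancel_left)
    then have Nw: "energy_norm w \<le> L * N / l * \<epsilon>" using l(1) by (simp add: field_simps)
    have "(LINT x|M. \<bar>(norm (D u1 x))\<^sup>2 - (norm (D u2 x))\<^sup>2\<bar>)
        \<le> (LINT x|M. norm (D w x) * norm (D u1 x) + norm (D w x) * norm (D u2 x))"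
    proof (rule integral_mono_AE)
      show "integrable M (\<lambda>x. \<bar>(norm (D u1 x))\<^sup>2 - (norm (D u2 x))\<^sup>2\<bar>)"
        using u by (intro integrable_abs Bochner_Integration.integrable_diff integrable_ess_bounded
            C_ess_bounded D_sq)
      show "AE x in M. \<bar>(norm (D u1 x))\<^sup>2 - (norm (D u2 x))\<^sup>2\<bar>
          \<le> norm (D w x) * norm (D u1 x) + norm (D w x) * norm (D u2 x)"
        using Dw
      proof eventually_elim
        case (elim x)
        have "\<bar>(norm (D u1 x))\<^sup>2 - (norm (D u2 x))\<^sup>2\<bar> = \<bar>norm (D u1 x) - norm (D u2 x)\<bar> * (norm (D u1 x) + norm (D u2 x))"
          by (simp add: power2_eq_square square_diff_square_factored abs_mult mult.commute)
        also have "\<dots> \<le> norm (D w x) * (norm (D u1 x) + norm (D u2 x))"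
          unfolding elim by (intro mult_right_mono norm_triangle_ineq3) auto
        finally show ?case by (simp add: distrib_left)
      qed
    qed (intro Bochner_Integration.integrable_add int_prod u w)
    also have "\<dots> = (LINT x|M. norm (D w x) * norm (D u1 x)) + (LINT x|M. norm (D w x) * norm (D u2 x))"
      by (intro Bochner_Integration.integral_add int_prod u w)
    also have "\<dots> \<le> energy_norm w * energy_norm u1 + energy_norm w * energy_norm u2"
      by (intro add_mono integral_norm_mult_le u w)
    also have "\<dots> \<le> energy_norm w * N + energy_norm w * N"
      using N[OF c1 s(1)] N[OF c2 s(2)] energy_norm_nonneg[OF w] by (intro add_mono mult_left_mono) auto
    also have "\<dots> = energy_norm w * (N + N)" by (simp add: algebra_simps)
    also have "\<dots> \<le> L * N / l * \<epsilon> * (N + N)" using Nw N0 by (intro mult_right_mono) auto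
    finally show "(LINT x|M. \<bar>(norm (D u1 x))\<^sup>2 - (norm (D u2 x))\<^sup>2\<bar>) \<le> L * N / l * (N + N) * \<epsilon>"
      by (simp add: mult_ac)
  qed
qed

end

lemma has_vector_derivative_iff_quotient:
  "(f has_vector_derivative f') (at t within S) \<longleftrightarrow>
    ((\<lambda>s. (f s - f t) /\<^sub>R (s - t)) \<longlongrightarrow> f') (at t within S)"
proof -
  have "(f has_vector_derivative f') (at t within S) \<longleftrightarrow>
      ((\<lambda>s. norm (f s - f t - (s - t) *\<^sub>R f') / norm (s - t)) \<longlongrightarrow> 0) (at t within S)"
    by (simp add: has_vector_derivative_def has_derivative_iff_norm bounded_linear_scaleR_left)
  also have "\<dots> \<longleftrightarrow> ((\<lambda>s. norm ((f s - f t) /\<^sub>R (s - t) - f')) \<longlongrightarrow> 0) (at t within S)"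
  proof (intro filterlim_cong refl)
    show "\<forall>\<^sub>F s in at t within S. norm (f s - f t - (s - t) *\<^sub>R f') / norm (s - t) = norm ((f s - f t) /\<^sub>R (s - t) - f')"
      unfolding eventually_at_filter
    proof (intro always_eventually allI impI)
      fix s assume "s \<noteq> t"
      then have "(f s - f t) /\<^sub>R (s - t) - f' = (f s - f t - (s - t) *\<^sub>R f') /\<^sub>R (s - t)"
        by (simp add: scaleR_diff_right)
      then show "norm (f s - f t - (s - t) *\<^sub>R f') / norm (s - t) = norm ((f s - f t) /\<^sub>R (s - t) - f')"
        by (simp add: divide_inverse mult.commute)
    qed
  qed
  also have "\<dots> \<longleftrightarrow> ((\<lambda>s. (f s - f t) /\<^sub>R (s - t)) \<longlongrightarrow> f') (at t within S)"
    by (simp only: tendsto_norm_zero_iff LIM_zero_iff)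
  finally show ?thesis .
qed

section \<open>Coordinates in a Banach space\<close>

instance bcontfun :: (metric_space, banach) banach ..

text \<open>
  The dimension of \<open>C\<close> is not known at the level of types, so its coordinate vectors are stored in the
  Banach space of bounded continuous functions on the line: the \<open>i\<close>-th coordinate is the value at the
  integer \<open>i\<close>, and hat functions are dual to these evaluations.
\<close>

definition hat :: "nat \<Rightarrow> real \<Rightarrow>\<^sub>C real" where
  "hat i = Bcontfun (\<lambda>t. max 0 (1 - \<bar>t - real i\<bar>))"

lemma apply_hat: "apply_bcontfun (hat i) t = max 0 (1 - \<bar>t - real i\<bar>)"
proof -
  have "(\<lambda>t. max 0 (1 - \<bar>t - real i\<bar>)) \<in> bcontfun"
    by (rule bcontfun_normI[where b = 1]) (auto intro!: continuous_intros)
  then show ?thesis by (simp add: hat_def Bcontfun_inverse)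
qed

lemma hat_delta: "apply_bcontfun (hat i) (real j) = (if i = j then 1 else 0)"
proof (cases "i = j")
  case False
  then have "1 \<le> \<bar>int j - int i\<bar>" by simp
  then have "1 \<le> \<bar>real j - real i\<bar>" by linarith
  then show ?thesis using False by (simp add: apply_hat)
qed (simp add: apply_hat)

lemma norm_hat: "norm (hat i) \<le> 1"
  by (rule norm_bound) (simp add: apply_hat)

context discrete_flow
begin

lemma C_semi_inner: "semi_inner_space C (\<lambda>f g. LINT x|M. f x * g x)"
proof
  fix f g h :: "'a \<Rightarrow> real" and a :: real
  assume f: "f \<in> C"
  show "(\<lambda>x. a *\<^sub>R f x) \<in> C" using C_fin_dim f unfolding fin_dim_space_def by blast
  assume g: "g \<in> C"
  show "(\<lambda>x. f x + g x) \<in> C" using C_fin_dim f g unfolding fin_dim_space_def by blast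
  assume h: "h \<in> C"
  show "(LINT x|M. (f x + g x) * h x) = (LINT x|M. f x * h x) + (LINT x|M. g x * h x)"
    using f g h by (simp add: distrib_right integrable_ess_bounded ess_bounded_mult C_ess_bounded)
qed (use C_fin_dim in \<open>simp_all add: mult.commute mult.left_commute fin_dim_space_def\<close>)

text \<open>
  In \<open>L\<^sup>2\<close> the vectors of length \<open>0\<close> vanish almost everywhere, so a Parseval family of \<open>C\<close> reconstructs
  its elements almost everywhere.  The coordinates \<open>\<integral> f e\<^sub>i\<close> are bounded by the \<open>L\<^sup>1\<close> norm of \<open>f\<close>,
  because \<open>e\<^sub>i\<close> is bounded, and they in turn bound \<open>f\<close> uniformly, so the \<open>L\<^sup>1\<close> norm controls the
  \<open>L\<^sup>\<infinity>\<close> norm on \<open>C\<close>.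
\<close>

lemma frame_exists:
  obtains n :: nat and e where "\<And>i. i < n \<Longrightarrow> e i \<in> C"
    "\<And>f. f \<in> C \<Longrightarrow> AE x in M. f x = (\<Sum>i<n. (LINT y|M. f y * e i y) * e i x)"
proof -
  interpret L2: semi_inner_space C "\<lambda>f g. LINT x|M. f x * g x" by (rule C_semi_inner)
  obtain b and n :: nat where b: "\<And>i. i < n \<Longrightarrow> b i \<in> C"
    and span: "\<And>f. f \<in> C \<Longrightarrow> \<exists>a. AE x in M. f x = (\<Sum>i<n. a i *\<^sub>R b i x)"
    by (rule fin_dim_space_spanE[OF C_fin_dim]) blast
  have int: "integrable M (\<lambda>x. f x * g x)" if "f \<in> C" "g \<in> C" for f g
    using that by (intro integrable_ess_bounded ess_bounded_mult C_ess_bounded)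
  have "\<exists>a. \<forall>g\<in>C. (LINT x|M. f x * g x) = (\<Sum>i<n. a i * (LINT x|M. b i x * g x))" if f: "f \<in> C" for f
  proof -
    obtain a where a: "AE x in M. f x = (\<Sum>i<n. a i *\<^sub>R b i x)" using span[OF f] by blast
    have "(LINT x|M. f x * g x) = (\<Sum>i<n. a i * (LINT x|M. b i x * g x))" if g: "g \<in> C" for g
    proof (rule integral_AE_sum)
      show "AE x in M. f x * g x = (\<Sum>i<n. a i * (b i x * g x))"
        using a by eventually_elim (simp add: sum_distrib_right mult.assoc)
      show "(\<lambda>x. f x * g x) \<in> borel_measurable M" by (intro borel_measurable_integrable int f g)
      show "integrable M (\<lambda>x. b i x * g x)" if "i < n" for i by (intro int b g that)
    qed
    then show ?thesis by blast
  qed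
  then obtain e where e: "\<And>i. i < n \<Longrightarrow> e i \<in> C"
    and rep: "\<And>f g. f \<in> C \<Longrightarrow> g \<in> C \<Longrightarrow>
      (LINT x|M. f x * g x) = (\<Sum>i<n. (LINT x|M. f x * e i x) * (LINT x|M. e i x * g x))"
    using L2.Parseval_family[of n b, OF b] by blast
  have "AE x in M. f x = (\<Sum>i<n. (LINT y|M. f y * e i y) * e i x)" if f: "f \<in> C" for f
  proof -
    let ?p = "\<lambda>x. \<Sum>i<n. (- (LINT y|M. f y * e i y)) *\<^sub>R e i x"
    let ?w = "\<lambda>x. f x + ?p x"
    have p: "?p \<in> C" using e by (rule L2.sum_in)
    have w: "?w \<in> C" using f p by (rule L2.add_in)
    have "(LINT x|M. ?w x * ?w x) = 0"
      using L2.ip_add[OF f p w] rep[OF f w]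
        L2.ip_sum_left[of n e ?w "\<lambda>i. - (LINT y|M. f y * e i y)", OF e w]
      by (simp add: sum_negf)
    then have "AE x in M. ?w x * ?w x = 0"
      unfolding integral_nonneg_eq_0_iff_AE[OF int[OF w w] AE_I2[OF zero_le_square]] .
    then show ?thesis by eventually_elim (simp add: sum_negf)
  qed
  then show ?thesis using that[of n e] e by blast
qed

end

locale discrete_flow_frame = discrete_flow M m C W D F
  for M :: "'a measure" and m C and W :: "('a \<Rightarrow> 'b::real_vector) set"
    and D :: "('a \<Rightarrow> 'b) \<Rightarrow> 'a \<Rightarrow> 'e::euclidean_space" and F +
  fixes n :: nat and e :: "nat \<Rightarrow> 'a \<Rightarrow> real"
  assumes e_in: "\<And>i. i < n \<Longrightarrow> e i \<in> C"
    and frame: "\<And>f. f \<in> C \<Longrightarrow> AE x in M. f x = (\<Sum>i<n. (LINT y|M. f y * e i y) * e i x)"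
begin

interpretation L2: semi_inner_space C "\<lambda>f g. LINT x|M. f x * g x" by (rule C_semi_inner)

lemma e_ess_bounded: "i < n \<Longrightarrow> ess_bounded M (e i)"
  by (intro C_ess_bounded e_in)

definition synth :: "(real \<Rightarrow>\<^sub>C real) \<Rightarrow> 'a \<Rightarrow> real" where
  "synth v x = (\<Sum>i<n. apply_bcontfun v (real i) * e i x)"

definition coords :: "('a \<Rightarrow> real) \<Rightarrow> real \<Rightarrow>\<^sub>C real" where
  "coords f = (\<Sum>i<n. (LINT x|M. f x * e i x) *\<^sub>R hat i)"

lemma apply_coords:
  assumes "j < n"
  shows "apply_bcontfun (coords f) (real j) = (LINT x|M. f x * e j x)"
proof -
  have "apply_bcontfun (\<Sum>i\<in>I. a i *\<^sub>R hat i) (real j) = (\<Sum>i\<in>I. if i = j then a i else 0)"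
    if "finite I" for I a
    using that by induction (auto simp: hat_delta)
  then show ?thesis using assms by (simp add: coords_def)
qed

lemma synth_in_C: "synth v \<in> C"
  using L2.sum_in[of n e "\<lambda>i. apply_bcontfun v (real i)", OF e_in] by (simp add: synth_def[abs_def])

lemma synth_coords:
  assumes "f \<in> C"
  shows "AE x in M. synth (coords f) x = f x"
  using frame[OF assms] by eventually_elim (simp add: synth_def apply_coords)

lemma synth_scaleR: "synth (a *\<^sub>R v) x = a * synth v x"
  by (simp add: synth_def sum_distrib_left mult.assoc)

lemma synth_add: "synth (v + w) x = synth v x + synth w x"
  by (simp add: synth_def sum.distrib distrib_right)

lemma synth_diff: "synth (v - w) x = synth v x - synth w x"
  by (simp add: synth_def sum_subtractf left_diff_distrib)

lemma abs_apply_le: "\<bar>apply_bcontfun v t\<bar> \<le> norm v" for v :: "real \<Rightarrow>\<^sub>C real"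
  using norm_bounded[of v t] by simp

lemma bounded_linear_synth: "bounded_linear (\<lambda>v. synth v x)"
proof (rule bounded_linear_intro)
  show "norm (synth v x) \<le> norm v * (\<Sum>i<n. \<bar>e i x\<bar>)" for v
    unfolding synth_def sum_distrib_left real_norm_def
    by (intro order_trans[OF sum_abs] sum_mono) (simp add: abs_mult mult_right_mono abs_apply_le)
qed (simp_all add: synth_add synth_scaleR)

lemma frame_bound:
  obtains \<beta> where "0 \<le> \<beta>" "AE x in M. \<forall>i<n. \<bar>e i x\<bar> \<le> \<beta>"
proof -
  have "\<forall>i. \<exists>B. i < n \<longrightarrow> 0 \<le> B \<and> (AE x in M. \<bar>e i x\<bar> \<le> B)"
  proof
    fix i
    show "\<exists>B. i < n \<longrightarrow> 0 \<le> B \<and> (AE x in M. \<bar>e i x\<bar> \<le> B)"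
    proof (cases "i < n")
      case True
      then obtain B where "0 \<le> B" "AE x in M. norm (e i x) \<le> B"
        using ess_boundedE[OF e_ess_bounded] by blast
      then show ?thesis by auto
    qed simp
  qed
  then obtain B where B: "\<And>i. i < n \<Longrightarrow> 0 \<le> B i" "\<And>i. i < n \<Longrightarrow> AE x in M. \<bar>e i x\<bar> \<le> B i"
    by metis
  have "AE x in M. \<forall>i\<in>{..<n}. \<bar>e i x\<bar> \<le> B i" using B(2) by (intro AE_finite_allI) auto
  then have "AE x in M. \<forall>i<n. \<bar>e i x\<bar> \<le> (\<Sum>i<n. B i)"
  proof eventually_elim
    case (elim x)
    have "\<bar>e i x\<bar> \<le> (\<Sum>i<n. B i)" if "i < n" for i
      using elim that member_le_sum[of i "{..<n}" B] B(1) by force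
    then show ?case by blast
  qed
  moreover have "0 \<le> (\<Sum>i<n. B i)" using B(1) by (intro sum_nonneg) auto
  ultimately show ?thesis using that by blast
qed

lemma synth_bound:
  obtains B where "0 < B" "AE x in M. \<forall>v. \<bar>synth v x\<bar> \<le> B * norm v"
proof -
  obtain \<beta> where \<beta>: "0 \<le> \<beta>" "AE x in M. \<forall>i<n. \<bar>e i x\<bar> \<le> \<beta>" by (rule frame_bound)
  from \<beta>(2) have "AE x in M. \<forall>v. \<bar>synth v x\<bar> \<le> (real n * \<beta> + 1) * norm v"
  proof eventually_elim
    case (elim x)
    have "\<bar>synth v x\<bar> \<le> (real n * \<beta> + 1) * norm v" for v
    proof -
      have "\<bar>synth v x\<bar> \<le> (\<Sum>i<n. norm v * \<beta>)"
        unfolding synth_def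
        by (intro order_trans[OF sum_abs] sum_mono) (use elim in \<open>simp add: abs_mult mult_mono abs_apply_le\<close>)
      then show ?thesis using norm_ge_zero[of v] by (simp add: algebra_simps del: norm_ge_zero)
    qed
    then show ?case by blast
  qed
  moreover have "0 < real n * \<beta> + 1" using \<beta>(1) by (simp add: add_nonneg_pos)
  ultimately show ?thesis using that by blast
qed

lemma coords_bound:
  obtains B where "0 \<le> B" "\<And>f. ess_bounded M f \<Longrightarrow> norm (coords f) \<le> B * (LINT x|M. \<bar>f x\<bar>)"
proof -
  obtain \<beta> where \<beta>: "0 \<le> \<beta>" "AE x in M. \<forall>i<n. \<bar>e i x\<bar> \<le> \<beta>" by (rule frame_bound)
  have "norm (coords f) \<le> real n * \<beta> * (LINT x|M. \<bar>f x\<bar>)" if f: "ess_bounded M f" for f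
  proof -
    have bound: "\<bar>LINT x|M. f x * e i x\<bar> \<le> \<beta> * (LINT x|M. \<bar>f x\<bar>)" if "i < n" for i
    proof -
      have int: "integrable M (\<lambda>x. f x * e i x)"
        using f that by (intro integrable_ess_bounded ess_bounded_mult e_ess_bounded)
      have "\<bar>LINT x|M. f x * e i x\<bar> \<le> (LINT x|M. \<bar>f x * e i x\<bar>)"
        using integral_abs_bound by blast
      also have "\<dots> \<le> (LINT x|M. \<beta> * \<bar>f x\<bar>)"
      proof (rule integral_mono_AE)
        show "integrable M (\<lambda>x. \<beta> * \<bar>f x\<bar>)"
          using integrable_ess_bounded[OF f] by (intro integrable_mult_right integrable_abs)
        show "AE x in M. \<bar>f x * e i x\<bar> \<le> \<beta> * \<bar>f x\<bar>"
          using \<beta>(2)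
        proof eventually_elim
          case (elim x)
          then have "\<bar>f x\<bar> * \<bar>e i x\<bar> \<le> \<bar>f x\<bar> * \<beta>" using that by (intro mult_left_mono) auto
          then show ?case by (simp add: abs_mult mult.commute)
        qed
      qed (intro integrable_abs int)
      finally show ?thesis by simp
    qed
    have "norm (coords f) \<le> (\<Sum>i<n. norm ((LINT x|M. f x * e i x) *\<^sub>R hat i))"
      unfolding coords_def by (rule norm_sum)
    also have "\<dots> \<le> (\<Sum>i<n. \<beta> * (LINT x|M. \<bar>f x\<bar>))"
    proof (rule sum_mono)
      fix i assume "i \<in> {..<n}"
      then show "norm ((LINT x|M. f x * e i x) *\<^sub>R hat i) \<le> \<beta> * (LINT x|M. \<bar>f x\<bar>)"
        using mult_mono[OF bound[of i] norm_hat[of i]] \<beta>(1) by simp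
    qed
    finally show ?thesis by simp
  qed
  then show ?thesis using that[of "real n * \<beta>"] \<beta>(1) by simp
qed

lemma coords_diff:
  assumes "ess_bounded M f" "ess_bounded M g"
  shows "coords (\<lambda>x. f x - g x) = coords f - coords g"
proof -
  have "integrable M (\<lambda>x. h x * e i x)" if "i < n" "ess_bounded M h" for h i
    using that by (intro integrable_ess_bounded ess_bounded_mult e_ess_bounded)
  then have "(LINT x|M. (f x - g x) * e i x) = (LINT x|M. f x * e i x) - (LINT x|M. g x * e i x)" if "i < n" for i
    using assms that by (simp add: left_diff_distrib)
  then show ?thesis by (simp add: coords_def scaleR_diff_left sum_subtractf)
qed

lemma coords_scale: "coords (\<lambda>x. a * f x) = a *\<^sub>R coords f"
  by (simp add: coords_def mult.assoc scaleR_sum_right)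

lemma coords_cong:
  assumes "ess_bounded M f" "ess_bounded M g" "AE x in M. f x = g x"
  shows "coords f = coords g"
proof -
  have "(LINT x|M. f x * e i x) = (LINT x|M. g x * e i x)" if "i < n" for i
  proof (rule integral_cong_AE)
    show "AE x in M. f x * e i x = g x * e i x" using assms(3) by eventually_elim simp
  qed (use that assms in \<open>auto intro!: borel_measurable_integrable integrable_ess_bounded ess_bounded_mult e_ess_bounded\<close>)
  then show ?thesis by (simp add: coords_def)
qed

section \<open>The evolution equation in coordinates\<close>

text \<open>
  The constraint on \<open>z = e\<^sup>t c\<close>; the case \<open>\<delta> = 0\<close> is the cone in which the right-hand side takes its
  values.
\<close>

definition upper_set :: "real \<Rightarrow> (real \<Rightarrow>\<^sub>C real) set" where
  "upper_set \<delta> = {v. AE x in M. \<delta> \<le> synth v x}"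

lemma closed_upper_set: "closed (upper_set \<delta>)"
  unfolding closed_sequential_limits
proof (intro allI impI, elim conjE)
  fix v l assume v: "\<forall>k. v k \<in> upper_set \<delta>" and lim: "v \<longlonglongrightarrow> l"
  have "AE x in M. \<forall>k. \<delta> \<le> synth (v k) x"
    using v by (simp add: AE_all_countable upper_set_def)
  then have "AE x in M. \<delta> \<le> synth l x"
  proof eventually_elim
    case (elim x)
    have "(\<lambda>k. synth (v k) x) \<longlonglongrightarrow> synth l x"
      by (rule bounded_linear.tendsto[OF bounded_linear_synth lim])
    then show ?case using elim by (intro LIMSEQ_le_const) auto
  qed
  then show "l \<in> upper_set \<delta>" by (simp add: upper_set_def)
qed

lemma upper_set_scaleR: "v \<in> upper_set \<delta> \<Longrightarrow> 0 \<le> a \<Longrightarrow> a *\<^sub>R v \<in> upper_set (a * \<delta>)"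
  unfolding upper_set_def by (auto simp: synth_scaleR intro: mult_left_mono elim!: eventually_mono)

lemma upper_set_mono: "v \<in> upper_set \<delta> \<Longrightarrow> \<epsilon> \<le> \<delta> \<Longrightarrow> v \<in> upper_set \<epsilon>"
  unfolding upper_set_def by (auto elim!: eventually_mono)

lemma upper_set_add: "v \<in> upper_set \<delta> \<Longrightarrow> w \<in> upper_set \<epsilon> \<Longrightarrow> v + w \<in> upper_set (\<delta> + \<epsilon>)"
  unfolding upper_set_def by (auto simp: synth_add elim!: eventually_elim2)

lemma integral_in_positive_cone:
  assumes "\<And>s. s \<in> {0..t} \<Longrightarrow> f s \<in> upper_set 0"
  shows "integral {0..t::real} f \<in> upper_set 0"
proof -
  have "cone (upper_set 0)"
    unfolding cone_def using upper_set_scaleR[of _ 0] by auto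
  moreover from this have "convex (upper_set 0)"
    unfolding convex_cone[of "upper_set 0"] cone_def
    using upper_set_add[of _ 0 _ 0] convex_cone[of "upper_set 0"] cone_def by auto
  moreover have "0 \<in> upper_set 0" by (simp add: upper_set_def synth_def)
  ultimately show ?thesis
    using integral_in_closed_convex_cone[of "upper_set 0" 0 t f] closed_upper_set assms by auto
qed

definition flux :: "(real \<Rightarrow>\<^sub>C real) \<Rightarrow> real \<Rightarrow>\<^sub>C real" where
  "flux v = coords (\<lambda>x. (norm (D (uh (synth v)) x))\<^sup>2)"

lemma between_synth:
  obtains B where "0 < B" "\<And>v \<delta> R. v \<in> upper_set \<delta> \<Longrightarrow> norm v \<le> R \<Longrightarrow> between \<delta> (B * R) (synth v)"
proof -
  obtain B where B: "0 < B" "AE x in M. \<forall>v. \<bar>synth v x\<bar> \<le> B * norm v" by (rule synth_bound)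
  have "between \<delta> (B * R) (synth v)" if v: "v \<in> upper_set \<delta>" "norm v \<le> R" for v \<delta> R
  proof -
    have "AE x in M. \<delta> \<le> synth v x" using v by (simp add: upper_set_def)
    then have "AE x in M. \<delta> \<le> synth v x \<and> synth v x \<le> B * R"
      using B(2)
    proof eventually_elim
      case (elim x)
      have "synth v x \<le> B * norm v" using elim by (meson abs_le_D1)
      also have "\<dots> \<le> B * R" using v(2) B(1) by simp
      finally show ?case using elim by simp
    qed
    then show ?thesis by (simp add: between_def synth_in_C)
  qed
  then show ?thesis using that B(1) by blast
qed

lemma u_h_in_W: "0 < \<delta> \<Longrightarrow> between \<delta> R c \<Longrightarrow> uh c \<in> W"
  using solution_u_h by (auto simp: solution_energy)

lemma u_h_synth:
  assumes "0 < \<delta>" "v \<in> upper_set \<delta>"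
  shows "uh (synth v) \<in> W"
  using assms between_synth u_h_in_W by (metis order_refl)

lemma synth_flux:
  assumes "0 < \<delta>" "v \<in> upper_set \<delta>"
  shows "AE x in M. synth (flux v) x = (norm (D (uh (synth v)) x))\<^sup>2"
  unfolding flux_def by (intro synth_coords D_sq u_h_synth[OF assms])

lemma flux_nonneg:
  assumes "0 < \<delta>" "v \<in> upper_set \<delta>"
  shows "flux v \<in> upper_set 0"
  using synth_flux[OF assms] unfolding upper_set_def by (auto elim!: eventually_mono)

lemma flux_growth:
  assumes "0 < \<delta>"
  obtains L where "0 \<le> L" "\<And>v. v \<in> upper_set \<delta> \<Longrightarrow> norm (flux v) \<le> L * norm v"
proof -
  obtain A where A: "0 \<le> A" "\<And>R c u. between \<delta> R c \<Longrightarrow> 0 \<le> R \<Longrightarrow> solution c u \<Longrightarrow> (energy_norm u)\<^sup>2 \<le> A * R"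
    by (rule solution_growth[OF assms]) blast
  obtain B where B: "0 < B" "\<And>v \<delta> R. v \<in> upper_set \<delta> \<Longrightarrow> norm v \<le> R \<Longrightarrow> between \<delta> (B * R) (synth v)"
    by (rule between_synth) blast
  obtain K where K: "0 \<le> K" "\<And>f. ess_bounded M f \<Longrightarrow> norm (coords f) \<le> K * (LINT x|M. \<bar>f x\<bar>)"
    by (rule coords_bound) blast
  have "norm (flux v) \<le> (K * (A * B)) * norm v" if v: "v \<in> upper_set \<delta>" for v
  proof -
    let ?u = "uh (synth v)"
    have btw: "between \<delta> (B * norm v) (synth v)" using B(2)[OF v order_refl] .
    have u: "?u \<in> W" "solution (synth v) ?u" using u_h_synth[OF assms v] solution_u_h[OF assms btw] by auto
    have "norm (flux v) \<le> K * (LINT x|M. \<bar>(norm (D ?u x))\<^sup>2\<bar>)"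
      unfolding flux_def by (intro K(2) C_ess_bounded D_sq u)
    also have "(LINT x|M. \<bar>(norm (D ?u x))\<^sup>2\<bar>) = (energy_norm ?u)\<^sup>2" by (simp add: energy_norm_sq u)
    also have "K * \<dots> \<le> K * (A * (B * norm v))"
      using B(1) K(1) by (intro mult_left_mono A(2)[OF btw _ u(2)]) simp_all
    finally show ?thesis by (simp add: mult.assoc)
  qed
  then show ?thesis using that[of "K * (A * B)"] K A B by simp
qed

text \<open>
  The case \<open>\<epsilon> = 0\<close> matters too: it shows that the flux does not depend on the chosen representatives
  of \<open>c\<close> and of the discrete solution.
\<close>

lemma coords_flux_lipschitz:
  assumes "0 < \<delta>"
  obtains \<Lambda> where "0 \<le> \<Lambda>" "\<And>c1 c2 \<epsilon>. between \<delta> R c1 \<Longrightarrow> between \<delta> R c2 \<Longrightarrow> 0 \<le> \<epsilon> \<Longrightarrow>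
    AE x in M. \<bar>c1 x - c2 x\<bar> \<le> \<epsilon> \<Longrightarrow>
    norm (coords (\<lambda>x. (norm (D (uh c1) x))\<^sup>2) - coords (\<lambda>x. (norm (D (uh c2) x))\<^sup>2)) \<le> \<Lambda> * \<epsilon>"
proof -
  obtain A where A: "0 \<le> A" "\<And>c1 c2 u1 u2 \<epsilon>. between \<delta> R c1 \<Longrightarrow> between \<delta> R c2 \<Longrightarrow>
    solution c1 u1 \<Longrightarrow> solution c2 u2 \<Longrightarrow> 0 \<le> \<epsilon> \<Longrightarrow> AE x in M. \<bar>c1 x - c2 x\<bar> \<le> \<epsilon> \<Longrightarrow>
    (LINT x|M. \<bar>(norm (D u1 x))\<^sup>2 - (norm (D u2 x))\<^sup>2\<bar>) \<le> A * \<epsilon>"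
    by (rule solution_lipschitz[OF assms, of R]) blast
  obtain K where K: "0 \<le> K" "\<And>f. ess_bounded M f \<Longrightarrow> norm (coords f) \<le> K * (LINT x|M. \<bar>f x\<bar>)"
    by (rule coords_bound) blast
  show ?thesis
  proof (rule that[of "K * A"])
    show "0 \<le> K * A" using K A by simp
    fix c1 c2 \<epsilon> assume c: "between \<delta> R c1" "between \<delta> R c2" and \<epsilon>: "0 \<le> \<epsilon>" "AE x in M. \<bar>c1 x - c2 x\<bar> \<le> \<epsilon>"
    let ?u1 = "uh c1" and ?u2 = "uh c2"
    have b: "ess_bounded M (\<lambda>x. (norm (D ?u1 x))\<^sup>2)" "ess_bounded M (\<lambda>x. (norm (D ?u2 x))\<^sup>2)"
      by (intro C_ess_bounded D_sq u_h_in_W[OF assms c(1)] u_h_in_W[OF assms c(2)])+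
    have "norm (coords (\<lambda>x. (norm (D ?u1 x))\<^sup>2) - coords (\<lambda>x. (norm (D ?u2 x))\<^sup>2))
        \<le> K * (LINT x|M. \<bar>(norm (D ?u1 x))\<^sup>2 - (norm (D ?u2 x))\<^sup>2\<bar>)"
      unfolding coords_diff[OF b, symmetric] by (intro K(2) ess_bounded_diff b)
    also have "\<dots> \<le> K * (A * \<epsilon>)"
      by (intro mult_left_mono A(2)[OF c _ _ \<epsilon>] K(1) solution_u_h[OF assms c(1)] solution_u_h[OF assms c(2)])
    finally show "norm (coords (\<lambda>x. (norm (D ?u1 x))\<^sup>2) - coords (\<lambda>x. (norm (D ?u2 x))\<^sup>2)) \<le> K * A * \<epsilon>"
      by (simp add: mult.assoc)
  qed
qed

lemma flux_lipschitz:
  assumes "0 < \<delta>"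
  obtains \<Lambda> where "0 \<le> \<Lambda>" "\<And>v w. v \<in> upper_set \<delta> \<Longrightarrow> w \<in> upper_set \<delta> \<Longrightarrow> norm v \<le> R \<Longrightarrow> norm w \<le> R \<Longrightarrow>
    norm (flux v - flux w) \<le> \<Lambda> * norm (v - w)"
proof -
  obtain B where B: "0 < B" "\<And>v \<delta> R. v \<in> upper_set \<delta> \<Longrightarrow> norm v \<le> R \<Longrightarrow> between \<delta> (B * R) (synth v)"
    by (rule between_synth) blast
  obtain B' where B': "0 < B'" "AE x in M. \<forall>v. \<bar>synth v x\<bar> \<le> B' * norm v" by (rule synth_bound)
  obtain \<Lambda> where \<Lambda>: "0 \<le> \<Lambda>" "\<And>c1 c2 \<epsilon>. between \<delta> (B * R) c1 \<Longrightarrow> between \<delta> (B * R) c2 \<Longrightarrow> 0 \<le> \<epsilon> \<Longrightarrow>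
    AE x in M. \<bar>c1 x - c2 x\<bar> \<le> \<epsilon> \<Longrightarrow>
    norm (coords (\<lambda>x. (norm (D (uh c1) x))\<^sup>2) - coords (\<lambda>x. (norm (D (uh c2) x))\<^sup>2)) \<le> \<Lambda> * \<epsilon>"
    by (rule coords_flux_lipschitz[OF assms, of "B * R"]) blast
  show ?thesis
  proof (rule that[of "\<Lambda> * B'"])
    fix v w assume v: "v \<in> upper_set \<delta>" "w \<in> upper_set \<delta>" "norm v \<le> R" "norm w \<le> R"
    have "AE x in M. \<bar>synth v x - synth w x\<bar> \<le> B' * norm (v - w)"
      using B'(2) by eventually_elim (simp flip: synth_diff)
    then show "norm (flux v - flux w) \<le> \<Lambda> * B' * norm (v - w)"
      unfolding flux_def mult.assoc using v B B'(1) by (intro \<Lambda>(2)) auto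
  qed (use \<Lambda> B' in auto)
qed

lemma flux_coords:
  assumes "0 < \<delta>" "between \<delta> R c"
  shows "flux (coords c) = coords (\<lambda>x. (norm (D (uh c) x))\<^sup>2)"
proof -
  have c: "c \<in> C" "AE x in M. \<delta> \<le> c x \<and> c x \<le> R" using assms by (auto simp: between_def)
  have ae: "AE x in M. synth (coords c) x = c x" by (rule synth_coords[OF c(1)])
  have "AE x in M. \<delta> \<le> synth (coords c) x \<and> synth (coords c) x \<le> R"
    using ae c(2) by eventually_elim simp
  then have btw: "between \<delta> R (synth (coords c))" by (simp add: between_def synth_in_C)
  obtain \<Lambda> where \<Lambda>: "0 \<le> \<Lambda>" "\<And>c1 c2 \<epsilon>. between \<delta> R c1 \<Longrightarrow> between \<delta> R c2 \<Longrightarrow> 0 \<le> \<epsilon> \<Longrightarrow>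
    AE x in M. \<bar>c1 x - c2 x\<bar> \<le> \<epsilon> \<Longrightarrow>
    norm (coords (\<lambda>x. (norm (D (uh c1) x))\<^sup>2) - coords (\<lambda>x. (norm (D (uh c2) x))\<^sup>2)) \<le> \<Lambda> * \<epsilon>"
    by (rule coords_flux_lipschitz[OF assms(1), of R]) blast
  have "AE x in M. \<bar>synth (coords c) x - c x\<bar> \<le> 0" using ae by eventually_elim simp
  from \<Lambda>(2)[OF btw assms(2) order_refl this] show ?thesis by (simp add: flux_def)
qed

lemma continuous_on_flux:
  assumes "0 < \<delta>"
  shows "continuous_on (upper_set \<delta>) flux"
  unfolding continuous_on_iff
proof (intro ballI allI impI)
  fix v and \<epsilon> :: real assume v: "v \<in> upper_set \<delta>" and "\<epsilon> > 0"
  obtain \<Lambda> where \<Lambda>: "0 \<le> \<Lambda>" "\<And>v' w. v' \<in> upper_set \<delta> \<Longrightarrow> w \<in> upper_set \<delta> \<Longrightarrow> norm v' \<le> norm v + 1 \<Longrightarrow>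
      norm w \<le> norm v + 1 \<Longrightarrow> norm (flux v' - flux w) \<le> \<Lambda> * norm (v' - w)"
    by (rule flux_lipschitz[OF assms, of "norm v + 1"]) blast
  show "\<exists>d>0. \<forall>w\<in>upper_set \<delta>. dist w v < d \<longrightarrow> dist (flux w) (flux v) < \<epsilon>"
  proof (intro exI[of _ "min 1 (\<epsilon> / (\<Lambda> + 1))"] conjI ballI impI)
    show "0 < min 1 (\<epsilon> / (\<Lambda> + 1))" using \<open>\<epsilon> > 0\<close> \<Lambda>(1) by simp
    fix w assume w: "w \<in> upper_set \<delta>" and d: "dist w v < min 1 (\<epsilon> / (\<Lambda> + 1))"
    have "norm w \<le> norm v + 1" using d norm_triangle_ineq2[of w v] by (simp add: dist_norm)
    then have "dist (flux w) (flux v) \<le> \<Lambda> * dist w v" unfolding dist_norm using w v by (intro \<Lambda>(2)) auto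
    also have "\<dots> \<le> \<Lambda> * (\<epsilon> / (\<Lambda> + 1))" using d \<Lambda>(1) by (intro mult_left_mono) auto
    also have "\<dots> < \<epsilon>" using \<Lambda>(1) \<open>\<epsilon> > 0\<close> by (simp add: field_simps)
    finally show "dist (flux w) (flux v) < \<epsilon>" .
  qed
qed

text \<open>
  The right-hand side after multiplication by the integrating factor: \<open>z = e\<^sup>s a\<close> satisfies
  \<open>z' = e\<^sup>s flux (e\<^sup>-\<^sup>s z)\<close> exactly when \<open>a' = flux a - a\<close>.  In this form the constraint set does not
  depend on time.
\<close>

definition field :: "real \<Rightarrow> (real \<Rightarrow>\<^sub>C real) \<Rightarrow> real \<Rightarrow>\<^sub>C real" where
  "field s z = exp s *\<^sub>R flux (exp (- s) *\<^sub>R z)"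

lemma exp_upper_set:
  assumes "0 < \<delta>" "z \<in> upper_set \<delta>" "s \<le> T"
  shows "exp (- s) *\<^sub>R z \<in> upper_set (exp (- T) * \<delta>)"
proof (rule upper_set_mono)
  show "exp (- s) *\<^sub>R z \<in> upper_set (exp (- s) * \<delta>)" using assms by (intro upper_set_scaleR) auto
qed (use assms in simp)

text \<open>
  On \<open>[0,T]\<close> the argument of \<open>flux\<close> stays above \<open>e\<^sup>-\<^sup>T \<delta>\<close>, so all constants can be taken from that fixed
  lower bound.
\<close>

lemma volterra:
  assumes \<delta>: "0 < \<delta>" and z0: "z0 \<in> upper_set \<delta>"
  shows "volterra_problem field (upper_set \<delta>) z0"
proof
  show "closed (upper_set \<delta>)" by (rule closed_upper_set)
  show "z0 \<in> upper_set \<delta>" by fact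
  show "continuous_on ({0..} \<times> upper_set \<delta>) (\<lambda>(s, z). field s z)"
    unfolding continuous_on_eq_continuous_within
  proof (intro ballI)
    fix p :: "real \<times> (real \<Rightarrow>\<^sub>C real)" assume p: "p \<in> {0..} \<times> upper_set \<delta>"
    define T where "T = fst p + 1"
    have "continuous_on ({0..T} \<times> upper_set \<delta>) (\<lambda>p. flux (exp (- fst p) *\<^sub>R snd p))"
    proof (rule continuous_on_compose2[OF continuous_on_flux])
      show "0 < exp (- T) * \<delta>" using \<delta> by simp
      show "(\<lambda>p. exp (- fst p) *\<^sub>R snd p) ` ({0..T} \<times> upper_set \<delta>) \<subseteq> upper_set (exp (- T) * \<delta>)"
        using exp_upper_set[OF \<delta>] by auto
    qed (intro continuous_intros)
    then have "continuous_on ({0..T} \<times> upper_set \<delta>) (\<lambda>(s, z). field s z)"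
      unfolding field_def case_prod_unfold by (intro continuous_intros)
    then have "continuous (at p within {0..T} \<times> upper_set \<delta>) (\<lambda>(s, z). field s z)"
      using p unfolding continuous_on_eq_continuous_within T_def by force
    moreover have "at p within {0..T} \<times> upper_set \<delta> = at p within {0..} \<times> upper_set \<delta>"
      by (rule at_within_nhd[of _ "{..<T} \<times> UNIV"]) (use p in \<open>auto simp: T_def open_Times\<close>)
    ultimately show "continuous (at p within {0..} \<times> upper_set \<delta>) (\<lambda>(s, z). field s z)" by simp
  qed
  show "z0 + integral {0..t} (\<lambda>s. field s (z s)) \<in> upper_set \<delta>"
    if z: "\<And>s. 0 \<le> s \<Longrightarrow> z s \<in> upper_set \<delta>" for z t
  proof -
    have "field s (z s) \<in> upper_set 0" if "s \<in> {0..t}" for s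
    proof -
      have "flux (exp (- s) *\<^sub>R z s) \<in> upper_set 0"
        using \<delta> z that by (intro flux_nonneg[of "exp (- s) * \<delta>"] upper_set_scaleR) auto
      then show ?thesis using upper_set_scaleR[of _ 0 "exp s"] by (simp add: field_def)
    qed
    then show ?thesis
      using upper_set_add[OF z0 integral_in_positive_cone] by simp
  qed
  show "\<exists>L\<ge>0. \<forall>s\<in>{0..T}. \<forall>z\<in>upper_set \<delta>. norm (field s z) \<le> L * norm z" for T
  proof -
    have "0 < exp (- T) * \<delta>" using \<delta> by simp
    then obtain L where L: "0 \<le> L" "\<And>v. v \<in> upper_set (exp (- T) * \<delta>) \<Longrightarrow> norm (flux v) \<le> L * norm v"
      by (rule flux_growth) blast
    have "norm (field s z) \<le> L * norm z" if "s \<in> {0..T}" "z \<in> upper_set \<delta>" for s z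
    proof -
      have "norm (flux (exp (- s) *\<^sub>R z)) \<le> L * norm (exp (- s) *\<^sub>R z)"
        using that exp_upper_set[OF \<delta>] by (intro L) auto
      then have "exp s * norm (flux (exp (- s) *\<^sub>R z)) \<le> exp s * (L * norm (exp (- s) *\<^sub>R z))"
        by (intro mult_left_mono) auto
      then show ?thesis by (simp add: field_def exp_minus field_simps)
    qed
    then show ?thesis using L(1) by blast
  qed
  show "\<exists>\<Lambda>\<ge>0. \<forall>s\<in>{0..T}. \<forall>z\<in>upper_set \<delta>. \<forall>w\<in>upper_set \<delta>.
      norm z \<le> R \<longrightarrow> norm w \<le> R \<longrightarrow> norm (field s z - field s w) \<le> \<Lambda> * norm (z - w)" for T R
  proof -
    have "0 < exp (- T) * \<delta>" using \<delta> by simp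
    then obtain \<Lambda> where \<Lambda>: "0 \<le> \<Lambda>" "\<And>v w. v \<in> upper_set (exp (- T) * \<delta>) \<Longrightarrow> w \<in> upper_set (exp (- T) * \<delta>) \<Longrightarrow>
        norm v \<le> R \<Longrightarrow> norm w \<le> R \<Longrightarrow> norm (flux v - flux w) \<le> \<Lambda> * norm (v - w)"
      by (rule flux_lipschitz[of _ R]) blast
    have "norm (field s z - field s w) \<le> \<Lambda> * norm (z - w)"
      if s: "s \<in> {0..T}" and z: "z \<in> upper_set \<delta>" "w \<in> upper_set \<delta>" "norm z \<le> R" "norm w \<le> R" for s z w
    proof -
      have small: "norm (exp (- s) *\<^sub>R v) \<le> R" if "norm v \<le> R" for v :: "real \<Rightarrow>\<^sub>C real"
        using that s mult_mono[of "exp (- s)" 1 "norm v" R] by simp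
      have "norm (flux (exp (- s) *\<^sub>R z) - flux (exp (- s) *\<^sub>R w)) \<le> \<Lambda> * norm (exp (- s) *\<^sub>R z - exp (- s) *\<^sub>R w)"
        using s z exp_upper_set[OF \<delta>] small by (intro \<Lambda>(2)) auto
      also have "norm (exp (- s) *\<^sub>R z - exp (- s) *\<^sub>R w) = exp (- s) * norm (z - w)"
        unfolding scaleR_diff_right[symmetric] by simp
      finally have "exp s * norm (flux (exp (- s) *\<^sub>R z) - flux (exp (- s) *\<^sub>R w)) \<le> exp s * (\<Lambda> * (exp (- s) * norm (z - w)))"
        by (intro mult_left_mono) simp_all
      also have "\<dots> = \<Lambda> * norm (z - w)" by (simp add: exp_minus field_simps)
      finally show ?thesis unfolding field_def scaleR_diff_right[symmetric] by simp
    qed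
    then show ?thesis using \<Lambda>(1) by blast
  qed
qed

end

section \<open>Global well-posedness of the discrete flow\<close>

context discrete_flow
begin

lemma positive_part_between:
  assumes "c \<in> positive_part M C"
  obtains \<delta> R where "0 < \<delta>" "between \<delta> R c"
proof -
  have c: "c \<in> C" "essinf M (\<lambda>x. ereal (c x)) > 0" using assms by (auto simp: positive_part_def)
  obtain \<delta> where \<delta>: "\<delta> > 0" "AE x in M. \<delta> \<le> c x" using essinf_posE[OF c(2)] by blast
  obtain R where R: "AE x in M. norm (c x) \<le> R" using ess_boundedE[OF C_ess_bounded[OF c(1)]] by blast
  have "AE x in M. \<delta> \<le> c x \<and> c x \<le> R" using \<delta>(2) R by eventually_elim auto
  then show ?thesis using that[of \<delta> R] \<delta>(1) c(1) by (simp add: between_def)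
qed

lemma between_positive_part:
  assumes "0 < \<delta>" "between \<delta> R c"
  shows "c \<in> positive_part M C"
proof -
  have c: "c \<in> C" "AE x in M. \<delta> \<le> c x \<and> c x \<le> R" using assms(2) by (auto simp: between_def)
  have "essinf M (\<lambda>x. ereal (c x)) > 0"
    by (rule essinf_posI[of _ _ \<delta>])
      (use c assms(1) C_ess_bounded[OF c(1)] in \<open>auto simp: ess_bounded_def elim!: eventually_mono\<close>)
  with c show ?thesis by (simp add: positive_part_def)
qed

text \<open>
  A negative essential supremum of \<open>|f|\<close> would make the measure trivial.
\<close>

lemma Linf_norm_nonneg: "0 \<le> Linf_norm M f"
proof (rule ccontr)
  assume "\<not> 0 \<le> Linf_norm M f"
  then have neg: "Linf_norm M f < 0" by simp
  have "AE x in M. ereal \<bar>f x\<bar> \<le> Linf_norm M f" unfolding Linf_norm_def by (rule esssup_AE)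
  then have "AE x in M. False"
  proof eventually_elim
    case (elim x)
    then have "ereal \<bar>f x\<bar> < 0" using neg by (rule le_less_trans)
    then show ?case by simp
  qed
  then show False using nontrivial ae_filter_eq_bot_iff[of M] by (simp add: eventually_False)
qed

end

context discrete_flow_frame
begin

lemma Linf_norm_synth:
  obtains B where "0 < B" "\<And>v. Linf_norm M (synth v) \<le> ereal (B * norm v)"
proof -
  obtain B where B: "0 < B" "AE x in M. \<forall>v. \<bar>synth v x\<bar> \<le> B * norm v" by (rule synth_bound)
  have "Linf_norm M (synth v) \<le> ereal (B * norm v)" for v
    unfolding Linf_norm_def
  proof (rule esssup_I)
    have "synth v \<in> borel_measurable M" using C_ess_bounded[OF synth_in_C] by (simp add: ess_bounded_def)
    then show "(\<lambda>x. ereal \<bar>synth v x\<bar>) \<in> borel_measurable M" by measurable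
    show "AE x in M. ereal \<bar>synth v x\<bar> \<le> ereal (B * norm v)"
      using B(2) by eventually_elim simp
  qed
  then show ?thesis using that B(1) by blast
qed

lemma Linf_norm_synth_tendsto:
  assumes "(v \<longlongrightarrow> 0) G"
  shows "((\<lambda>s. Linf_norm M (synth (v s))) \<longlongrightarrow> 0) G"
proof -
  obtain B where B: "0 < B" "\<And>v. Linf_norm M (synth v) \<le> ereal (B * norm v)" by (rule Linf_norm_synth) blast
  have "((\<lambda>s. B * norm (v s)) \<longlongrightarrow> B * 0) G"
    using assms by (intro tendsto_intros tendsto_norm_zero)
  then have "((\<lambda>s. ereal (B * norm (v s))) \<longlongrightarrow> ereal (B * 0)) G"
    by (rule tendsto_ereal)
  then have lim: "((\<lambda>s. ereal (B * norm (v s))) \<longlongrightarrow> 0) G" by (simp add: zero_ereal_def)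
  show ?thesis
    by (rule tendsto_sandwich[OF _ _ tendsto_const lim]) (use B Linf_norm_nonneg in auto)
qed

lemma C1_curve_synth:
  assumes deriv: "\<And>t. 0 \<le> t \<Longrightarrow> (a has_vector_derivative a' t) (at t within {0..})"
    and cont: "continuous_on {0..} a'"
  shows "C1_curve M C (\<lambda>t. synth (a t)) (\<lambda>t. synth (a' t))"
  unfolding C1_curve_def
proof (intro allI impI conjI synth_in_C)
  fix t :: real assume t: "0 \<le> t"
  have "((\<lambda>s. (a s - a t) /\<^sub>R (s - t)) \<longlongrightarrow> a' t) (at t within {0..})"
    using deriv[OF t] by (simp only: has_vector_derivative_iff_quotient)
  then have "((\<lambda>s. (a s - a t) /\<^sub>R (s - t) - a' t) \<longlongrightarrow> 0) (at t within {0..})"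
    by (simp only: LIM_zero_iff)
  from Linf_norm_synth_tendsto[OF this]
  show "((\<lambda>s. Linf_norm M (\<lambda>x. (synth (a s) x - synth (a t) x) / (s - t) - synth (a' t) x)) \<longlongrightarrow> 0) (at t within {0..})"
    by (simp add: synth_diff[abs_def] synth_scaleR divide_inverse mult.commute)
  have "((\<lambda>s. a' s - a' t) \<longlongrightarrow> 0) (at t within {0..})"
    using cont t by (simp add: continuous_on LIM_zero)
  from Linf_norm_synth_tendsto[OF this]
  show "((\<lambda>s. Linf_norm M (\<lambda>x. synth (a' s) x - synth (a' t) x)) \<longlongrightarrow> 0) (at t within {0..})"
    by (simp add: synth_diff[abs_def])
qed

lemma coords_tendsto:
  assumes f: "\<And>s. ess_bounded M (f s)" and lim: "((\<lambda>s. Linf_norm M (f s)) \<longlongrightarrow> 0) G"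
  shows "((\<lambda>s. coords (f s)) \<longlongrightarrow> 0) G"
proof -
  obtain K where K: "0 \<le> K" "\<And>f. ess_bounded M f \<Longrightarrow> norm (coords f) \<le> K * (LINT x|M. \<bar>f x\<bar>)"
    by (rule coords_bound) blast
  define A where "A = K * measure M (space M)"
  have "0 \<le> A" using K by (simp add: A_def)
  show ?thesis
  proof (rule tendstoI)
    fix \<eta> :: real assume "0 < \<eta>"
    then have "(0::ereal) < ereal (\<eta> / (A + 1))" using \<open>0 \<le> A\<close> by simp
    from order_tendstoD(2)[OF lim this]
    show "\<forall>\<^sub>F s in G. dist (coords (f s)) 0 < \<eta>"
    proof eventually_elim
      case (elim s)
      have "AE x in M. ereal \<bar>f s x\<bar> \<le> Linf_norm M (f s)" unfolding Linf_norm_def by (rule esssup_AE)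
      then have ae: "AE x in M. \<bar>f s x\<bar> \<le> \<eta> / (A + 1)"
      proof eventually_elim
        case (elim x)
        then have "ereal \<bar>f s x\<bar> < ereal (\<eta> / (A + 1))"
          using \<open>Linf_norm M (f s) < ereal (\<eta> / (A + 1))\<close> by (rule le_less_trans)
        then show ?case by simp
      qed
      have "norm (coords (f s)) \<le> K * (LINT x|M. \<bar>f s x\<bar>)" by (rule K(2)[OF f])
      also have "\<dots> \<le> K * (LINT x|M. \<eta> / (A + 1))"
        using ae integrable_ess_bounded[OF f] K(1)
        by (intro mult_left_mono integral_mono_AE integrable_abs) simp_all
      also have "\<dots> = A * (\<eta> / (A + 1))" by (simp add: A_def mult_ac)
      also have "\<dots> < \<eta>" using \<open>0 \<le> A\<close> \<open>0 < \<eta>\<close> by (simp add: field_simps)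
      finally show ?case by simp
    qed
  qed
qed

lemma coords_derivative:
  assumes curve: "C1_curve M C b b'" and t: "0 \<le> t"
  shows "((\<lambda>t. coords (b t)) has_vector_derivative coords (b' t)) (at t within {0..})"
proof -
  have bC: "b s \<in> C" "b' s \<in> C" if "0 \<le> s" for s using curve that by (auto simp: C1_curve_def)
  define q where "q s = (\<lambda>x. (1 / (s - t)) * (b s x - b t x) - b' t x)" for s
  define q' where "q' s = (if 0 \<le> s then q s else (\<lambda>x. 0))" for s
  have q: "ess_bounded M (q s)" if "0 \<le> s" for s
    unfolding q_def using that t bC
    by (intro ess_bounded_diff ess_bounded_mult ess_bounded_const C_ess_bounded) auto
  have ev: "\<forall>\<^sub>F s in at t within {0..}. 0 \<le> s"
    by (simp add: eventually_at_filter)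
  have "((\<lambda>s. Linf_norm M (q s)) \<longlongrightarrow> 0) (at t within {0..})"
    using curve t unfolding C1_curve_def q_def by simp
  moreover have "\<forall>\<^sub>F s in at t within {0..}. Linf_norm M (q s) = Linf_norm M (q' s)"
    using ev by eventually_elim (simp add: q'_def)
  ultimately have "((\<lambda>s. Linf_norm M (q' s)) \<longlongrightarrow> 0) (at t within {0..})"
    by (rule Lim_transform_eventually)
  then have "((\<lambda>s. coords (q' s)) \<longlongrightarrow> 0) (at t within {0..})"
    by (intro coords_tendsto) (auto simp: q'_def q)
  moreover have "\<forall>\<^sub>F s in at t within {0..}. coords (q' s) = (coords (b s) - coords (b t)) /\<^sub>R (s - t) - coords (b' t)"
    using ev
  proof eventually_elim
    case (elim s)
    have "ess_bounded M (\<lambda>x. (1 / (s - t)) * (b s x - b t x))" "ess_bounded M (b' t)" 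
      using elim t bC by (intro ess_bounded_diff ess_bounded_mult ess_bounded_const C_ess_bounded; simp)+
    then have "coords (q s) = coords (\<lambda>x. (1 / (s - t)) * (b s x - b t x)) - coords (b' t)"
      unfolding q_def by (rule coords_diff)
    also have "coords (\<lambda>x. (1 / (s - t)) * (b s x - b t x)) = (1 / (s - t)) *\<^sub>R (coords (b s) - coords (b t))"
      using elim t bC by (subst coords_scale) (simp add: coords_diff C_ess_bounded)
    finally show ?case using elim by (simp add: q'_def inverse_eq_divide)
  qed
  ultimately have "((\<lambda>s. (coords (b s) - coords (b t)) /\<^sub>R (s - t) - coords (b' t)) \<longlongrightarrow> 0) (at t within {0..})"
    by (rule Lim_transform_eventually)
  then show ?thesis by (simp only: has_vector_derivative_iff_quotient LIM_zero_iff)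
qed

text \<open>
  An arbitrary solution satisfies only \<open>b(t) \<ge> \<delta>\<^sub>t\<close> with some \<open>\<delta>\<^sub>t > 0\<close> for each time.  This already
  makes its flux nonnegative, and integrating then shows that \<open>e\<^sup>t b(t)\<close> keeps the lower bound of the
  initial value.  So it lies in the set where the Picard solution is unique.
\<close>

lemma global_solution_coords:
  assumes b: "global_solution M m C W D F c0 b" and c0: "c0 \<in> C" 
    and \<delta>: "0 < \<delta>" "coords c0 \<in> upper_set \<delta>"
  shows "volterra_problem.solves field (upper_set \<delta>) (coords c0) (\<lambda>t. exp t *\<^sub>R coords (b t))"
proof -
  interpret V: volterra_problem field "upper_set \<delta>" "coords c0" by (rule volterra[OF \<delta>])
  obtain b' where curve: "C1_curve M C b b'"
    and ode: "\<And>t. 0 \<le> t \<Longrightarrow> AE x in M. b' t x = (norm (D (uh (b t)) x))\<^sup>2 - b t x"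
    and init: "AE x in M. b 0 x = c0 x" and pos: "\<And>t. 0 \<le> t \<Longrightarrow> b t \<in> positive_part M C"
    using b unfolding global_solution_def by blast
  have bC: "b t \<in> C" "b' t \<in> C" if "0 \<le> t" for t using curve that by (auto simp: C1_curve_def)
  let ?z = "\<lambda>t. exp t *\<^sub>R coords (b t)"
  have coords_b': "coords (b' t) = flux (coords (b t)) - coords (b t)" and nonneg: "flux (coords (b t)) \<in> upper_set 0"
    if t: "0 \<le> t" for t
  proof -
    obtain d R where d: "0 < d" "between d R (b t)" using positive_part_between[OF pos[OF t]] .
    let ?g = "\<lambda>x. (norm (D (uh (b t)) x))\<^sup>2"
    have g: "ess_bounded M ?g" by (intro C_ess_bounded D_sq u_h_in_W[OF d])
    have "coords (b' t) = coords (\<lambda>x. ?g x - b t x)"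
      by (intro coords_cong ess_bounded_diff g C_ess_bounded bC t ode[OF t])
    also have "\<dots> = coords ?g - coords (b t)"
      by (intro coords_diff g C_ess_bounded bC t)
    finally show "coords (b' t) = flux (coords (b t)) - coords (b t)" by (simp add: flux_coords[OF d])
    have "AE x in M. d \<le> b t x \<and> b t x \<le> R" using d(2) by (simp add: between_def)
    with synth_coords[OF bC(1)[OF t]] have "AE x in M. d \<le> synth (coords (b t)) x"
      by eventually_elim simp
    then show "flux (coords (b t)) \<in> upper_set 0"
      by (intro flux_nonneg[OF d(1)]) (simp add: upper_set_def)
  qed
  have deriv: "(?z has_vector_derivative field t (?z t)) (at t within {0..})" if t: "0 \<le> t" for t
  proof -
    have e: "(exp has_real_derivative exp t) (at t within {0..})"
      by (rule has_field_derivative_at_within[OF DERIV_exp])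
    have "(?z has_vector_derivative exp t *\<^sub>R coords (b' t) + exp t *\<^sub>R coords (b t)) (at t within {0..})"
      by (rule has_vector_derivative_scaleR[OF e coords_derivative[OF curve t]])
    moreover have "exp t *\<^sub>R coords (b' t) + exp t *\<^sub>R coords (b t) = field t (?z t)"
      by (simp add: field_def coords_b'[OF t] algebra_simps flip: exp_add)
    ultimately show ?thesis by simp
  qed
  have z0: "?z 0 = coords c0"
    using coords_cong[OF C_ess_bounded[OF bC(1)] C_ess_bounded[OF c0] init] by simp
  have cont: "continuous_on {0..} ?z"
    unfolding continuous_on_eq_continuous_within
    using deriv by (intro ballI has_vector_derivative_continuous) auto
  have in_S: "?z t \<in> upper_set \<delta>" if t: "0 \<le> t" for t
  proof -
    have "((\<lambda>s. field s (?z s)) has_integral ?z t - ?z 0) {0..t}"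
      using t by (intro fundamental_theorem_of_calculus)
        (auto intro!: has_vector_derivative_within_subset[OF deriv])
    then have eq: "?z t = coords c0 + integral {0..t} (\<lambda>s. field s (?z s))"
      using z0 by (simp add: integral_unique)
    have "field s (?z s) \<in> upper_set 0" if "s \<in> {0..t}" for s
      using upper_set_scaleR[OF nonneg[of s], of "exp s"] that by (simp add: field_def flip: exp_add)
    then show ?thesis
      unfolding eq using upper_set_add[OF \<delta>(2) integral_in_positive_cone] by simp
  qed
  show ?thesis
    by (rule V.solvesI) (use cont in_S z0 deriv in \<open>auto simp: V.path_def\<close>)
qed

theorem well_posed_flow:
  assumes "c0 \<in> positive_part M C"
  shows "well_posed M m C W D F c0"
proof -
  have c0: "c0 \<in> C" using assms by (simp add: positive_part_def)
  obtain \<delta> R0 where \<delta>: "0 < \<delta>" and btw: "between \<delta> R0 c0" using positive_part_between[OF assms] .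
  have "AE x in M. \<delta> \<le> c0 x \<and> c0 x \<le> R0" using btw by (simp add: between_def)
  with synth_coords[OF c0] have "AE x in M. \<delta> \<le> synth (coords c0) x"
    by eventually_elim simp
  then have z0: "coords c0 \<in> upper_set \<delta>" by (simp add: upper_set_def)
  interpret V: volterra_problem field "upper_set \<delta>" "coords c0" by (rule volterra[OF \<delta> z0])
  obtain z where z: "V.solves z" using V.exists by blast
  have zS: "z t \<in> upper_set \<delta>" if "0 \<le> t" for t using z that unfolding V.solves_def V.path_def by blast
  have zcont: "continuous_on {0..} z" using z by (simp add: V.solves_def V.path_def)
  define a where "a t = exp (- t) *\<^sub>R z t" for t
  define c where "c t = synth (a t)" for t
  have aS: "a t \<in> upper_set (exp (- T) * \<delta>)" if "0 \<le> t" "t \<le> T" for t T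
    unfolding a_def by (rule exp_upper_set[OF \<delta> zS]) (use that in auto)
  have a_deriv: "(a has_vector_derivative flux (a t) - a t) (at t within {0..})" if t: "0 \<le> t" for t
  proof -
    have e: "((\<lambda>t. exp (- t)) has_real_derivative - exp (- t)) (at t within {0..})"
      by (auto intro!: derivative_eq_intros)
    have "(a has_vector_derivative exp (- t) *\<^sub>R field t (z t) + (- exp (- t)) *\<^sub>R z t) (at t within {0..})"
      unfolding a_def[abs_def]
      by (rule has_vector_derivative_scaleR[OF e V.solves_has_derivative[OF z t]])
    then show ?thesis by (simp add: field_def a_def flip: exp_add)
  qed
  have a_cont: "continuous_on {0..} a" unfolding a_def[abs_def] by (intro continuous_intros zcont)
  have flux_cont: "continuous_on {0..} (\<lambda>t. flux (a t) - a t)"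
  proof -
    have "continuous_on {0..} (\<lambda>t. exp (- t) *\<^sub>R field t (z t) - a t)"
      using z by (intro continuous_intros a_cont V.continuous_on_h_path) (simp add: V.solves_def)
    then show ?thesis by (simp add: field_def a_def flip: exp_add)
  qed
  obtain B where B: "0 < B" "\<And>v \<delta> R. v \<in> upper_set \<delta> \<Longrightarrow> norm v \<le> R \<Longrightarrow> between \<delta> (B * R) (synth v)"
    by (rule between_synth) blast
  have "global_solution M m C W D F c0 c"
    unfolding global_solution_def
  proof (intro conjI exI[of _ "\<lambda>t. synth (flux (a t) - a t)"] allI impI)
    show "C1_curve M C c (\<lambda>t. synth (flux (a t) - a t))"
      unfolding c_def[abs_def] using a_deriv flux_cont by (rule C1_curve_synth)
    show "AE x in M. c 0 x = c0 x"
    proof -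
      have "a 0 = coords c0" using z by (simp add: a_def V.solves_def)
      then show ?thesis using synth_coords[OF c0] by (simp add: c_def)
    qed
    fix t :: real assume t: "0 \<le> t"
    have pos: "0 < exp (- t) * \<delta>" using \<delta> by simp
    show "AE x in M. synth (flux (a t) - a t) x = (norm (D (uh (c t)) x))\<^sup>2 - c t x"
      using synth_flux[OF pos aS[OF t order_refl]] by eventually_elim (simp add: synth_diff c_def)
    show "c t \<in> positive_part M C"
      unfolding c_def by (rule between_positive_part[OF pos B(2)[OF aS[OF t order_refl] order_refl]])
  qed
  moreover have "AE x in M. b t x = c t x" if b: "global_solution M m C W D F c0 b" and t: "0 \<le> t" for b t
  proof -
    have "exp t *\<^sub>R coords (b t) = z t"
      using V.unique[OF global_solution_coords[OF b c0 \<delta> z0] z t] .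
    then have "coords (b t) = a t" by (simp add: a_def flip: exp_add) (metis exp_minus_inverse mult.commute scaleR_one scaleR_scaleR)
    moreover have "b t \<in> C" using b t by (auto simp: global_solution_def positive_part_def)
    ultimately show ?thesis using synth_coords[of "b t"] unfolding c_def by auto
  qed
  moreover have "\<exists>\<epsilon>>0. \<forall>t. 0 \<le> t \<and> t \<le> T \<longrightarrow> (AE x in M. \<epsilon> \<le> c t x \<and> c t x \<le> 1 / \<epsilon>)" for T
  proof -
    have "continuous_on {0..T} a" using a_cont by (rule continuous_on_subset) auto
    then have "bounded (a ` {0..T})" by (intro compact_imp_bounded compact_continuous_image) auto
    then obtain R where R: "\<forall>v\<in>a ` {0..T}. norm v \<le> R" unfolding bounded_iff by blast
    define \<epsilon> where "\<epsilon> = min (exp (- T) * \<delta>) (1 / (\<bar>B * R\<bar> + 1))"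
    have "\<epsilon> > 0" using \<delta> by (simp add: \<epsilon>_def)
    have "\<epsilon> \<le> 1 / (\<bar>B * R\<bar> + 1)" by (simp add: \<epsilon>_def)
    then have "\<bar>B * R\<bar> + 1 \<le> 1 / \<epsilon>" using \<open>\<epsilon> > 0\<close> by (simp add: field_simps)
    then have up: "B * R \<le> 1 / \<epsilon>" by linarith
    have "AE x in M. \<epsilon> \<le> c t x \<and> c t x \<le> 1 / \<epsilon>" if "0 \<le> t \<and> t \<le> T" for t
    proof -
      have "between (exp (- T) * \<delta>) (B * R) (c t)"
        unfolding c_def using that R by (intro B(2) aS) auto
      then have "AE x in M. exp (- T) * \<delta> \<le> c t x \<and> c t x \<le> B * R" by (simp add: between_def)
      then show ?thesis by eventually_elim (use up in \<open>auto simp: \<epsilon>_def\<close>)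
    qed
    with \<open>\<epsilon> > 0\<close> show ?thesis by blast
  qed
  ultimately show ?thesis unfolding well_posed_def by blast
qed

end

theorem (in discrete_flow) well_posed:
  assumes "c0 \<in> positive_part M C"
  shows "well_posed M m C W D F c0"
proof -
  obtain n :: nat and e where "\<And>i. i < n \<Longrightarrow> e i \<in> C"
    "\<And>f. f \<in> C \<Longrightarrow> AE x in M. f x = (\<Sum>i<n. (LINT y|M. f y * e i y) * e i x)"
    by (rule frame_exists) blast
  then interpret discrete_flow_frame M m C W D F n e
    by unfold_locales
  show ?thesis using assms by (rule well_posed_flow)
qed

section \<open>The viscosity function\<close>

context
  fixes \<phi> :: "real \<Rightarrow> real"
  assumes N: "N_function \<phi>" and C3: "C3_on_pos \<phi>"
begin

lemma phi_deriv: "0 < r \<Longrightarrow> (\<phi> has_real_derivative deriv \<phi> r) (at r)"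
  using C3[unfolded C3_on_pos_def, THEN conjunct1, rule_format, of 0 r]
  by (auto intro: field_differentiable_derivI)

lemma phi_deriv2: "0 < r \<Longrightarrow> (deriv \<phi> has_real_derivative deriv (deriv \<phi>) r) (at r)"
  using C3[unfolded C3_on_pos_def, THEN conjunct1, rule_format, of 1 r]
  by (auto intro: field_differentiable_derivI)

lemma phi_deriv2_continuous: "continuous_on {0<..} (deriv (deriv \<phi>))"
proof -
  have "deriv (deriv \<phi>) field_differentiable (at r)" if "0 < r" for r
    using C3[unfolded C3_on_pos_def, THEN conjunct1, rule_format, of 2 r] that by (simp add: numeral_2_eq_2)
  then show ?thesis
    by (auto intro!: continuous_at_imp_continuous_on field_differentiable_imp_continuous_at)
qed

text \<open>
  Both the positivity and the monotonicity of \<open>\<phi>'\<close> are read off from the tangent inequality.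
\<close>

lemma phi_tangent:
  assumes "0 < r" "0 \<le> s"
  shows "deriv \<phi> r * (s - r) \<le> \<phi> s - \<phi> r"
proof (rule convex_on_imp_above_tangent[of "{0..}"])
  show "convex_on {0..} \<phi>" using N by (simp add: N_function_def)
  show "(\<phi> has_field_derivative deriv \<phi> r) (at r within {0..})"
    using phi_deriv[OF assms(1)] by (rule has_field_derivative_at_within)
qed (use assms in \<open>auto simp: interior_Ici[of 0]\<close>)

lemma phi_deriv_pos: "0 < deriv \<phi> r" if "0 < r"
proof -
  have "\<phi> r > 0" "\<phi> 0 = 0" using N that by (auto simp: N_function_def)
  then have "deriv \<phi> r * r > 0" using phi_tangent[OF that, of 0] by simp
  then show ?thesis using that by (simp add: zero_less_mult_iff)
qed

lemma phi_deriv_mono: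
  assumes "0 < r" "r \<le> s"
  shows "deriv \<phi> r \<le> deriv \<phi> s"
proof (cases "r = s")
  case False
  then have "deriv \<phi> r * (s - r) \<le> deriv \<phi> s * (s - r)"
    using phi_tangent[of r s] phi_tangent[of s r] assms by (simp add: algebra_simps)
  then show ?thesis using False assms by simp
qed simp

lemma mu_pos: "0 < r \<Longrightarrow> 0 < mu \<phi> r"
  using mu_eq[OF C3] phi_deriv_pos[of "sqrt r"] by simp

lemma sqrt_mu: "0 < r \<Longrightarrow> sqrt r * mu \<phi> r = deriv \<phi> (sqrt r)"
  using mu_eq[OF C3] by simp

text \<open>
  The function \<open>\<surd>r \<mu>(r) = \<phi>'(\<surd>r)\<close> is nondecreasing.
\<close>

lemma mu_growth:
  assumes "0 < \<delta>"
  shows "\<exists>\<kappa>>0. \<forall>r\<ge>\<delta>. \<kappa> \<le> sqrt r * mu \<phi> r"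
  using assms by (intro exI[of _ "deriv \<phi> (sqrt \<delta>)"]) (auto simp: sqrt_mu phi_deriv_pos intro!: phi_deriv_mono)

lemma mu_deriv:
  assumes r: "0 < r"
  shows "(mu \<phi> has_real_derivative
    (deriv (deriv \<phi>) (sqrt r) * sqrt r - deriv \<phi> (sqrt r)) / (2 * r * sqrt r)) (at r)"
proof -
  have sq: "(sqrt has_real_derivative inverse (sqrt r) / 2) (at r)" using r by (rule DERIV_real_sqrt)
  have "((\<lambda>r. deriv \<phi> (sqrt r)) has_real_derivative deriv (deriv \<phi>) (sqrt r) * (inverse (sqrt r) / 2)) (at r)"
    using r by (intro DERIV_chain2[OF phi_deriv2 sq]) simp
  from DERIV_divide[OF this sq]
  have "((\<lambda>r. deriv \<phi> (sqrt r) / sqrt r) has_real_derivative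
    (deriv (deriv \<phi>) (sqrt r) * (inverse (sqrt r) / 2) * sqrt r - deriv \<phi> (sqrt r) * (inverse (sqrt r) / 2)) / (sqrt r * sqrt r)) (at r)"
    using r by simp
  also have "(deriv (deriv \<phi>) (sqrt r) * (inverse (sqrt r) / 2) * sqrt r - deriv \<phi> (sqrt r) * (inverse (sqrt r) / 2)) / (sqrt r * sqrt r)
    = (deriv (deriv \<phi>) (sqrt r) * sqrt r - deriv \<phi> (sqrt r)) / (2 * r * sqrt r)"
    using r by (simp add: field_simps)
  finally show ?thesis
  proof (rule has_field_derivative_transform_within_open[where S = "{0<..}"])
    show "deriv \<phi> (sqrt x) / sqrt x = mu \<phi> x" if "x \<in> {0<..}" for x
      using mu_eq[OF C3, of x] that by simp
  qed (use r in auto)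
qed

lemma mu_continuous: "continuous_on {0<..} (mu \<phi>)"
  using mu_deriv by (auto intro!: continuous_at_imp_continuous_on DERIV_isCont)

lemma mu_lipschitz:
  assumes "0 < \<delta>"
  shows "\<exists>\<Lambda>. \<forall>r\<in>{\<delta>..R}. \<forall>s\<in>{\<delta>..R}. \<bar>mu \<phi> r - mu \<phi> s\<bar> \<le> \<Lambda> * \<bar>r - s\<bar>"
proof -
  define d where "d r = (deriv (deriv \<phi>) (sqrt r) * sqrt r - deriv \<phi> (sqrt r)) / (2 * r * sqrt r)" for r
  have d1: "continuous_on {0<..} (deriv \<phi>)"
    using phi_deriv2 by (auto intro!: continuous_at_imp_continuous_on DERIV_isCont)
  have sq: "continuous_on {\<delta>..R} sqrt" by (intro continuous_intros)
  have "continuous_on {\<delta>..R} (\<lambda>r. deriv (deriv \<phi>) (sqrt r))" "continuous_on {\<delta>..R} (\<lambda>r. deriv \<phi> (sqrt r))"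
    using assms by (auto intro!: continuous_on_compose2[OF phi_deriv2_continuous sq] continuous_on_compose2[OF d1 sq])
  then have "continuous_on {\<delta>..R} d" unfolding d_def[abs_def] using assms by (intro continuous_intros) auto
  then have "bounded (d ` {\<delta>..R})" by (intro compact_imp_bounded compact_continuous_image) auto
  then obtain B where B: "\<forall>y\<in>d ` {\<delta>..R}. norm y \<le> B" using bounded_iff[of "d ` {\<delta>..R}"] by meson
  have der: "(mu \<phi> has_field_derivative d z) (at z within {\<delta>..R})" if "z \<in> {\<delta>..R}" for z
    unfolding d_def using that assms by (intro has_field_derivative_at_within[OF mu_deriv]) simp
  have B': "norm (d z) \<le> B" if "z \<in> {\<delta>..R}" for z using B that by (rule bspec[OF _ imageI])
  have "norm (mu \<phi> r - mu \<phi> s) \<le> B * norm (r - s)" if "r \<in> {\<delta>..R}" "s \<in> {\<delta>..R}" for r s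
    by (rule field_differentiable_bound[of "{\<delta>..R}" "mu \<phi>" d B r s]) (simp_all add: der B' that del: atLeastAtMost_iff real_norm_def)
  then show ?thesis unfolding real_norm_def by blast
qed

lemma viscosity_mu: "viscosity (mu \<phi>)"
  using mu_continuous mu_pos mu_lipschitz mu_growth by unfold_locales

end

section \<open>Partial derivatives\<close>

lemma pderiv_at_eq:
  assumes "(f has_derivative f') (at x)"
  shows "pderiv_at i f x = f' (axis i 1)"
  unfolding pderiv_at_def using frechet_derivative_at[OF assms] by simp

lemma pderiv_at_add:
  assumes "f differentiable at x" "g differentiable at x"
  shows "pderiv_at i (\<lambda>x. f x + g x) x = pderiv_at i f x + pderiv_at i g x"
  using has_derivative_add[OF assms[unfolded frechet_derivative_works]]
  by (subst pderiv_at_eq) (simp_all add: pderiv_at_def)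

lemma pderiv_at_mult:
  assumes "f differentiable at x" "g differentiable at x"
  shows "pderiv_at i (\<lambda>x. f x * g x) x = f x * pderiv_at i g x + pderiv_at i f x * g x"
  using has_derivative_mult[OF assms[unfolded frechet_derivative_works]]
  by (subst pderiv_at_eq) (simp_all add: pderiv_at_def)

lemma pderiv_at_const: "pderiv_at i (\<lambda>x. c) x = 0"
  by (subst pderiv_at_eq[of _ "\<lambda>_. 0"]) auto

section \<open>Smooth cut-off functions\<close>

text \<open>
  The functions \<open>p(1/t) e\<^sup>-\<^sup>1\<^sup>/\<^sup>t\<close> for \<open>t > 0\<close>, extended by \<open>0\<close>.  With a polynomial factor \<open>p\<close> the class is closed
  under differentiation, which makes smoothness a matter of a single derivative.
\<close>

definition flat :: "real poly \<Rightarrow> real \<Rightarrow> real" where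
  "flat p t = (if t \<le> 0 then 0 else poly p (1 / t) * exp (- (1 / t)))"

lemma poly_mult_exp_tendsto_0: "((\<lambda>y. poly p y * exp (- y)) \<longlongrightarrow> 0) at_top" for p :: "real poly"
proof -
  have "((\<lambda>y. \<Sum>i\<le>degree p. coeff p i * (y ^ i / exp y)) \<longlongrightarrow> (\<Sum>i\<le>degree p. coeff p i * 0)) at_top"
    by (intro tendsto_intros tendsto_power_div_exp_0)
  then show ?thesis by (simp add: poly_altdef exp_minus field_simps sum_divide_distrib)
qed

text \<open>
  For \<open>t > 0\<close> the derivative of \<open>p(1/t) e\<^sup>-\<^sup>1\<^sup>/\<^sup>t\<close> is \<open>(p(1/t) - p'(1/t)) / t\<^sup>2 \<cdot> e\<^sup>-\<^sup>1\<^sup>/\<^sup>t\<close>; at \<open>0\<close> the exponential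
  beats every power.
\<close>

lemma flat_has_derivative:
  "(flat p has_real_derivative flat ([:0, 0, 1:] * (p - pderiv p)) t) (at t)"
proof -
  let ?q = "[:0, 0, 1:] * (p - pderiv p)"
  consider "t < 0" | "t > 0" | "t = 0" by linarith
  then show ?thesis
  proof cases
    case 1
    have "((\<lambda>_. 0) has_real_derivative flat ?q t) (at t)" using 1 by (simp add: flat_def)
    then show ?thesis
      by (rule has_field_derivative_transform_within_open[where S = "{..<0}"]) (use 1 in \<open>auto simp: flat_def\<close>)
  next
    case 2
    have "((\<lambda>t. poly p (1 / t) * exp (- (1 / t))) has_real_derivative flat ?q t) (at t)"
      using 2 by (auto intro!: derivative_eq_intros poly_DERIV[THEN DERIV_chain2]
          simp: flat_def field_simps power2_eq_square)
    then show ?thesis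
      by (rule has_field_derivative_transform_within_open[where S = "{0<..}"]) (use 2 in \<open>auto simp: flat_def\<close>)
  next
    case 3
    have "((\<lambda>h. poly ([:0, 1:] * p) (1 / h) * exp (- (1 / h))) \<longlongrightarrow> 0) (at_right 0)"
    proof (rule filterlim_compose[OF poly_mult_exp_tendsto_0])
      show "LIM h at_right (0::real). 1 / h :> at_top"
        using filterlim_inverse_at_top_right unfolding inverse_eq_divide[abs_def] .
    qed
    moreover have "\<forall>\<^sub>F h in at_right 0. poly ([:0, 1:] * p) (1 / h) * exp (- (1 / h)) = flat p h / h"
      by (auto simp: eventually_at_filter flat_def)
    ultimately have r: "((\<lambda>h. flat p h / h) \<longlongrightarrow> 0) (at_right 0)"
      by (rule Lim_transform_eventually)
    have "((\<lambda>h. flat p h / h) \<longlongrightarrow> 0) (at_left 0)"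
      by (rule Lim_transform_eventually[OF tendsto_const]) (auto simp: eventually_at_filter flat_def)
    with r have "((\<lambda>h. flat p h / h) \<longlongrightarrow> 0) (at 0)"
      by (simp add: filterlim_at_split)
    then show ?thesis using 3 by (simp add: DERIV_def flat_def)
  qed
qed

text \<open>
  A class of functions that is closed under partial derivatives and consists of differentiable
  functions contains only smooth functions.
\<close>

inductive_set bump_algebra :: "(real^'d::finite \<Rightarrow> real) set" where
  flat: "(\<lambda>x. flat p (s * x $ i + c)) \<in> bump_algebra"
| const: "(\<lambda>x. c) \<in> bump_algebra"
| add: "f \<in> bump_algebra \<Longrightarrow> g \<in> bump_algebra \<Longrightarrow> (\<lambda>x. f x + g x) \<in> bump_algebra"
| mult: "f \<in> bump_algebra \<Longrightarrow> g \<in> bump_algebra \<Longrightarrow> (\<lambda>x. f x * g x) \<in> bump_algebra"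

lemma bump_algebra_closed:
  fixes f :: "real^'d::finite \<Rightarrow> real"
  assumes "f \<in> bump_algebra"
  shows "(\<forall>x. f differentiable at x) \<and> pderiv_at j f \<in> bump_algebra"
  using assms
proof induction
  case (flat p s i c)
  let ?q = "[:0, 0, 1:] * (p - pderiv p)"
  have d: "((\<lambda>x. flat p (s * x $ i + c)) has_derivative (\<lambda>v. v $ i * s * flat ?q (s * x $ i + c))) (at x)" for x :: "real^'d"
    by (rule has_derivative_eq_rhs, rule has_derivative_compose[OF _ flat_has_derivative[unfolded has_field_derivative_def]])
      (auto intro!: derivative_eq_intros bounded_linear.has_derivative[OF bounded_linear_vec_nth] simp: mult_ac)
  have "pderiv_at j (\<lambda>x. flat p (s * x $ i + c)) = (\<lambda>x. axis j 1 $ i * s * flat ?q (s * x $ i + c))"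
    using pderiv_at_eq[OF d] by (intro ext)
  also have "\<dots> \<in> bump_algebra"
    by (intro bump_algebra.mult bump_algebra.const bump_algebra.flat)
  finally show ?case using d by (auto simp: differentiable_def)
next
  case (const c)
  have "pderiv_at j (\<lambda>x. c :: real) = (\<lambda>x. 0)" by (rule ext) (rule pderiv_at_const)
  then show ?case by (simp add: bump_algebra.const)
next
  case (add f g)
  then have "pderiv_at j (\<lambda>x. f x + g x) = (\<lambda>x. pderiv_at j f x + pderiv_at j g x)"
    by (intro ext pderiv_at_add) auto
  then show ?case using add by (auto intro: bump_algebra.add)
next
  case (mult f g)
  then have "pderiv_at j (\<lambda>x. f x * g x) = (\<lambda>x. f x * pderiv_at j g x + pderiv_at j f x * g x)"
    by (intro ext pderiv_at_mult) auto
  then show ?case using mult by (auto intro!: bump_algebra.add bump_algebra.mult)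
qed

lemma bump_algebra_smooth:
  assumes "f \<in> bump_algebra"
  shows "smooth f"
proof -
  have "foldr pderiv_at idx f \<in> bump_algebra" for idx
    by (induction idx) (use assms bump_algebra_closed in auto)
  then show ?thesis using bump_algebra_closed unfolding smooth_def by blast
qed

lemma bump_algebra_prod:
  assumes "finite I" "\<And>i. i \<in> I \<Longrightarrow> f i \<in> bump_algebra"
  shows "(\<lambda>x. \<Prod>i\<in>I. f i x) \<in> bump_algebra"
  using assms by (induction I) (auto intro: bump_algebra.intros)

text \<open>
  A smooth function supported in the box from \<open>a\<close> to \<open>b\<close>.  Since \<open>e\<^sup>-\<^sup>1\<^sup>/\<^sup>t\<close> tends to \<open>1\<close> as \<open>t\<close> tends
  to infinity, scaling the argument by \<open>n + 1\<close> yields convergence to the indicator of the open box.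
\<close>

definition box_bump :: "nat \<Rightarrow> real^'d::finite \<Rightarrow> real^'d \<Rightarrow> real^'d \<Rightarrow> real" where
  "box_bump n a b x = (\<Prod>i\<in>UNIV. flat 1 (real (Suc n) * (x $ i - a $ i)) * flat 1 (real (Suc n) * (b $ i - x $ i)))"

lemma flat_1: "flat 1 t = (if t \<le> 0 then 0 else exp (- (1 / t)))"
  by (simp add: flat_def)

lemma flat_1_bounds: "0 \<le> flat 1 t" "flat 1 t \<le> 1"
  by (auto simp: flat_1)

lemma box_bump_smooth: "smooth (box_bump n a b)"
proof (rule bump_algebra_smooth)
  have "(\<lambda>x. flat 1 (real (Suc n) * (x $ i - a $ i))) \<in> bump_algebra"
    "(\<lambda>x. flat 1 (real (Suc n) * (b $ i - x $ i))) \<in> bump_algebra" for i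
    using bump_algebra.flat[of 1 "real (Suc n)" i "- (real (Suc n) * a $ i)"]
      bump_algebra.flat[of 1 "- real (Suc n)" i "real (Suc n) * b $ i"]
    by (simp_all add: algebra_simps)
  then show "box_bump n a b \<in> bump_algebra"
    unfolding box_bump_def[abs_def] by (intro bump_algebra_prod bump_algebra.mult) auto
qed

lemma box_bump_bounds: "0 \<le> box_bump n a b x" "box_bump n a b x \<le> 1"
  unfolding box_bump_def by (auto intro!: prod_nonneg prod_le_1 mult_nonneg_nonneg mult_le_one flat_1_bounds)

lemma box_bump_outside: 
  assumes "x \<notin> box a b"
  shows "box_bump n a b x = 0"
proof -
  obtain i where "x $ i \<le> a $ i \<or> b $ i \<le> x $ i"
    using assms by (auto simp: mem_box_cart not_less)
  then have "flat 1 (real (Suc n) * (x $ i - a $ i)) * flat 1 (real (Suc n) * (b $ i - x $ i)) = 0"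
    by (auto simp: flat_1 mult_le_0_iff)
  then show ?thesis unfolding box_bump_def by (intro prod_zero) auto
qed

lemma flat_1_tendsto:
  assumes "0 < t"
  shows "(\<lambda>n. flat 1 (real (Suc n) * t)) \<longlonglongrightarrow> 1"
proof -
  have "(\<lambda>n. exp (- (1 / t * inverse (real (Suc n))))) \<longlonglongrightarrow> exp (- (1 / t * 0))"
    by (intro tendsto_intros LIMSEQ_inverse_real_of_nat)
  moreover have "flat 1 (real (Suc n) * t) = exp (- (1 / t * inverse (real (Suc n))))" for n
    using assms by (auto simp: flat_1 field_simps mult_le_0_iff simp del: of_nat_Suc)
  ultimately show ?thesis by simp
qed

lemma box_bump_tendsto: "(\<lambda>n. box_bump n a b x) \<longlonglongrightarrow> indicator (box a b) x"
proof (cases "x \<in> box a b")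
  case True
  have "(\<lambda>n. box_bump n a b x) \<longlonglongrightarrow> (\<Prod>i\<in>(UNIV :: 'a set). 1 * 1)"
    unfolding box_bump_def using True
    by (intro tendsto_prod tendsto_mult flat_1_tendsto) (auto simp: mem_box_cart)
  then show ?thesis using True by simp
qed (simp add: box_bump_outside)

lemma box_bump_test_function:
  assumes "cbox a b \<subseteq> \<Omega>"
  shows "box_bump n a b \<in> test_functions \<Omega>"
proof -
  have "{x. box_bump n a b x \<noteq> 0} \<subseteq> cbox a b"
    using box_bump_outside box_subset_cbox by blast
  have "closure {x. box_bump n a b x \<noteq> 0} \<subseteq> cbox a b"
    by (rule closure_minimal) (fact, rule closed_cbox)
  then show ?thesis
    using assms box_bump_smooth bounded_subset[OF bounded_cbox \<open>{x. box_bump n a b x \<noteq> 0} \<subseteq> cbox a b\<close>]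
    by (auto simp: test_functions_def)
qed

section \<open>Integration by parts\<close>

lemma pderiv_at_direction:
  assumes "f differentiable at (x + t *\<^sub>R axis i 1)"
  shows "((\<lambda>t. f (x + t *\<^sub>R axis i 1)) has_real_derivative pderiv_at i f (x + t *\<^sub>R axis i 1)) (at t)"
proof -
  have d: "(f has_derivative frechet_derivative f (at (x + t *\<^sub>R axis i 1))) (at (x + t *\<^sub>R axis i 1))"
    using assms by (simp add: frechet_derivative_works)
  have "((\<lambda>t. x + t *\<^sub>R axis i 1) has_derivative (\<lambda>h. h *\<^sub>R axis i 1)) (at t)"
    by (auto intro!: derivative_eq_intros)
  from has_derivative_compose[OF this d]
  have "((\<lambda>t. f (x + t *\<^sub>R axis i 1)) has_derivative
    (\<lambda>h. frechet_derivative f (at (x + t *\<^sub>R axis i 1)) (h *\<^sub>R axis i 1))) (at t)" .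
  moreover have "frechet_derivative f (at (x + t *\<^sub>R axis i 1)) (h *\<^sub>R axis i 1)
      = pderiv_at i f (x + t *\<^sub>R axis i 1) * h" for h
    using linear_frechet_derivative[OF assms] by (simp add: pderiv_at_def linear_cmul mult.commute)
  ultimately show ?thesis by (simp add: has_field_derivative_def)
qed

lemma pderiv_at_outside:
  assumes "closed K" "\<And>y. y \<notin> K \<Longrightarrow> f y = 0" "x \<notin> K"
  shows "pderiv_at i f x = 0"
proof -
  have "((\<lambda>_. 0) has_derivative (\<lambda>_. 0)) (at x)" by simp
  then have "(f has_derivative (\<lambda>_. 0)) (at x)"
    by (rule has_derivative_transform_within_open[where s = "- K"]) (use assms in auto)
  then show ?thesis by (simp add: pderiv_at_eq)
qed

lemma integrable_continuous_bounded_support: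
  fixes f :: "real^'d::finite \<Rightarrow> real"
  assumes "continuous_on UNIV f" "compact K" "\<And>x. x \<notin> K \<Longrightarrow> f x = 0"
  shows "integrable lborel f"
proof -
  have "set_integrable lborel K f"
    unfolding set_integrable_def
    using assms by (intro borel_integrable_compact) (auto intro: continuous_on_subset)
  moreover have "(\<lambda>x. indicator K x *\<^sub>R f x) = f" using assms(3) by (intro ext) (auto simp: indicator_def)
  ultimately show ?thesis by (simp add: set_integrable_def)
qed

text \<open>
  Difference quotients of \<open>f\<close> have integral \<open>0\<close> by translation invariance, and they converge
  dominatedly to the partial derivative; the mean value theorem bounds them by the supremum of that derivative.
\<close>

lemma integral_pderiv_zero:
  fixes f :: "real^'d::finite \<Rightarrow> real"
  assumes diff: "\<And>x. f differentiable at x" and cont: "continuous_on UNIV (pderiv_at i f)"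
    and K: "compact K" "\<And>x. x \<notin> K \<Longrightarrow> f x = 0"
  shows "(LINT x|lborel. pderiv_at i f x) = 0"
proof -
  let ?e = "axis i 1 :: real^'d"
  define t where "t n = inverse (real (Suc n))" for n
  have t: "0 < t n" "t n \<le> 1" for n by (auto simp: t_def inverse_le_1_iff)
  define q where "q n x = (f (x + t n *\<^sub>R ?e) - f x) / t n" for n x
  have f_cont: "continuous_on UNIV f"
    using diff by (auto intro!: continuous_at_imp_continuous_on differentiable_imp_continuous_within)
  have f_int: "integrable lborel f" using integrable_continuous_bounded_support[OF f_cont K] .
  obtain R where R: "\<And>x. x \<in> K \<Longrightarrow> norm x \<le> R"
    using compact_imp_bounded[OF K(1)] unfolding bounded_iff by blast
  have supp: "pderiv_at i f x = 0" if "x \<notin> K" for x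
    using pderiv_at_outside[OF compact_imp_closed[OF K(1)] K(2) that] .
  have "bounded (pderiv_at i f ` K)"
    using K(1) cont by (intro compact_imp_bounded compact_continuous_image) (auto intro: continuous_on_subset)
  then obtain B where "\<And>x. x \<in> K \<Longrightarrow> \<bar>pderiv_at i f x\<bar> \<le> B" unfolding bounded_iff by force
  then have B: "\<bar>pderiv_at i f x\<bar> \<le> max 0 B" for x
    using supp[of x] by (cases "x \<in> K") (auto simp: le_max_iff_disj)
  have q_bound: "norm (q n x) \<le> max 0 B * indicator (cball 0 (R + 1)) x" for n x
  proof (cases "x \<in> cball 0 (R + 1)")
    case True
    have "norm (f (x + t n *\<^sub>R ?e) - f (x + 0 *\<^sub>R ?e)) \<le> max 0 B * norm (t n - 0)"
    proof (rule field_differentiable_bound[where S = UNIV and f = "\<lambda>s. f (x + s *\<^sub>R ?e)"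
          and f' = "\<lambda>s. pderiv_at i f (x + s *\<^sub>R ?e)"])
      show "((\<lambda>s. f (x + s *\<^sub>R ?e)) has_field_derivative pderiv_at i f (x + s *\<^sub>R ?e)) (at s within UNIV)" for s
        using pderiv_at_direction[OF diff] by simp
    qed (use B in auto)
    then show ?thesis using True t[of n] by (simp add: q_def field_simps)
  next
    case False
    then have x: "R + 1 < norm x" by simp
    then have "x \<notin> K" using R[of x] by auto
    moreover have "x + t n *\<^sub>R ?e \<notin> K"
    proof
      assume "x + t n *\<^sub>R ?e \<in> K"
      then have "norm (x + t n *\<^sub>R ?e) \<le> R" by (rule R)
      moreover have "norm (t n *\<^sub>R ?e) \<le> 1" using t[of n] by simp
      ultimately show False using x norm_triangle_ineq2[of "x + t n *\<^sub>R ?e" "t n *\<^sub>R ?e"] norm_diff_ineq[of x "t n *\<^sub>R ?e"] by linarith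
    qed
    ultimately show ?thesis using K(2) by (simp add: q_def)
  qed
  have q_lim: "(\<lambda>n. q n x) \<longlonglongrightarrow> pderiv_at i f x" for x
  proof -
    have "((\<lambda>h. (f (x + h *\<^sub>R ?e) - f x) / h) \<longlongrightarrow> pderiv_at i f x) (at 0)"
      using pderiv_at_direction[of f x 0 i] diff by (simp add: DERIV_def)
    moreover have "filterlim t (at 0) sequentially"
      unfolding filterlim_at t_def using LIMSEQ_inverse_real_of_nat by auto
    ultimately show ?thesis unfolding q_def by (rule filterlim_compose)
  qed
  have shift: "integrable lborel (\<lambda>x. f (x + v))" "(LINT x|lborel. f (x + v)) = (LINT x|lborel. f x)" for v
  proof -
    have f_meas: "f \<in> borel_measurable borel" using f_int by (simp add: borel_measurable_integrable)
    have eq: "(\<lambda>x. f (x + v)) = (\<lambda>x. f (v + x))" by (simp add: add.commute)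
    show "(LINT x|lborel. f (x + v)) = (LINT x|lborel. f x)"
      unfolding eq by (subst (2) lborel_distr_plus[symmetric, of v], subst integral_distr) (use f_meas in auto)
    show "integrable lborel (\<lambda>x. f (x + v))"
      unfolding eq using f_int by (subst (asm) lborel_distr_plus[symmetric, of v], subst (asm) integrable_distr_eq) (use f_meas in auto)
  qed
  have "(\<lambda>n. LINT x|lborel. q n x) \<longlonglongrightarrow> (LINT x|lborel. pderiv_at i f x)"
  proof (rule integral_dominated_convergence)
    show "integrable lborel (\<lambda>x. max 0 B * indicator (cball 0 (R + 1)) x)"
      by (intro integrable_mult_right integrable_real_indicator) (simp_all add: emeasure_lborel_cball_finite[simplified])
    show "pderiv_at i f \<in> borel_measurable lborel"
      using cont by (simp add: borel_measurable_continuous_onI)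
    show "q n \<in> borel_measurable lborel" for n
      unfolding q_def[abs_def] using shift f_int by (intro borel_measurable_integrable) auto
  qed (use q_lim q_bound in auto)
  moreover have "(LINT x|lborel. q n x) = 0" for n
    unfolding q_def using shift f_int by simp
  ultimately show ?thesis by (simp add: LIMSEQ_const_iff)
qed

section \<open>Square-integrable functions\<close>

lemma integrable_L2_inner:
  assumes "f \<in> L2 M" "g \<in> L2 M"
  shows "integrable M (\<lambda>x. f x \<bullet> g x)"
proof (rule Bochner_Integration.integrable_bound)
  show "integrable M (\<lambda>x. (norm (f x))\<^sup>2 + (norm (g x))\<^sup>2)"
    using assms by (auto simp: L2_def)
  show "(\<lambda>x. f x \<bullet> g x) \<in> borel_measurable M" using assms by (auto simp: L2_def)
  have "norm (f x \<bullet> g x) \<le> (norm (f x))\<^sup>2 + (norm (g x))\<^sup>2" for x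
  proof -
    have "norm (f x \<bullet> g x) \<le> norm (f x) * norm (g x)" using Cauchy_Schwarz_ineq2 by simp
    also have "\<dots> \<le> (norm (f x))\<^sup>2 + (norm (g x))\<^sup>2"
      using sum_squares_bound[of "norm (f x)" "norm (g x)"] mult_nonneg_nonneg[OF norm_ge_zero[of "f x"] norm_ge_zero[of "g x"]]
      by linarith
    finally show ?thesis .
  qed
  then show "AE x in M. norm (f x \<bullet> g x) \<le> norm ((norm (f x))\<^sup>2 + (norm (g x))\<^sup>2)"
    by (intro AE_I2) (auto intro: order_trans)
qed

lemma integrable_L2_mult: "f \<in> L2 M \<Longrightarrow> g \<in> L2 M \<Longrightarrow> integrable M (\<lambda>x. f x * g x :: real)"
  using integrable_L2_inner[of f M g] by (simp add: mult.commute)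

lemma L2_add:
  assumes "f \<in> L2 M" "g \<in> L2 M"
  shows "(\<lambda>x. f x + g x) \<in> L2 M"
proof -
  have "integrable M (\<lambda>x. (norm (f x))\<^sup>2 + 2 * (f x \<bullet> g x) + (norm (g x))\<^sup>2)"
    using assms integrable_L2_inner[OF assms] by (auto simp: L2_def)
  moreover have "(\<lambda>x. f x + g x) \<in> borel_measurable M"
    using assms by (intro borel_measurable_add) (auto simp: L2_def)
  ultimately show ?thesis
    by (simp add: L2_def power2_norm_eq_inner inner_add inner_commute algebra_simps)
qed

lemma L2_scaleR: "f \<in> L2 M \<Longrightarrow> (\<lambda>x. a *\<^sub>R f x) \<in> L2 M"
  by (auto simp: L2_def power_mult_distrib)

lemma L2_diff: "f \<in> L2 M \<Longrightarrow> g \<in> L2 M \<Longrightarrow> (\<lambda>x. f x - g x) \<in> L2 M"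
  using L2_add[of f M "\<lambda>x. (-1) *\<^sub>R g x"] L2_scaleR[of g M "-1"] by simp

lemma L2_component:
  fixes g :: "'a \<Rightarrow> real^'n"
  assumes "g \<in> L2 M"
  shows "(\<lambda>x. g x $ i) \<in> L2 M"
proof -
  have c: "(\<lambda>v :: real^'n. v $ i) \<in> borel_measurable borel"
    by (intro borel_measurable_continuous_onI continuous_intros)
  have "g \<in> borel_measurable M" using assms by (simp add: L2_def)
  then have meas: "(\<lambda>x. g x $ i) \<in> borel_measurable M"
    by (rule measurable_compose[OF _ c])
  have "integrable M (\<lambda>x. (g x $ i)\<^sup>2)"
  proof (rule Bochner_Integration.integrable_bound)
    show "integrable M (\<lambda>x. (norm (g x))\<^sup>2)" using assms by (simp add: L2_def)
    show "AE x in M. norm ((g x $ i)\<^sup>2) \<le> norm ((norm (g x))\<^sup>2)"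
      by (intro AE_I2) (simp add: component_le_norm_cart abs_le_square_iff[symmetric])
  qed (use meas in measurable)
  with meas show ?thesis by (simp add: L2_def)
qed

lemma (in finite_measure) L2_ess_bounded:
  assumes "ess_bounded M f"
  shows "f \<in> L2 M"
proof -
  have "ess_bounded M (\<lambda>x. f x \<bullet> f x)" by (intro ess_bounded_inner assms)
  then show ?thesis
    using assms integrable_ess_bounded[OF \<open>ess_bounded M (\<lambda>x. f x \<bullet> f x)\<close>]
    by (auto simp: L2_def power2_norm_eq_inner ess_bounded_def)
qed

lemma (in finite_measure) L2_integrable:
  fixes f :: "'a \<Rightarrow> real"
  assumes "f \<in> L2 M"
  shows "integrable M f"
  using integrable_L2_mult[OF assms L2_ess_bounded[OF ess_bounded_const[of M 1]]] by simp

lemma L2_norm_sq: "(L2_norm M f)\<^sup>2 = (LINT x|M. (norm (f x))\<^sup>2)"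
  by (simp add: L2_norm_def)

section \<open>Weak gradients\<close>

locale bounded_domain =
  fixes \<Omega> :: "(real^'d::finite) set"
  assumes open_domain: "open \<Omega>" and bounded_domain: "bounded \<Omega>"
begin

lemma sets_domain [measurable, simp]: "\<Omega> \<in> sets borel" "\<Omega> \<in> sets lebesgue"
  using open_domain by auto

sublocale finite_measure "lebesgue_on \<Omega>"
  using bounded_domain by (intro finite_measure_lebesgue_on bounded_set_imp_lmeasurable) auto

abbreviation "M \<equiv> lebesgue_on \<Omega>"

lemma complete_domain: "complete_measure M"
proof
  fix A B assume "B \<subseteq> A" "A \<in> null_sets M"
  then have A: "A \<subseteq> \<Omega>" "A \<in> null_sets lebesgue" "B \<subseteq> A"
    by (auto simp: null_sets_restrict_space)
  then have "B \<in> sets lebesgue"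
    using completion.complete by blast
  then show "B \<in> sets M" using A by (subst sets_restrict_space_iff) auto
qed

lemma domain_nontrivial: "\<Omega> \<noteq> {} \<Longrightarrow> emeasure M (space M) \<noteq> 0"
  using open_not_negligible[OF open_domain]
  by (auto simp: emeasure_restrict_space negligible_iff_null_sets null_sets_def)

lemma test_functionE:
  assumes "f \<in> test_functions \<Omega>"
  obtains K where "compact K" "K \<subseteq> \<Omega>" "\<And>x. x \<notin> K \<Longrightarrow> f x = 0"
  using assms closure_subset[of "{x. f x \<noteq> 0}"] unfolding test_functions_def by blast

lemma test_function_differentiable:
  assumes "f \<in> test_functions \<Omega>"
  shows "f differentiable at x" "continuous_on UNIV f" "continuous_on UNIV (pderiv_at i f)"
proof -
  have s: "foldr pderiv_at idx f differentiable at x" for idx x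
    using assms by (simp add: test_functions_def smooth_def)
  show d: "f differentiable at x" for x using s[of "[]"] by simp
  show "continuous_on UNIV f"
    using d by (auto intro!: continuous_at_imp_continuous_on differentiable_imp_continuous_within)
  have "pderiv_at i f differentiable at x" for x using s[of "[i]"] by simp
  then show "continuous_on UNIV (pderiv_at i f)"
    by (auto intro!: continuous_at_imp_continuous_on differentiable_imp_continuous_within)
qed

lemma integral_lborel_eq:
  assumes "continuous_on UNIV f" "\<And>x. x \<notin> \<Omega> \<Longrightarrow> f x = (0::real)"
  shows "(LINT x|M. f x) = (LINT x|lborel. f x)"
proof -
  have "(LINT x|M. f x) = (LINT x|lebesgue. indicator \<Omega> x *\<^sub>R f x)"
    by (rule integral_restrict_space) simp
  also have "(\<lambda>x. indicator \<Omega> x *\<^sub>R f x) = f" using assms(2) by (intro ext) (auto simp: indicator_def)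
  also have "(LINT x|lebesgue. f x) = (LINT x|lborel. f x)"
    by (rule integral_completion) (use assms(1) in \<open>simp add: borel_measurable_continuous_onI\<close>)
  finally show ?thesis .
qed

lemma ess_bounded_continuous:
  fixes f :: "real^'d \<Rightarrow> real"
  assumes "continuous_on UNIV f"
  shows "ess_bounded M f"
proof -
  have "compact (closure \<Omega>)" using bounded_domain by simp
  then have "bounded (f ` closure \<Omega>)"
    using assms by (intro compact_imp_bounded compact_continuous_image) (auto intro: continuous_on_subset)
  then obtain B where B: "\<forall>y\<in>f ` closure \<Omega>. norm y \<le> B" using bounded_iff by blast
  have "AE x in M. norm (f x) \<le> B"
    using B closure_subset[of \<Omega>] by (intro AE_I2) (auto simp: space_restrict_space)
  moreover have "f \<in> borel_measurable M"
    using assms by (intro measurable_restrict_space1 measurable_completion) (simp add: borel_measurable_continuous_onI)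
  ultimately show ?thesis by (rule ess_boundedI[rotated])
qed

lemma L2_continuous:
  fixes f :: "real^'d \<Rightarrow> real"
  shows "continuous_on UNIV f \<Longrightarrow> f \<in> L2 M"
  by (rule L2_ess_bounded[OF ess_bounded_continuous])

lemma L2_test_function:
  assumes "f \<in> test_functions \<Omega>"
  shows "f \<in> L2 M" "pderiv_at i f \<in> L2 M"
  using test_function_differentiable[OF assms] by (auto intro: L2_continuous)

lemma integration_by_parts:
  assumes f: "f \<in> test_functions \<Omega>"
    and h: "\<And>x. h differentiable at x" "continuous_on UNIV (pderiv_at i h)"
  shows "(LINT x|M. h x * pderiv_at i f x) = - (LINT x|M. pderiv_at i h x * f x)"
proof -
  obtain K where K: "compact K" "K \<subseteq> \<Omega>" "\<And>x. x \<notin> K \<Longrightarrow> f x = 0" by (rule test_functionE[OF f]) blast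
  note fd = test_function_differentiable[OF f]
  have hc: "continuous_on UNIV h"
    using h(1) by (auto intro!: continuous_at_imp_continuous_on differentiable_imp_continuous_within)
  have eq: "pderiv_at i (\<lambda>x. h x * f x) = (\<lambda>x. h x * pderiv_at i f x + pderiv_at i h x * f x)"
    by (intro ext pderiv_at_mult h fd)
  have cont: "continuous_on UNIV (pderiv_at i (\<lambda>x. h x * f x))"
    unfolding eq by (intro continuous_intros hc h fd)
  have "(LINT x|lborel. pderiv_at i (\<lambda>x. h x * f x) x) = 0"
    by (rule integral_pderiv_zero[OF _ cont K(1)]) (use K fd h in \<open>auto intro: differentiable_mult\<close>)
  moreover have "pderiv_at i (\<lambda>x. h x * f x) x = 0" if "x \<notin> \<Omega>" for x
    by (rule pderiv_at_outside[OF compact_imp_closed[OF K(1)]]) (use K that in auto)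
  ultimately have "(LINT x|M. pderiv_at i (\<lambda>x. h x * f x) x) = 0"
    using integral_lborel_eq[OF cont] by simp
  moreover have "integrable M (\<lambda>x. h x * pderiv_at i f x)" "integrable M (\<lambda>x. pderiv_at i h x * f x)"
    by (intro integrable_ess_bounded ess_bounded_continuous continuous_intros hc h fd)+
  ultimately show ?thesis unfolding eq by simp
qed

text \<open>
  The fundamental lemma of the calculus of variations.  Cut-off functions converge to indicators of
  boxes, so \<open>g\<close> integrates to \<open>0\<close> over small cubes, and by Lebesgue differentiation \<open>g\<close> is almost
  everywhere the limit of its means over such cubes.
\<close>

lemma fundamental_lemma:
  assumes g: "g \<in> L2 M" and zero: "\<And>f. f \<in> test_functions \<Omega> \<Longrightarrow> (LINT x|M. g x * f x) = (0::real)"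
  shows "AE x in M. g x = 0"
proof -
  define G where "G x = indicator \<Omega> x *\<^sub>R g x" for x
  have gi: "integrable M g" using g by (rule L2_integrable)
  then have G: "integrable lebesgue G" unfolding G_def[abs_def] by (subst (asm) integrable_restrict_space) auto
  have box: "integral (cbox a b) G = 0" if sub: "cbox a b \<subseteq> \<Omega>" for a b
  proof -
    have "(\<lambda>n. LINT x|M. g x * box_bump n a b x) \<longlonglongrightarrow> (LINT x|M. g x * indicator (box a b) x)"
    proof (rule integral_dominated_convergence[where w = "\<lambda>x. norm (g x)"])
      show "AE x in M. (\<lambda>n. g x * box_bump n a b x) \<longlonglongrightarrow> g x * indicator (box a b) x"
        by (intro AE_I2 tendsto_intros box_bump_tendsto)
      show "AE x in M. norm (g x * box_bump n a b x) \<le> norm (g x)" for n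
        using box_bump_bounds[of n a b] by (intro AE_I2) (simp add: abs_mult mult_left_le)
      show "(\<lambda>x. g x * box_bump n a b x) \<in> borel_measurable M" for n
        using integrable_L2_mult[OF g L2_test_function(1)[OF box_bump_test_function[OF sub]]]
        by (rule borel_measurable_integrable)
      have "indicator (box a b) \<in> borel_measurable M"
        by (intro measurable_restrict_space1 measurable_completion) simp
      then show "(\<lambda>x. g x * indicator (box a b) x) \<in> borel_measurable M"
        using gi by (intro borel_measurable_times) auto
    qed (use gi in simp)
    then have "(LINT x|M. g x * indicator (box a b) x) = 0"
      using zero[OF box_bump_test_function[OF sub]] by (simp add: LIMSEQ_const_iff)
    then have "(LINT x|lebesgue. indicator \<Omega> x *\<^sub>R (g x * indicator (box a b) x)) = 0"
      by (subst (asm) integral_restrict_space) auto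
    moreover have "(\<lambda>x. indicator \<Omega> x *\<^sub>R (g x * indicator (box a b) x)) = (\<lambda>x. indicator (box a b) x *\<^sub>R G x)"
      by (auto simp: G_def)
    ultimately have "(LINT x:box a b|lebesgue. G x) = 0" by (simp add: set_lebesgue_integral_def)
    moreover have "set_integrable lebesgue (box a b) G"
      unfolding set_integrable_def using G by (intro integrable_mult_indicator) auto
    ultimately have "integral (box a b) G = 0" by (simp add: set_lebesgue_integral_eq_integral)
    then show ?thesis by (simp add: integral_open_interval)
  qed
  have "G integrable_on cbox a b" for a b
    using integrable_on_lebesgue[OF G] integrable_on_subcbox by blast
  then obtain N where N: "negligible N" and lim: "\<And>x e. x \<notin> N \<Longrightarrow> 0 < e \<Longrightarrow>
      \<exists>d>0. \<forall>h. 0 < h \<and> h < d \<longrightarrow> norm (integral (cbox x (x + h *\<^sub>R One)) G /\<^sub>R h ^ DIM(real^'d) - G x) < e"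
    by (rule integrable_ccontinuous_explicit) blast
  have zero_at: "g x = 0" if x: "x \<in> \<Omega>" "x \<notin> N" for x
  proof (rule ccontr)
    assume "g x \<noteq> 0"
    then obtain d where d: "d > 0" "\<And>h. 0 < h \<Longrightarrow> h < d \<Longrightarrow>
        norm (integral (cbox x (x + h *\<^sub>R One)) G /\<^sub>R h ^ DIM(real^'d) - G x) < norm (g x)"
      using lim[OF x(2), of "norm (g x)"] by auto
    obtain r where r: "r > 0" "ball x r \<subseteq> \<Omega>" using open_domain x(1) openE by blast
    \<comment> \<open>Points of a cube of side \<open>h\<close> are at distance at most \<open>DIM \<cdot> h\<close> from its corner.\<close>
    define h where "h = min (d / 2) (r / (2 * real DIM(real^'d)))"
    have h: "0 < h" "h < d" "real DIM(real^'d) * h < r"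
    proof -
      show "0 < h" using d r by (simp add: h_def)
      show "h < d" using d by (simp add: h_def min_less_iff_disj)
      have "real DIM(real^'d) * h \<le> real DIM(real^'d) * (r / (2 * real DIM(real^'d)))"
        by (intro mult_left_mono) (auto simp: h_def)
      also have "\<dots> < r" using r by simp
      finally show "real DIM(real^'d) * h < r" .
    qed
    have "cbox x (x + h *\<^sub>R One) \<subseteq> \<Omega>"
    proof
      fix y assume y: "y \<in> cbox x (x + h *\<^sub>R One)"
      have "norm (y - x) \<le> (\<Sum>b\<in>Basis. \<bar>(y - x) \<bullet> b\<bar>)" by (rule norm_le_l1)
      also have "\<dots> \<le> (\<Sum>b\<in>(Basis :: (real^'d) set). h)"
      proof (rule sum_mono)
        fix b :: "real^'d" assume b: "b \<in> Basis"
        then have "x \<bullet> b \<le> y \<bullet> b" "y \<bullet> b \<le> (x + h *\<^sub>R One) \<bullet> b" using y by (auto simp: mem_box)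
        then show "\<bar>(y - x) \<bullet> b\<bar> \<le> h" using b h by (simp add: inner_diff_left inner_add_left)
      qed
      also have "\<dots> < r" using h(3) by simp
      finally show "y \<in> \<Omega>" using r(2) by (auto simp: dist_norm norm_minus_commute)
    qed
    then have "norm (G x) < norm (g x)" using d(2)[OF h(1,2)] box by simp
    then show False using x(1) by (simp add: G_def)
  qed
  have "N \<in> null_sets lebesgue" using N by (simp add: negligible_iff_null_sets)
  then have "AE x in lebesgue. x \<in> \<Omega> \<longrightarrow> g x = 0"
    by (rule AE_I') (use zero_at in auto)
  then show ?thesis by (subst AE_restrict_space_iff) auto
qed

lemma weak_grad_unique:
  assumes "is_weak_grad \<Omega> u g" "is_weak_grad \<Omega> u g'"
  shows "AE x in M. g x = g' x"
proof -
  have L2: "g \<in> L2 M" "g' \<in> L2 M" using assms by (auto simp: is_weak_grad_def)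
  have "AE x in M. g x $ i - g' x $ i = 0" for i
  proof (rule fundamental_lemma)
    show "(\<lambda>x. g x $ i - g' x $ i) \<in> L2 M" by (intro L2_diff L2_component L2)
    fix f assume f: "f \<in> test_functions \<Omega>"
    have "(LINT x|M. g x $ i * f x) = (LINT x|M. g' x $ i * f x)"
    proof -
      have "(LINT x|M. u x * pderiv_at i f x) = - (LINT x|M. g x $ i * f x)"
        "(LINT x|M. u x * pderiv_at i f x) = - (LINT x|M. g' x $ i * f x)"
        using assms f unfolding is_weak_grad_def by blast+
      then show ?thesis by linarith
    qed
    then show "(LINT x|M. (g x $ i - g' x $ i) * f x) = 0"
      using integrable_L2_mult[OF L2_component[OF L2(1), of i] L2_test_function(1)[OF f]]
        integrable_L2_mult[OF L2_component[OF L2(2), of i] L2_test_function(1)[OF f]]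
      by (simp add: left_diff_distrib)
  qed
  then have "AE x in M. \<forall>i\<in>UNIV. g x $ i - g' x $ i = 0" by (intro AE_finite_allI) auto
  then show ?thesis by eventually_elim (simp add: vec_eq_iff)
qed

lemma H1_weak_grad:
  assumes "u \<in> H1 \<Omega>"
  shows "is_weak_grad \<Omega> u (grad \<Omega> u)"
proof -
  have "\<exists>g. is_weak_grad \<Omega> u g" using assms by (simp add: H1_def)
  then show ?thesis unfolding grad_def by (rule someI_ex)
qed

lemma H1_L2: "u \<in> H1 \<Omega> \<Longrightarrow> u \<in> L2 M" "u \<in> H1 \<Omega> \<Longrightarrow> grad \<Omega> u \<in> L2 M"
  using H1_weak_grad by (auto simp: H1_def is_weak_grad_def)

lemma weak_gradI:
  assumes "u \<in> L2 M" "is_weak_grad \<Omega> u g"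
  shows "u \<in> H1 \<Omega>" "AE x in M. grad \<Omega> u x = g x"
proof -
  show u: "u \<in> H1 \<Omega>" using assms by (auto simp: H1_def)
  show "AE x in M. grad \<Omega> u x = g x" by (rule weak_grad_unique[OF H1_weak_grad[OF u] assms(2)])
qed

lemma H1_add:
  assumes u: "u \<in> H1 \<Omega>" and v: "v \<in> H1 \<Omega>"
  shows "(\<lambda>x. u x + v x) \<in> H1 \<Omega>" "AE x in M. grad \<Omega> (\<lambda>x. u x + v x) x = grad \<Omega> u x + grad \<Omega> v x"
proof -
  have "is_weak_grad \<Omega> (\<lambda>x. u x + v x) (\<lambda>x. grad \<Omega> u x + grad \<Omega> v x)"
    unfolding is_weak_grad_def
  proof (intro conjI ballI allI)
    show "(\<lambda>x. grad \<Omega> u x + grad \<Omega> v x) \<in> L2 M" by (intro L2_add H1_L2 u v)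
    fix f i assume f: "f \<in> test_functions \<Omega>"
    have w: "(LINT x|M. w x * pderiv_at i f x) = - (LINT x|M. grad \<Omega> w x $ i * f x)"
      "integrable M (\<lambda>x. w x * pderiv_at i f x)" "integrable M (\<lambda>x. grad \<Omega> w x $ i * f x)" if "w \<in> H1 \<Omega>" for w
      using H1_weak_grad[OF that] f H1_L2[OF that] L2_test_function[OF f]
      by (auto simp: is_weak_grad_def intro: integrable_L2_mult L2_component)
    show "(LINT x|M. (u x + v x) * pderiv_at i f x) = - (LINT x|M. (grad \<Omega> u x + grad \<Omega> v x) $ i * f x)"
      using w[OF u] w[OF v] by (simp add: distrib_right)
  qed
  from weak_gradI[OF L2_add[OF H1_L2(1)[OF u] H1_L2(1)[OF v]] this]
  show "(\<lambda>x. u x + v x) \<in> H1 \<Omega>" "AE x in M. grad \<Omega> (\<lambda>x. u x + v x) x = grad \<Omega> u x + grad \<Omega> v x" .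
qed

lemma H1_scale:
  assumes u: "u \<in> H1 \<Omega>"
  shows "(\<lambda>x. a * u x) \<in> H1 \<Omega>" "AE x in M. grad \<Omega> (\<lambda>x. a * u x) x = a *\<^sub>R grad \<Omega> u x"
proof -
  have "is_weak_grad \<Omega> (\<lambda>x. a * u x) (\<lambda>x. a *\<^sub>R grad \<Omega> u x)"
    unfolding is_weak_grad_def
    using H1_weak_grad[OF u] by (auto simp: is_weak_grad_def mult.assoc intro: L2_scaleR)
  from weak_gradI[OF L2_scaleR[OF H1_L2(1)[OF u], of a, unfolded real_scaleR_def] this]
  show "(\<lambda>x. a * u x) \<in> H1 \<Omega>" "AE x in M. grad \<Omega> (\<lambda>x. a * u x) x = a *\<^sub>R grad \<Omega> u x" .
qed

lemma H1_sum:
  fixes n :: nat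
  assumes "\<And>i. i < n \<Longrightarrow> b i \<in> H1 \<Omega>"
  shows "(\<lambda>x. \<Sum>i<n. a i * b i x) \<in> H1 \<Omega> \<and>
    (AE x in M. grad \<Omega> (\<lambda>x. \<Sum>i<n. a i * b i x) x = (\<Sum>i<n. a i *\<^sub>R grad \<Omega> (b i) x))"
  using assms
proof (induction n)
  case 0
  have "is_weak_grad \<Omega> (\<lambda>x. 0) (\<lambda>x. 0)" by (simp add: is_weak_grad_def L2_def)
  then show ?case using weak_gradI[of "\<lambda>x. 0" "\<lambda>x. 0"] by (simp add: L2_def)
next
  case (Suc n)
  then have IH: "(\<lambda>x. \<Sum>i<n. a i * b i x) \<in> H1 \<Omega>"
    "AE x in M. grad \<Omega> (\<lambda>x. \<Sum>i<n. a i * b i x) x = (\<Sum>i<n. a i *\<^sub>R grad \<Omega> (b i) x)" by auto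
  have b: "b n \<in> H1 \<Omega>" using Suc.prems by simp
  have "AE x in M. grad \<Omega> (\<lambda>x. (\<Sum>i<n. a i * b i x) + a n * b n x) x
      = (\<Sum>i<n. a i *\<^sub>R grad \<Omega> (b i) x) + a n *\<^sub>R grad \<Omega> (b n) x"
    using H1_add(2)[OF IH(1) H1_scale(1)[OF b, of "a n"]] IH(2) H1_scale(2)[OF b, of "a n"]
    by eventually_elim simp
  then show ?case using H1_add(1)[OF IH(1) H1_scale(1)[OF b, of "a n"]] by simp
qed

lemma H1_grad_cong:
  assumes u: "u \<in> H1 \<Omega>" and v: "v \<in> H1 \<Omega>" and eq: "AE x in M. u x = v x"
  shows "AE x in M. grad \<Omega> u x = grad \<Omega> v x"
proof (rule weak_grad_unique[OF H1_weak_grad[OF u]])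
  show "is_weak_grad \<Omega> u (grad \<Omega> v)"
    unfolding is_weak_grad_def
  proof (intro conjI ballI allI)
    show "grad \<Omega> v \<in> L2 M" by (intro H1_L2 v)
    fix f i assume f: "f \<in> test_functions \<Omega>"
    have "(LINT x|M. u x * pderiv_at i f x) = (LINT x|M. v x * pderiv_at i f x)"
    proof (rule integral_cong_AE)
      show "AE x in M. u x * pderiv_at i f x = v x * pderiv_at i f x" using eq by eventually_elim simp
    qed (intro borel_measurable_integrable integrable_L2_mult H1_L2 L2_test_function u v f)+
    then show "(LINT x|M. u x * pderiv_at i f x) = - (LINT x|M. grad \<Omega> v x $ i * f x)"
      using H1_weak_grad[OF v] f by (simp add: is_weak_grad_def)
  qed
qed

lemma H1_norm_null:
  assumes u: "u \<in> H1 \<Omega>" "AE x in M. u x = 0"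
  shows "H1_norm \<Omega> u = 0"
proof -
  have zero: "(\<lambda>x. 0) \<in> H1 \<Omega>" "AE x in M. grad \<Omega> (\<lambda>x. 0) x = 0"
    using H1_sum[of 0] by auto
  have "AE x in M. grad \<Omega> u x = 0"
    using H1_grad_cong[OF u(1) zero(1) u(2)] zero(2) by eventually_elim simp
  then have "AE x in M. (norm (grad \<Omega> u x))\<^sup>2 = 0" by eventually_elim simp
  moreover have "AE x in M. (norm (u x))\<^sup>2 = 0" using u(2) by eventually_elim simp
  ultimately show ?thesis
    by (simp add: H1_norm_def L2_norm_sq integral_eq_zero_AE)
qed

lemma H1_test_function:
  assumes f: "f \<in> test_functions \<Omega>"
  shows "f \<in> H1 \<Omega>" "AE x in M. grad \<Omega> f x = (\<chi> i. pderiv_at i f x)"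
proof -
  have c: "continuous_on UNIV (\<lambda>x. \<chi> i. pderiv_at i f x)"
    by (intro continuous_on_vec_lambda test_function_differentiable[OF f])
  have "(\<lambda>x. \<chi> i. pderiv_at i f x) \<in> borel_measurable M"
    using c by (intro measurable_restrict_space1 measurable_completion) (simp add: borel_measurable_continuous_onI)
  moreover have "integrable M (\<lambda>x. (norm (\<chi> i. pderiv_at i f x))\<^sup>2)"
    by (intro integrable_ess_bounded ess_bounded_continuous continuous_on_power continuous_on_norm c)
  ultimately have "(\<lambda>x. \<chi> i. pderiv_at i f x) \<in> L2 M" by (simp add: L2_def)
  then have "is_weak_grad \<Omega> f (\<lambda>x. \<chi> i. pderiv_at i f x)"
    unfolding is_weak_grad_def
    using integration_by_parts[OF _ test_function_differentiable(1)[OF f] test_function_differentiable(3)[OF f]]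
    by simp
  from weak_gradI[OF L2_test_function(1)[OF f] this]
  show "f \<in> H1 \<Omega>" "AE x in M. grad \<Omega> f x = (\<chi> i. pderiv_at i f x)" .
qed

section \<open>The Poincare inequality in one direction\<close>

text \<open>
  Integrating \<open>\<partial>\<^sub>i (x\<^sub>i f) = f + x\<^sub>i \<partial>\<^sub>i f\<close> against \<open>f\<close> gives \<open>\<integral> f\<^sup>2 = -2 \<integral> x\<^sub>i f \<partial>\<^sub>i f\<close>, and the weight \<open>x\<^sub>i\<close> is
  bounded on the domain.
\<close>

lemma Poincare_test_function:
  assumes f: "f \<in> test_functions \<Omega>" and R: "\<And>x. x \<in> \<Omega> \<Longrightarrow> \<bar>x $ i\<bar> \<le> R"
  shows "(LINT x|M. (f x)\<^sup>2) \<le> 4 * R\<^sup>2 * (LINT x|M. (pderiv_at i f x)\<^sup>2)"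
proof -
  note fd = test_function_differentiable[OF f]
  have lin: "((\<lambda>x::real^'d. x $ i) has_derivative (\<lambda>v. v $ i)) (at x)" for x
    by (rule bounded_linear_imp_has_derivative[OF bounded_linear_vec_nth])
  then have xd: "(\<lambda>x::real^'d. x $ i) differentiable at x" for x by (auto simp: differentiable_def)
  have px: "pderiv_at i (\<lambda>x::real^'d. x $ i) x = 1" for x
    using pderiv_at_eq[OF lin] by simp
  have eq: "pderiv_at i (\<lambda>x. x $ i * f x) = (\<lambda>x. x $ i * pderiv_at i f x + f x)"
    by (intro ext) (simp add: pderiv_at_mult[OF xd fd(1)] px)
  have xc: "continuous_on UNIV (\<lambda>x::real^'d. x $ i)" by (intro continuous_intros)
  have int: "integrable M (\<lambda>x. x $ i * f x * pderiv_at i f x)" "integrable M (\<lambda>x. (f x)\<^sup>2)"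
    "integrable M (\<lambda>x. (pderiv_at i f x)\<^sup>2)"
    by (intro integrable_ess_bounded ess_bounded_continuous continuous_intros fd xc)+
  have "(LINT x|M. (x $ i * f x) * pderiv_at i f x) = - (LINT x|M. pderiv_at i (\<lambda>x. x $ i * f x) x * f x)"
  proof (rule integration_by_parts[OF f])
    show "(\<lambda>x. x $ i * f x) differentiable at x" for x by (intro differentiable_mult xd fd)
    show "continuous_on UNIV (pderiv_at i (\<lambda>x. x $ i * f x))"
      unfolding eq by (intro continuous_intros fd xc)
  qed
  also have "(\<lambda>x. pderiv_at i (\<lambda>x. x $ i * f x) x * f x) = (\<lambda>x. x $ i * f x * pderiv_at i f x + (f x)\<^sup>2)"
    unfolding eq by (simp add: fun_eq_iff power2_eq_square algebra_simps)
  finally have "(LINT x|M. (f x)\<^sup>2) = - 2 * (LINT x|M. x $ i * f x * pderiv_at i f x)"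
    using int by simp
  also have "\<dots> = (LINT x|M. - 2 * (x $ i * f x * pderiv_at i f x))" by simp
  also have "\<dots> \<le> (LINT x|M. 1 / 2 * (f x)\<^sup>2 + 2 * R\<^sup>2 * (pderiv_at i f x)\<^sup>2)"
  proof (rule integral_mono)
    fix x assume "x \<in> space M"
    then have "\<bar>x $ i\<bar> \<le> R" using R by (simp add: space_restrict_space)
    then have "(x $ i)\<^sup>2 \<le> R\<^sup>2" using abs_le_square_iff[of "x $ i" R] by linarith
    then have "2 * ((x $ i)\<^sup>2 * (pderiv_at i f x)\<^sup>2) \<le> 2 * (R\<^sup>2 * (pderiv_at i f x)\<^sup>2)"
      by (intro mult_left_mono mult_right_mono) auto
    moreover have "0 \<le> (f x + 2 * (x $ i * pderiv_at i f x))\<^sup>2 / 2" by simp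
    ultimately show "- 2 * (x $ i * f x * pderiv_at i f x) \<le> 1 / 2 * (f x)\<^sup>2 + 2 * R\<^sup>2 * (pderiv_at i f x)\<^sup>2"
      by (simp add: power2_eq_square algebra_simps)
  qed (use int in auto)
  also have "\<dots> = 1 / 2 * (LINT x|M. (f x)\<^sup>2) + 2 * R\<^sup>2 * (LINT x|M. (pderiv_at i f x)\<^sup>2)"
    using int by simp
  finally show ?thesis by simp
qed

lemma H10_H1: "u \<in> H10 \<Omega> \<Longrightarrow> u \<in> H1 \<Omega>"
  by (simp add: H10_def)

text \<open>
  If \<open>f\<^sub>n\<close> are test functions tending to \<open>u\<close>, then \<open>\<partial>\<^sub>i f\<^sub>n\<close> tends to \<open>\<partial>\<^sub>i u = 0\<close> in \<open>L\<^sup>2\<close>, so by the Poincare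
  inequality \<open>f\<^sub>n\<close> tends to \<open>0\<close>.
\<close>

lemma H10_directional_null:
  assumes u: "u \<in> H10 \<Omega>" and null: "AE x in M. grad \<Omega> u x $ i = 0"
  shows "AE x in M. u x = 0"
proof -
  obtain f where f: "\<And>n::nat. f n \<in> test_functions \<Omega>" and lim: "(\<lambda>n. H1_norm \<Omega> (\<lambda>x. f n x - u x)) \<longlonglongrightarrow> 0"
    using u unfolding H10_def by blast
  obtain R where R: "\<And>x. x \<in> \<Omega> \<Longrightarrow> norm x \<le> R" using bounded_domain unfolding bounded_iff by blast
  have Ri: "\<bar>x $ i\<bar> \<le> R" if "x \<in> \<Omega>" for x
    using component_le_norm_cart[of x i] R[OF that] by linarith
  have uL2: "u \<in> L2 M" and uH: "u \<in> H1 \<Omega>" using H1_L2 H10_H1[OF u] by auto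
  \<comment> \<open>This combines \<open>u\<^sup>2 \<le> 2 f\<^sub>n\<^sup>2 + 2 (f\<^sub>n - u)\<^sup>2\<close> with the Poincare inequality for \<open>f\<^sub>n\<close>.\<close>
  have bound: "(LINT x|M. (u x)\<^sup>2) \<le> (8 * R\<^sup>2 + 2) * (H1_norm \<Omega> (\<lambda>x. f n x - u x))\<^sup>2" for n
  proof -
    let ?w = "\<lambda>x. f n x - u x"
    note fH = H1_test_function[OF f[of n]]
    have w: "?w \<in> H1 \<Omega>" using H1_add(1)[OF fH(1) H1_scale(1)[OF uH, of "-1"]] by simp
    have "AE x in M. grad \<Omega> ?w x = grad \<Omega> (f n) x + grad \<Omega> (\<lambda>x. - u x) x"
      "AE x in M. grad \<Omega> (\<lambda>x. - u x) x = - grad \<Omega> u x"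
      using H1_add(2)[OF fH(1) H1_scale(1)[OF uH, of "-1"]] H1_scale(2)[OF uH, of "-1"] by simp_all
    then have "AE x in M. grad \<Omega> ?w x = grad \<Omega> (f n) x - grad \<Omega> u x"
      by eventually_elim simp
    then have gw: "AE x in M. grad \<Omega> ?w x $ i = pderiv_at i (f n) x"
      using fH(2) null by eventually_elim simp
    have wL2: "?w \<in> L2 M" "grad \<Omega> ?w \<in> L2 M" using H1_L2[OF w] by auto
    have fL2: "f n \<in> L2 M" "pderiv_at i (f n) \<in> L2 M" using L2_test_function[OF f] by auto
    have H1: "(H1_norm \<Omega> ?w)\<^sup>2 = (LINT x|M. (?w x)\<^sup>2) + (LINT x|M. (norm (grad \<Omega> ?w x))\<^sup>2)"
      by (simp add: H1_norm_def L2_norm_sq)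
    have "(LINT x|M. (pderiv_at i (f n) x)\<^sup>2) \<le> (LINT x|M. (norm (grad \<Omega> ?w x))\<^sup>2)"
    proof (rule integral_mono_AE)
      show "AE x in M. (pderiv_at i (f n) x)\<^sup>2 \<le> (norm (grad \<Omega> ?w x))\<^sup>2"
        using gw
      proof eventually_elim
        case (elim x)
        have "\<bar>grad \<Omega> ?w x $ i\<bar> \<le> \<bar>norm (grad \<Omega> ?w x)\<bar>" using component_le_norm_cart by simp
        then show ?case unfolding elim[symmetric] by (simp only: abs_le_square_iff)
      qed
    qed (use fL2 wL2 in \<open>auto simp: L2_def\<close>)
    then have d: "(LINT x|M. (pderiv_at i (f n) x)\<^sup>2) \<le> (H1_norm \<Omega> ?w)\<^sup>2"
      and w2: "(LINT x|M. (?w x)\<^sup>2) \<le> (H1_norm \<Omega> ?w)\<^sup>2"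
      unfolding H1 by (auto intro: add_increasing)
    have "(LINT x|M. (u x)\<^sup>2) \<le> (LINT x|M. 2 * (f n x)\<^sup>2 + 2 * (?w x)\<^sup>2)"
    proof (rule integral_mono)
      fix x
      have "0 \<le> (2 * f n x - u x)\<^sup>2" by simp
      then show "(u x)\<^sup>2 \<le> 2 * (f n x)\<^sup>2 + 2 * (?w x)\<^sup>2" by (simp add: power2_eq_square algebra_simps)
    qed (use uL2 fL2 wL2 in \<open>auto simp: L2_def\<close>)
    also have "\<dots> = 2 * (LINT x|M. (f n x)\<^sup>2) + 2 * (LINT x|M. (?w x)\<^sup>2)"
      using fL2 wL2 by (simp add: L2_def)
    also have "\<dots> \<le> 2 * (4 * R\<^sup>2 * (H1_norm \<Omega> ?w)\<^sup>2) + 2 * (H1_norm \<Omega> ?w)\<^sup>2"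
    proof (intro add_mono mult_left_mono)
      have "(LINT x|M. (f n x)\<^sup>2) \<le> 4 * R\<^sup>2 * (LINT x|M. (pderiv_at i (f n) x)\<^sup>2)"
        by (rule Poincare_test_function[OF f Ri])
      also have "\<dots> \<le> 4 * R\<^sup>2 * (H1_norm \<Omega> ?w)\<^sup>2" using d by (intro mult_left_mono) auto
      finally show "(LINT x|M. (f n x)\<^sup>2) \<le> 4 * R\<^sup>2 * (H1_norm \<Omega> ?w)\<^sup>2" .
    qed (use w2 in auto)
    finally show ?thesis by (simp add: algebra_simps)
  qed
  have "(\<lambda>n. (8 * R\<^sup>2 + 2) * (H1_norm \<Omega> (\<lambda>x. f n x - u x))\<^sup>2) \<longlonglongrightarrow> (8 * R\<^sup>2 + 2) * 0\<^sup>2"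
    by (intro tendsto_intros lim)
  from LIMSEQ_le_const[OF this, of "LINT x|M. (u x)\<^sup>2"] have "(LINT x|M. (u x)\<^sup>2) \<le> 0" using bound by auto
  moreover have "0 \<le> (LINT x|M. (u x)\<^sup>2)" by (intro integral_nonneg_AE AE_I2) simp
  ultimately have "(LINT x|M. (u x)\<^sup>2) = 0" by simp
  moreover have "integrable M (\<lambda>x. (u x)\<^sup>2)" using uL2 by (simp add: L2_def)
  ultimately have "AE x in M. (u x)\<^sup>2 = 0" by (subst (asm) integral_nonneg_eq_0_iff_AE) auto
  then show ?thesis by eventually_elim simp
qed

end

section \<open>Finite-dimensional function spaces\<close>

definition finitely_spanned :: "'a measure \<Rightarrow> ('a \<Rightarrow> 'b::real_vector) set \<Rightarrow> bool" where
  "finitely_spanned M V \<longleftrightarrow> (\<exists>b (n::nat). (\<forall>i<n. b i \<in> V) \<and>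
    (\<forall>u\<in>V. \<exists>a. AE x in M. u x = (\<Sum>i<n. a i *\<^sub>R b i x)))"

lemma fin_dim_space_function_space:
  assumes "fin_dim_space M V"
  shows "function_space V"
  using assms by unfold_locales (auto simp: fin_dim_space_def)

lemma fin_dim_space_finitely_spanned:
  assumes "fin_dim_space M V"
  shows "finitely_spanned M V"
proof -
  obtain b and n :: nat where "\<And>i. i < n \<Longrightarrow> b i \<in> V"
    "\<And>f. f \<in> V \<Longrightarrow> \<exists>a. AE x in M. f x = (\<Sum>i<n. a i *\<^sub>R b i x)"
    by (rule fin_dim_space_spanE[OF assms]) blast
  then show ?thesis unfolding finitely_spanned_def by blast
qed

lemma function_space_kernel:
  assumes "function_space V"
    and "\<And>f g. f \<in> V \<Longrightarrow> g \<in> V \<Longrightarrow> l (\<lambda>x. f x + g x) = l f + (l g :: real)"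
    and "\<And>f a. f \<in> V \<Longrightarrow> l (\<lambda>x. a *\<^sub>R f x) = a * l f"
  shows "function_space {u \<in> V. l u = 0}"
proof -
  interpret function_space V by fact
  have "l (\<lambda>x. 0) = 0" using assms(3)[OF zero_in, of 0] by simp
  then show ?thesis by unfold_locales (use assms zero_in add_in scale_in in auto)
qed

text \<open>
  A generator \<open>b k\<close> outside the kernel is used to correct the others: \<open>b i - (l (b i) / l (b k)) b k\<close>
  lies in the kernel, and the corrections cancel in every combination that lies in the kernel.
\<close>

lemma finitely_spanned_kernel:
  assumes V: "function_space V" and span: "finitely_spanned M V"
    and l_add: "\<And>f g. f \<in> V \<Longrightarrow> g \<in> V \<Longrightarrow> l (\<lambda>x. f x + g x) = l f + (l g :: real)"
    and l_scale: "\<And>f a. f \<in> V \<Longrightarrow> l (\<lambda>x. a *\<^sub>R f x) = a * l f"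
    and l_cong: "\<And>f g. f \<in> V \<Longrightarrow> g \<in> V \<Longrightarrow> AE x in M. f x = g x \<Longrightarrow> l f = l g"
  shows "finitely_spanned M {u \<in> V. l u = 0}"
proof -
  interpret function_space V by fact
  obtain b and n :: nat where b: "\<And>i. i < n \<Longrightarrow> b i \<in> V"
    and sp: "\<And>u. u \<in> V \<Longrightarrow> \<exists>a. AE x in M. u x = (\<Sum>i<n. a i *\<^sub>R b i x)"
    using span unfolding finitely_spanned_def by blast
  have l_sum: "l (\<lambda>x. \<Sum>i<n. a i *\<^sub>R b i x) = (\<Sum>i<n. a i * l (b i))" for a
    by (rule linear_sum) (use l_add l_scale b in auto)
  show ?thesis
  proof (cases "\<forall>i<n. l (b i) = 0")
    case True
    then show ?thesis unfolding finitely_spanned_def using b sp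
      by (intro exI[of _ b] exI[of _ n]) auto
  next
    case False
    then obtain k where k: "k < n" "l (b k) \<noteq> 0" by blast
    define b' where "b' i = (\<lambda>x. b i x + (- (l (b i) / l (b k))) *\<^sub>R b k x)" for i
    have b': "b' i \<in> V \<and> l (b' i) = 0" if "i < n" for i
      unfolding b'_def using that k b
      by (auto simp: l_add[OF b scale_in[OF b]] l_scale[OF b] intro!: add_in scale_in
          simp del: scaleR_minus_left)
    have "\<exists>a. AE x in M. u x = (\<Sum>i<n. a i *\<^sub>R b' i x)" if u: "u \<in> V" "l u = 0" for u
    proof -
      obtain a where a: "AE x in M. u x = (\<Sum>i<n. a i *\<^sub>R b i x)" using sp[OF u(1)] by blast
      have "l u = (\<Sum>i<n. a i * l (b i))"
        unfolding l_sum[symmetric] by (rule l_cong[OF u(1) sum_in[OF b] a])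
      then have zero: "(\<Sum>i<n. a i * (l (b i) / l (b k))) = 0"
        using u(2) by (simp add: sum_divide_distrib[symmetric])
      have "(\<Sum>i<n. a i *\<^sub>R b' i x) = (\<Sum>i<n. a i *\<^sub>R b i x)" for x
      proof -
        have "(\<Sum>i<n. a i *\<^sub>R b' i x) = (\<Sum>i<n. a i *\<^sub>R b i x) - (\<Sum>i<n. a i * (l (b i) / l (b k))) *\<^sub>R b k x"
          by (simp add: b'_def scaleR_diff_right scaleR_sum_left sum_subtractf)
        then show ?thesis using zero by simp
      qed
      with a show ?thesis by (intro exI[of _ a]) simp
    qed
    then show ?thesis unfolding finitely_spanned_def using b' by (intro exI[of _ b'] exI[of _ n]) auto
  qed
qed

lemma finitely_spanned_kernels:
  fixes k :: nat
  assumes V: "function_space V" and span: "finitely_spanned M V"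
    and l_add: "\<And>j f g. f \<in> V \<Longrightarrow> g \<in> V \<Longrightarrow> l j (\<lambda>x. f x + g x) = l j f + (l j g :: real)"
    and l_scale: "\<And>j f a. f \<in> V \<Longrightarrow> l j (\<lambda>x. a *\<^sub>R f x) = a * l j f"
    and l_cong: "\<And>j f g. f \<in> V \<Longrightarrow> g \<in> V \<Longrightarrow> AE x in M. f x = g x \<Longrightarrow> l j f = l j g"
  shows "function_space {u \<in> V. \<forall>j<k. l j u = 0} \<and> finitely_spanned M {u \<in> V. \<forall>j<k. l j u = 0}"
proof (induction k)
  case 0
  then show ?case using V span by simp
next
  case (Suc k)
  let ?V = "{u \<in> V. \<forall>j<k. l j u = 0}"
  have eq: "{u \<in> V. \<forall>j<Suc k. l j u = 0} = {u \<in> ?V. l k u = 0}" by (auto simp: less_Suc_eq)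
  have V': "function_space ?V" "finitely_spanned M ?V" using Suc by auto
  have lk: "l k (\<lambda>x. f x + g x) = l k f + l k g" "l k (\<lambda>x. a *\<^sub>R f x) = a * l k f"
    "AE x in M. f x = g x \<Longrightarrow> l k f = l k g" if "f \<in> ?V" "g \<in> ?V" for f g a
    using that by (blast intro: l_add l_scale l_cong)+
  have "function_space {u \<in> ?V. l k u = 0}"
    by (rule function_space_kernel[OF V'(1)]) (rule lk; assumption)+
  moreover have "finitely_spanned M {u \<in> ?V. l k u = 0}"
    by (rule finitely_spanned_kernel[OF V']) (rule lk; assumption)+
  ultimately show ?case unfolding eq by simp
qed

section \<open>The two settings\<close>

context bounded_domain
begin

lemma bounded_functional_null:
  assumes "bounded_functional V nrm F" "f \<in> V" "nrm f = 0"
  shows "F f = 0"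
  using assms unfolding bounded_functional_def by fastforce

text \<open>
  A function in \<open>H\<^sup>1\<^sub>0\<close> with vanishing gradient has \<open>H\<^sup>1\<close> norm \<open>0\<close>, and this norm bounds \<open>F\<close>.
\<close>

lemma discrete_flow_scalar:
  assumes nonempty: "\<Omega> \<noteq> {}" and phi: "N_function \<phi>" "C3_on_pos \<phi>"
    and setting: "scalar_setting \<Omega> C U F"
  shows "discrete_flow M (mu \<phi>) C U (grad \<Omega>) F"
proof -
  have C: "fin_dim_space M C" "C \<subseteq> Linf M" and U: "fin_dim_space M U" "U \<subseteq> H10 \<Omega>"
    and sq: "\<And>u. u \<in> U \<Longrightarrow> (\<lambda>x. (norm (grad \<Omega> u x))\<^sup>2) \<in> C"
    and F: "bounded_functional (H10 \<Omega>) (H1_norm \<Omega>) F"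
    using setting by (auto simp: scalar_setting_def)
  interpret U: function_space U by (rule fin_dim_space_function_space[OF U(1)])
  have H1: "u \<in> H1 \<Omega>" if "u \<in> U" for u using that U(2) H10_H1 by blast
  obtain b and n :: nat where b: "\<And>i. i < n \<Longrightarrow> b i \<in> U"
    and span: "\<And>u. u \<in> U \<Longrightarrow> \<exists>a. AE x in M. u x = (\<Sum>i<n. a i *\<^sub>R b i x)"
    by (rule fin_dim_space_spanE[OF U(1)]) blast
  have D_span: "\<exists>a. AE x in M. grad \<Omega> u x = (\<Sum>i<n. a i *\<^sub>R grad \<Omega> (b i) x)" if u: "u \<in> U" for u
  proof -
    obtain a where a: "AE x in M. u x = (\<Sum>i<n. a i *\<^sub>R b i x)" using span[OF u] by blast
    have s: "(\<lambda>x. \<Sum>i<n. a i * b i x) \<in> H1 \<Omega>"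
      "AE x in M. grad \<Omega> (\<lambda>x. \<Sum>i<n. a i * b i x) x = (\<Sum>i<n. a i *\<^sub>R grad \<Omega> (b i) x)"
      using H1_sum[of n b a] H1[OF b] by auto
    have "AE x in M. grad \<Omega> u x = grad \<Omega> (\<lambda>x. \<Sum>i<n. a i * b i x) x"
      using H1_grad_cong[OF H1[OF u] s(1)] a by simp
    with s(2) have "AE x in M. grad \<Omega> u x = (\<Sum>i<n. a i *\<^sub>R grad \<Omega> (b i) x)" by eventually_elim simp
    then show ?thesis by blast
  qed
  have F_null: "F u = 0" if u: "u \<in> U" "AE x in M. grad \<Omega> u x = 0" for u
  proof -
    have "AE x in M. grad \<Omega> u x $ i = 0" for i using u(2) by eventually_elim simp
    then have "AE x in M. u x = 0" using H10_directional_null U(2) u(1) by blast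
    then have "H1_norm \<Omega> u = 0" by (rule H1_norm_null[OF H1[OF u(1)]])
    then show ?thesis using bounded_functional_null[OF F] U(2) u(1) by blast
  qed
  show ?thesis
  proof (intro discrete_flow.intro discrete_flow_axioms.intro)
    show "finite_measure M" by (rule finite_measure_axioms)
    show "\<exists>b (n::nat). (\<forall>i<n. b i \<in> U) \<and> (\<forall>u\<in>U. \<exists>a. AE x in M. grad \<Omega> u x = (\<Sum>i<n. a i *\<^sub>R grad \<Omega> (b i) x))"
      using b D_span by blast
    show "AE x in M. grad \<Omega> (\<lambda>x. u x + v x) x = grad \<Omega> u x + grad \<Omega> v x" if "u \<in> U" "v \<in> U" for u v
      by (rule H1_add(2)[OF H1[OF that(1)] H1[OF that(2)]])
    show "AE x in M. grad \<Omega> (\<lambda>x. a *\<^sub>R u x) x = a *\<^sub>R grad \<Omega> u x" if "u \<in> U" for u a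
      using H1_scale(2)[OF H1[OF that]] by simp
    show "grad \<Omega> u \<in> borel_measurable M" if "u \<in> U" for u
      using H1_L2(2)[OF H1[OF that]] by (simp add: L2_def)
    show "F (\<lambda>x. u x + v x) = F u + F v" if "u \<in> U" "v \<in> U" for u v
      using F U(2) that unfolding bounded_functional_def by blast
    show "F (\<lambda>x. a *\<^sub>R u x) = a * F u" if "u \<in> U" for u a
      using F U(2) that unfolding bounded_functional_def by blast
    show "complete_measure M" by (rule complete_domain)
    show "emeasure M (space M) \<noteq> 0" by (rule domain_nontrivial[OF nonempty])
    show "viscosity (mu \<phi>)" by (rule viscosity_mu[OF phi])
  qed (use C sq U.zero_in U.add_in U.scale_in F_null in auto)
qed

lemma grad_vec_component: "grad_vec \<Omega> u x $ i = grad \<Omega> (\<lambda>y. u y $ i) x"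
  by (simp add: grad_vec_def)

lemma H10_vec_H1: "u \<in> H10_vec \<Omega> \<Longrightarrow> (\<lambda>x. u x $ i) \<in> H1 \<Omega>"
  by (simp add: H10_vec_def H10_H1)

lemma AE_vec_eqI:
  fixes f g :: "'a \<Rightarrow> 'b^'n::finite"
  assumes "\<And>i. AE x in N. f x $ i = g x $ i"
  shows "AE x in N. f x = g x"
proof -
  have "AE x in N. \<forall>i\<in>UNIV. f x $ i = g x $ i" using assms by (intro AE_finite_allI) auto
  then show ?thesis by eventually_elim (simp add: vec_eq_iff)
qed

lemma grad_vec_add:
  assumes "u \<in> H10_vec \<Omega>" "v \<in> H10_vec \<Omega>"
  shows "AE x in M. grad_vec \<Omega> (\<lambda>x. u x + v x) x = grad_vec \<Omega> u x + grad_vec \<Omega> v x"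
proof (rule AE_vec_eqI)
  show "AE x in M. grad_vec \<Omega> (\<lambda>x. u x + v x) x $ i = (grad_vec \<Omega> u x + grad_vec \<Omega> v x) $ i" for i
    using H1_add(2)[OF H10_vec_H1[OF assms(1), of i] H10_vec_H1[OF assms(2), of i]]
    by eventually_elim (simp add: grad_vec_component)
qed

lemma grad_vec_scale:
  assumes "u \<in> H10_vec \<Omega>"
  shows "AE x in M. grad_vec \<Omega> (\<lambda>x. a *\<^sub>R u x) x = a *\<^sub>R grad_vec \<Omega> u x"
proof (rule AE_vec_eqI)
  show "AE x in M. grad_vec \<Omega> (\<lambda>x. a *\<^sub>R u x) x $ i = (a *\<^sub>R grad_vec \<Omega> u x) $ i" for i
    using H1_scale(2)[OF H10_vec_H1[OF assms(1), of i], of a]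
    by eventually_elim (simp add: grad_vec_component)
qed

lemma grad_vec_cong:
  assumes "u \<in> H10_vec \<Omega>" "v \<in> H10_vec \<Omega>" "AE x in M. u x = v x"
  shows "AE x in M. grad_vec \<Omega> u x = grad_vec \<Omega> v x"
proof (rule AE_vec_eqI)
  fix i
  have "AE x in M. u x $ i = v x $ i" using assms(3) by eventually_elim simp
  from H1_grad_cong[OF H10_vec_H1[OF assms(1)] H10_vec_H1[OF assms(2)] this]
  show "AE x in M. grad_vec \<Omega> u x $ i = grad_vec \<Omega> v x $ i"
    by eventually_elim (simp add: grad_vec_component)
qed

lemma grad_vec_sum:
  fixes n :: nat
  assumes "u \<in> H10_vec \<Omega>" "\<And>i. i < n \<Longrightarrow> b i \<in> H10_vec \<Omega>" "AE x in M. u x = (\<Sum>i<n. a i *\<^sub>R b i x)"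
  shows "AE x in M. grad_vec \<Omega> u x = (\<Sum>i<n. a i *\<^sub>R grad_vec \<Omega> (b i) x)"
proof (rule AE_vec_eqI)
  fix j
  let ?s = "\<lambda>x. \<Sum>i<n. a i * b i x $ j"
  have s: "?s \<in> H1 \<Omega>" "AE x in M. grad \<Omega> ?s x = (\<Sum>i<n. a i *\<^sub>R grad \<Omega> (\<lambda>x. b i x $ j) x)"
    using H1_sum[of n "\<lambda>i x. b i x $ j" a] H10_vec_H1[OF assms(2)] by auto
  have "AE x in M. u x $ j = ?s x" using assms(3) by eventually_elim simp
  from H1_grad_cong[OF H10_vec_H1[OF assms(1)] s(1) this] s(2)
  show "AE x in M. grad_vec \<Omega> u x $ j = (\<Sum>i<n. a i *\<^sub>R grad_vec \<Omega> (b i) x) $ j"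
    by eventually_elim (simp add: grad_vec_component)
qed

lemma sym_grad_component: "sym_grad \<Omega> u x $ i $ j = (grad_vec \<Omega> u x $ i $ j + grad_vec \<Omega> u x $ j $ i) / 2"
  by (simp add: sym_grad_def transpose_def)

lemma grad_vec_L2:
  assumes "u \<in> H10_vec \<Omega>"
  shows "(\<lambda>x. grad_vec \<Omega> u x $ i $ j) \<in> L2 M"
  unfolding grad_vec_component by (intro L2_component H1_L2 H10_vec_H1[OF assms])

lemma sym_grad_measurable:
  assumes "u \<in> H10_vec \<Omega>"
  shows "sym_grad \<Omega> u \<in> borel_measurable M"
proof (subst borel_measurable_euclidean_space, rule ballI)
  fix b :: "real^'d^'d" assume "b \<in> Basis"
  then obtain i j where b: "b = axis i (axis j 1)" by (auto simp: Basis_vec_def)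
  have "(\<lambda>x. grad_vec \<Omega> u x $ i $ j) \<in> borel_measurable M" for i j
    using grad_vec_L2[OF assms] by (simp add: L2_def)
  then have "(\<lambda>x. (grad_vec \<Omega> u x $ i $ j + grad_vec \<Omega> u x $ j $ i) / 2) \<in> borel_measurable M"
    by (intro borel_measurable_divide borel_measurable_add) auto
  then show "(\<lambda>x. sym_grad \<Omega> u x \<bullet> b) \<in> borel_measurable M"
    by (simp add: b inner_axis sym_grad_component)
qed

lemma divergence_L2:
  assumes "u \<in> H10_vec \<Omega>"
  shows "divergence \<Omega> u \<in> L2 M"
proof -
  have "(\<lambda>x. \<Sum>i\<in>I. grad_vec \<Omega> u x $ i $ i) \<in> L2 M" if "finite I" for I
    using that
  proof induction
    case empty
    then show ?case by (simp add: L2_def)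
  next
    case (insert i I)
    then show ?case using L2_add[OF grad_vec_L2[OF assms, of i i]] by simp
  qed
  then show ?thesis by (simp add: divergence_def[abs_def] trace_def)
qed

text \<open>
  The discretely divergence-free functions form the kernel of finitely many functionals, one for each
  generator of \<open>Q\<close>, and hence a finitely spanned space.  If \<open>\<epsilon>(u) = 0\<close>, its diagonal gives
  \<open>\<partial>\<^sub>i u\<^sub>i = 0\<close> for every \<open>i\<close>, so every component vanishes.
\<close>

lemma discrete_flow_vector:
  assumes nonempty: "\<Omega> \<noteq> {}" and phi: "N_function \<phi>" "C3_on_pos \<phi>"
    and setting: "vector_setting \<Omega> (mu \<phi>) C U Q F"
  shows "discrete_flow M (mu \<phi>) C (div_free \<Omega> U Q) (sym_grad \<Omega>) F"
proof -
  have C: "fin_dim_space M C" "C \<subseteq> Linf M" and U: "fin_dim_space M U" "U \<subseteq> H10_vec \<Omega>"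
    and Q: "fin_dim_space M Q" "Q \<subseteq> L2_mean_zero M"
    and sq: "\<And>u. u \<in> U \<Longrightarrow> (\<lambda>x. (norm (sym_grad \<Omega> u x))\<^sup>2) \<in> C"
    and F: "bounded_functional (H10_vec \<Omega>) (H1_norm_vec \<Omega>) F"
    using setting by (auto simp: vector_setting_def)
  have QL2: "q \<in> L2 M" if "q \<in> Q" for q using that Q(2) by (auto simp: L2_mean_zero_def)
  have int: "integrable M (\<lambda>x. q x * divergence \<Omega> u x)" if "q \<in> Q" "u \<in> U" for q u
    using that U(2) by (intro integrable_L2_mult QL2 divergence_L2) auto
  obtain qs and k :: nat where qs: "\<And>i. i < k \<Longrightarrow> qs i \<in> Q"
    and Q_span: "\<And>q. q \<in> Q \<Longrightarrow> \<exists>a. AE x in M. q x = (\<Sum>i<k. a i *\<^sub>R qs i x)"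
    by (rule fin_dim_space_spanE[OF Q(1)]) blast
  \<comment> \<open>Trivial for \<open>j \<ge> k\<close>, so that linearity holds for every index.\<close>
  define l where "l j u = (if j < k then LINT x|M. qs j x * divergence \<Omega> u x else 0)" for j u
  have W_eq: "div_free \<Omega> U Q = {u \<in> U. \<forall>j<k. l j u = 0}"
  proof (intro equalityI subsetI)
    show "u \<in> {u \<in> U. \<forall>j<k. l j u = 0}" if "u \<in> div_free \<Omega> U Q" for u
      using that qs by (auto simp: div_free_def l_def)
    fix u assume "u \<in> {u \<in> U. \<forall>j<k. l j u = 0}"
    then have u: "u \<in> U" and zero: "\<And>j. j < k \<Longrightarrow> (LINT x|M. qs j x * divergence \<Omega> u x) = 0"
      by (auto simp: l_def)
    have "(LINT x|M. q x * divergence \<Omega> u x) = 0" if q: "q \<in> Q" for q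
    proof -
      obtain a where a: "AE x in M. q x = (\<Sum>i<k. a i *\<^sub>R qs i x)" using Q_span[OF q] by blast
      have "(LINT x|M. q x * divergence \<Omega> u x) = (\<Sum>j<k. a j * (LINT x|M. qs j x * divergence \<Omega> u x))"
      proof (rule integral_AE_sum)
        show "AE x in M. q x * divergence \<Omega> u x = (\<Sum>j<k. a j * (qs j x * divergence \<Omega> u x))"
          using a by eventually_elim (simp add: sum_distrib_right mult.assoc)
        show "(\<lambda>x. q x * divergence \<Omega> u x) \<in> borel_measurable M" by (intro borel_measurable_integrable int q u)
        show "integrable M (\<lambda>x. qs j x * divergence \<Omega> u x)" if "j < k" for j by (intro int qs u that)
      qed
      then show ?thesis using zero by simp
    qed
    then show "u \<in> div_free \<Omega> U Q" using u by (simp add: div_free_def)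
  qed
  have U_space: "function_space U" by (rule fin_dim_space_function_space[OF U(1)])
  then interpret U: function_space U .
  have vec: "u \<in> H10_vec \<Omega>" if "u \<in> U" for u using U(2) that by blast
  have l_add: "l j (\<lambda>x. u x + v x) = l j u + l j v" if u: "u \<in> U" and v: "v \<in> U" for j u v
  proof (cases "j < k")
    case True
    have "(LINT x|M. qs j x * divergence \<Omega> (\<lambda>x. u x + v x) x)
        = (LINT x|M. qs j x * divergence \<Omega> u x + qs j x * divergence \<Omega> v x)"
    proof (rule integral_cong_AE)
      show "AE x in M. qs j x * divergence \<Omega> (\<lambda>x. u x + v x) x
          = qs j x * divergence \<Omega> u x + qs j x * divergence \<Omega> v x"
        using grad_vec_add[OF vec[OF u] vec[OF v]]
        by eventually_elim (simp add: divergence_def trace_def sum.distrib distrib_left)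
    qed (intro borel_measurable_integrable Bochner_Integration.integrable_add int qs True U.add_in u v)+
    then show ?thesis using True int[OF qs[OF True]] u v by (simp add: l_def)
  qed (simp add: l_def)
  have l_scale: "l j (\<lambda>x. a *\<^sub>R u x) = a * l j u" if u: "u \<in> U" for j u a
  proof (cases "j < k")
    case True
    have "(LINT x|M. qs j x * divergence \<Omega> (\<lambda>x. a *\<^sub>R u x) x) = (LINT x|M. a * (qs j x * divergence \<Omega> u x))"
    proof (rule integral_cong_AE)
      show "AE x in M. qs j x * divergence \<Omega> (\<lambda>x. a *\<^sub>R u x) x = a * (qs j x * divergence \<Omega> u x)"
        using grad_vec_scale[OF vec[OF u], of a]
        by eventually_elim (simp add: divergence_def trace_def sum_distrib_left mult.left_commute)
    qed (intro borel_measurable_integrable integrable_mult_right int qs True U.scale_in u)+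
    then show ?thesis using True by (simp add: l_def)
  qed (simp add: l_def)
  have l_cong: "l j u = l j v" if u: "u \<in> U" and v: "v \<in> U" and eq: "AE x in M. u x = v x" for j u v
  proof (cases "j < k")
    case True
    have "(LINT x|M. qs j x * divergence \<Omega> u x) = (LINT x|M. qs j x * divergence \<Omega> v x)"
    proof (rule integral_cong_AE)
      show "AE x in M. qs j x * divergence \<Omega> u x = qs j x * divergence \<Omega> v x"
        using grad_vec_cong[OF vec[OF u] vec[OF v] eq] by eventually_elim (simp add: divergence_def)
    qed (intro borel_measurable_integrable int qs True u v)+
    then show ?thesis using True by (simp add: l_def)
  qed (simp add: l_def)
  have "function_space (div_free \<Omega> U Q) \<and> finitely_spanned M (div_free \<Omega> U Q)"
    unfolding W_eq
    by (rule finitely_spanned_kernels[OF U_space fin_dim_space_finitely_spanned[OF U(1)] l_add l_scale l_cong])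
  then interpret W: function_space "div_free \<Omega> U Q" by simp
  have W: "u \<in> U" "u \<in> H10_vec \<Omega>" if "u \<in> div_free \<Omega> U Q" for u
    using that vec by (auto simp: div_free_def)
  obtain b and n :: nat where b: "\<And>i. i < n \<Longrightarrow> b i \<in> div_free \<Omega> U Q"
    and span: "\<And>u. u \<in> div_free \<Omega> U Q \<Longrightarrow> \<exists>a. AE x in M. u x = (\<Sum>i<n. a i *\<^sub>R b i x)"
    using \<open>_ \<and> finitely_spanned M (div_free \<Omega> U Q)\<close> unfolding finitely_spanned_def by blast
  have D_span: "\<exists>a. AE x in M. sym_grad \<Omega> u x = (\<Sum>i<n. a i *\<^sub>R sym_grad \<Omega> (b i) x)"
    if u: "u \<in> div_free \<Omega> U Q" for u
  proof -
    obtain a where a: "AE x in M. u x = (\<Sum>i<n. a i *\<^sub>R b i x)" using span[OF u] by blast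
    have "AE x in M. grad_vec \<Omega> u x = (\<Sum>i<n. a i *\<^sub>R grad_vec \<Omega> (b i) x)"
      by (rule grad_vec_sum[OF _ _ a]) (use W b u in auto)
    then have "AE x in M. sym_grad \<Omega> u x = (\<Sum>i<n. a i *\<^sub>R sym_grad \<Omega> (b i) x)"
      by eventually_elim
        (simp add: vec_eq_iff sym_grad_component sum_divide_distrib[symmetric] distrib_left sum.distrib)
    then show ?thesis by blast
  qed
  have F_null: "F u = 0" if u: "u \<in> div_free \<Omega> U Q" "AE x in M. sym_grad \<Omega> u x = 0" for u
  proof -
    have "H1_norm \<Omega> (\<lambda>x. u x $ i) = 0" for i
    proof (rule H1_norm_null)
      show "(\<lambda>x. u x $ i) \<in> H1 \<Omega>" by (rule H10_vec_H1[OF W(2)[OF u(1)]])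
      have comp: "(\<lambda>x. u x $ i) \<in> H10 \<Omega>" using W(2)[OF u(1)] by (simp add: H10_vec_def)
      have null: "AE x in M. grad \<Omega> (\<lambda>x. u x $ i) x $ i = 0"
        using u(2)
      proof eventually_elim
        case (elim x)
        then have "sym_grad \<Omega> u x $ i $ i = 0" by simp
        then show ?case by (simp add: sym_grad_component grad_vec_component)
      qed
      show "AE x in M. u x $ i = 0" by (rule H10_directional_null[OF comp null])
    qed
    then have "H1_norm_vec \<Omega> u = 0" by (simp add: H1_norm_vec_def)
    then show ?thesis using bounded_functional_null[OF F] W(2)[OF u(1)] by blast
  qed
  show ?thesis
  proof (intro discrete_flow.intro discrete_flow_axioms.intro)
    show "finite_measure M" by (rule finite_measure_axioms)
    show "\<exists>b (n::nat). (\<forall>i<n. b i \<in> div_free \<Omega> U Q) \<and>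
        (\<forall>u\<in>div_free \<Omega> U Q. \<exists>a. AE x in M. sym_grad \<Omega> u x = (\<Sum>i<n. a i *\<^sub>R sym_grad \<Omega> (b i) x))"
      using b D_span by blast
    show "AE x in M. sym_grad \<Omega> (\<lambda>x. u x + v x) x = sym_grad \<Omega> u x + sym_grad \<Omega> v x"
      if "u \<in> div_free \<Omega> U Q" "v \<in> div_free \<Omega> U Q" for u v
      using grad_vec_add[OF W(2)[OF that(1)] W(2)[OF that(2)]]
      by eventually_elim (simp add: vec_eq_iff sym_grad_component add_divide_distrib)
    show "AE x in M. sym_grad \<Omega> (\<lambda>x. a *\<^sub>R u x) x = a *\<^sub>R sym_grad \<Omega> u x" if "u \<in> div_free \<Omega> U Q" for u a
      using grad_vec_scale[OF W(2)[OF that], of a]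
      by eventually_elim (simp add: vec_eq_iff sym_grad_component distrib_left)
    show "sym_grad \<Omega> u \<in> borel_measurable M" if "u \<in> div_free \<Omega> U Q" for u
      by (rule sym_grad_measurable[OF W(2)[OF that]])
    show "F (\<lambda>x. u x + v x) = F u + F v" if "u \<in> div_free \<Omega> U Q" "v \<in> div_free \<Omega> U Q" for u v
      using F W that unfolding bounded_functional_def by blast
    show "F (\<lambda>x. a *\<^sub>R u x) = a * F u" if "u \<in> div_free \<Omega> U Q" for u a
      using F W that unfolding bounded_functional_def by blast
    show "complete_measure M" by (rule complete_domain)
    show "emeasure M (space M) \<noteq> 0" by (rule domain_nontrivial[OF nonempty])
    show "viscosity (mu \<phi>)" by (rule viscosity_mu[OF phi])
  qed (use C sq W.zero_in W.add_in W.scale_in W F_null in auto)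
qed

end

theorem theorem4p3:
  fixes \<Omega> :: "(real^'d) set" and \<phi> :: "real \<Rightarrow> real"
  assumes "CARD('d) = 2 \<or> CARD('d) = 3"
    and "open \<Omega>" and "bounded \<Omega>" and "connected \<Omega>" and "\<Omega> \<noteq> {}"
    and "standing_assumptions \<phi>"
    and "(strictly_convex_on {0<..} (Phi \<phi>) \<and> (\<forall>r>0. deriv (mu \<phi>) r > 0)) \<or>
         (strictly_concave_on {0<..} (Phi \<phi>) \<and> (\<forall>r>0. deriv (mu \<phi>) r < 0))"
    and "0 < S_minus \<phi>" and "S_minus \<phi> \<le> S_plus \<phi>" and "S_plus \<phi> < \<infinity>"
  shows
    "(\<forall>C U F. scalar_setting \<Omega> C U F \<longrightarrow>
        (\<forall>c0\<in>positive_part (lebesgue_on \<Omega>) C.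
           well_posed (lebesgue_on \<Omega>) (mu \<phi>) C U (grad \<Omega>) F c0)) \<and>
     (\<forall>C U Q F. vector_setting \<Omega> (mu \<phi>) C U Q F \<longrightarrow>
        (\<forall>c0\<in>positive_part (lebesgue_on \<Omega>) C.
           well_posed (lebesgue_on \<Omega>) (mu \<phi>) C (div_free \<Omega> U Q) (sym_grad \<Omega>) F c0))"
proof -
  interpret bounded_domain \<Omega> using assms(2,3) by unfold_locales
  have phi: "N_function \<phi>" "C3_on_pos \<phi>" using assms(6) by (auto simp: standing_assumptions_def)
  show ?thesis
    using discrete_flow.well_posed[OF discrete_flow_scalar[OF assms(5) phi]]
      discrete_flow.well_posed[OF discrete_flow_vector[OF assms(5) phi]] by blast
qed

end
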